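(* Let $\Omega \subset \mathbb{R}^d$ be a bounded domain, let $D \subset \partial\Omega$ be a closed part of the boundary and let $p \in (1,\infty)$. Suppose that the following three conditions are satisfied. (i) The set $D$ is $l$-thick for some $l \in (d-p,d]$. (ii) The space $W^{1,p}_D(\Omega)$ can be equivalently normed by $\|\nabla\cdot\|_{L^p(\Omega)}$. (iii) There are two open, bounded sets $U,V \subset \mathbb{R}^d$ with $$D \subset U, \qquad \overline{V} \cap D = \emptyset, \qquad \overline{\Omega} \subset U \cup V,$$ such that $\Lambda := \Omega \cap U$ is again a domain and, with $\Gamma := (\partial\Omega \setminus D) \cap U$ and $E := \partial\Lambda \setminus \Gamma$, there is a linear, continuous extension operator $\mathfrak{F} : W^{1,p}_E(\Lambda) \to W^{1,p}_E(\mathbb{R}^d)$. Then there is a constant $c>0$ such that Hardy's inequality $$\int_\Omega \left| \frac{u}{\operatorname{dist}_D} \right|^p \, d\mathrm{x} \le c \int_\Omega |\nabla u|^p \, d\mathrm{x}$$ holds for all $u \in W^{1,p}_D(\Omega)$.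
   Context: The space dimension is $d \ge 1$; a domain is a non-empty connected open set; $B(\mathrm{x},r)$ is the open ball; $\operatorname{dist}_D$ is the Euclidean distance function to $D$. For $\Lambda \subset \mathbb{R}^d$ open, $E \subset \overline{\Lambda}$ closed and $p \in [1,\infty)$, put $C^\infty_E(\Lambda) := \{ v|_\Lambda : v \in C_0^\infty(\mathbb{R}^d),\ \operatorname{supp}(v) \cap E = \emptyset \}$, and let $W^{1,p}_E(\Lambda)$ be the completion of $C^\infty_E(\Lambda)$ with respect to the norm $v \mapsto \big( \int_\Lambda |\nabla v|^p + |v|^p \, d\mathrm{x} \big)^{1/p}$. An extension operator is one whose values restrict on $\Lambda$ to the original function. For $l>0$ the centered Hausdorff content of $F \subset \mathbb{R}^d$ is $\mathcal{H}_l^\infty(F) := \inf \{ \sum_{j=1}^\infty r_j^l : \mathrm{x}_j \in F,\ r_j>0,\ F \subset \bigcup_{j=1}^\infty B(\mathrm{x}_j,r_j) \}$. For $l \in (0,\infty)$, a non-empty compact set $F \subset \mathbb{R}^d$ is called $l$-thick if there exist $R>0$ and $\gamma>0$ such that $\mathcal{H}^\infty_l(F \cap B(\mathrm{x},r)) \ge \gamma r^l$ for all $\mathrm{x} \in F$ and all $r \in (0,R]$. ($l$-thickness is defined only for $l>0$.) *)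

theory Defs
  imports "HOL-Analysis.Analysis"
begin

text \<open>The space \<open>\<real>\<^sup>d\<close> is an arbitrary Euclidean space \<open>'a\<close> with \<open>d = DIM('a)\<close>, and all functions
  are real-valued.\<close>

definition domain :: "'a::euclidean_space set \<Rightarrow> bool"
  where "domain \<Omega> \<longleftrightarrow> open \<Omega> \<and> connected \<Omega> \<and> \<Omega> \<noteq> {}"


section \<open>Hausdorff content and thick sets\<close>

text \<open>For empty \<open>F\<close> no sequence of centres exists and the content is \<open>\<infinity>\<close>; below it is only applied to
  non-empty sets.\<close>

definition centered_hausdorff_content :: "real \<Rightarrow> 'a::euclidean_space set \<Rightarrow> ennreal"
  where "centered_hausdorff_content l F =
    Inf {\<Sum>j. ennreal (r j powr l) | (x :: nat \<Rightarrow> 'a) (r :: nat \<Rightarrow> real).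
           (\<forall>j. x j \<in> F) \<and> (\<forall>j. 0 < r j) \<and> F \<subseteq> (\<Union>j. ball (x j) (r j))}"

definition thick :: "real \<Rightarrow> 'a::euclidean_space set \<Rightarrow> bool"
  where "thick l F \<longleftrightarrow> 0 < l \<and> compact F \<and> F \<noteq> {} \<and>
    (\<exists>R>0. \<exists>\<gamma>>0. \<forall>x\<in>F. \<forall>r. 0 < r \<and> r \<le> R \<longrightarrow>
       ennreal (\<gamma> * r powr l) \<le> centered_hausdorff_content l (F \<inter> ball x r))"


section \<open>Smooth functions\<close>

text \<open>\<open>C_diff n f\<close>: \<open>f\<close> is \<open>n\<close> times continuously differentiable on the whole space.\<close>

primrec C_diff :: "nat \<Rightarrow> ('a::euclidean_space \<Rightarrow> real) \<Rightarrow> bool"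
  where
    "C_diff 0 f \<longleftrightarrow> continuous_on UNIV f"
  | "C_diff (Suc n) f \<longleftrightarrow> (\<forall>x. f differentiable at x) \<and>
       (\<forall>h. C_diff n (\<lambda>x. frechet_derivative f (at x) h))"

definition smooth :: "('a::euclidean_space \<Rightarrow> real) \<Rightarrow> bool"
  where "smooth f \<longleftrightarrow> (\<forall>n. C_diff n f)"

definition supp :: "('a::euclidean_space \<Rightarrow> real) \<Rightarrow> 'a set"
  where "supp f = closure {x. f x \<noteq> 0}"

definition grad :: "('a::euclidean_space \<Rightarrow> real) \<Rightarrow> 'a \<Rightarrow> 'a"
  where "grad f x = (\<Sum>b\<in>Basis. frechet_derivative f (at x) b *\<^sub>R b)"

text \<open>The functions on the whole space whose restrictions to \<open>\<Lambda>\<close> make up \<open>C\<^sup>\<infinity>\<^sub>E(\<Lambda>)\<close>. The restriction is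
  not performed explicitly: below, functions on \<open>\<Lambda>\<close> are total functions of which only the values
  on \<open>\<Lambda>\<close> matter.\<close>

definition smooth_vanishing :: "'a::euclidean_space set \<Rightarrow> ('a \<Rightarrow> real) set"
  where "smooth_vanishing E = {v. smooth v \<and> compact (supp v) \<and> supp v \<inter> E = {}}"


section \<open>The Sobolev spaces $W^{1,p}_E(\Lambda)$\<close>

text \<open>An element of the completion is represented by a pair \<open>(u, g)\<close>, where \<open>u\<close> is the limit in
  \<open>L\<^sup>p(\<Lambda>)\<close> of functions in \<open>C\<^sup>\<infinity>\<^sub>E(\<Lambda>)\<close> and \<open>g = \<nabla>u\<close> is the limit of their gradients. This is the
  closure of \<open>{(v, \<nabla>v)}\<close> in the Banach space \<open>L\<^sup>p(\<Lambda>) \<times> L\<^sup>p(\<Lambda>)\<^sup>d\<close>. As the gradient is closable,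
  \<open>u\<close> determines \<open>g\<close> up to null sets. Pairs that agree almost everywhere on \<open>\<Lambda>\<close> represent the same
  element.\<close>

type_synonym 'a sob = "('a \<Rightarrow> real) \<times> ('a \<Rightarrow> 'a)"

definition in_Lp :: "real \<Rightarrow> 'a::euclidean_space set \<Rightarrow> ('a \<Rightarrow> 'b::euclidean_space) \<Rightarrow> bool"
  where "in_Lp p \<Lambda> f \<longleftrightarrow> f \<in> borel_measurable (lebesgue_on \<Lambda>) \<and>
    integrable (lebesgue_on \<Lambda>) (\<lambda>x. norm (f x) powr p)"

definition Lp_norm :: "real \<Rightarrow> 'a::euclidean_space set \<Rightarrow> ('a \<Rightarrow> 'b::euclidean_space) \<Rightarrow> real"
  where "Lp_norm p \<Lambda> f = (\<integral>x. norm (f x) powr p \<partial>lebesgue_on \<Lambda>) powr (1 / p)"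

definition sob_norm :: "real \<Rightarrow> 'a::euclidean_space set \<Rightarrow> 'a sob \<Rightarrow> real"
  where "sob_norm p \<Lambda> w =
    (\<integral>x. norm (snd w x) powr p + \<bar>fst w x\<bar> powr p \<partial>lebesgue_on \<Lambda>) powr (1 / p)"

definition sob_lincomb :: "real \<Rightarrow> 'a::euclidean_space sob \<Rightarrow> real \<Rightarrow> 'a sob \<Rightarrow> 'a sob"
  where "sob_lincomb a w b z =
    (\<lambda>x. a * fst w x + b * fst z x, \<lambda>x. a *\<^sub>R snd w x + b *\<^sub>R snd z x)"

definition sob_eq :: "'a::euclidean_space set \<Rightarrow> 'a sob \<Rightarrow> 'a sob \<Rightarrow> bool"
  where "sob_eq \<Lambda> w z \<longleftrightarrow> (AE x in lebesgue_on \<Lambda>. fst w x = fst z x \<and> snd w x = snd z x)"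

definition sobolev :: "real \<Rightarrow> 'a::euclidean_space set \<Rightarrow> 'a set \<Rightarrow> 'a sob set"
  where "sobolev p \<Lambda> E = {w. in_Lp p \<Lambda> (fst w) \<and> in_Lp p \<Lambda> (snd w) \<and>
    (\<exists>v :: nat \<Rightarrow> 'a \<Rightarrow> real. (\<forall>n. v n \<in> smooth_vanishing E) \<and>
      (\<lambda>n. sob_norm p \<Lambda> (sob_lincomb 1 w (- 1) (v n, grad (v n)))) \<longlonglongrightarrow> 0)}"

definition equivalently_normed_by_gradient ::
    "real \<Rightarrow> 'a::euclidean_space set \<Rightarrow> 'a set \<Rightarrow> bool"
  where "equivalently_normed_by_gradient p \<Lambda> E \<longleftrightarrow>
    (\<exists>a>0. \<exists>b>0. \<forall>w\<in>sobolev p \<Lambda> E.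
       a * sob_norm p \<Lambda> w \<le> Lp_norm p \<Lambda> (snd w) \<and> Lp_norm p \<Lambda> (snd w) \<le> b * sob_norm p \<Lambda> w)"

text \<open>A continuous linear operator \<open>W\<^sup>1\<^sup>,\<^sup>p\<^sub>E(\<Lambda>) \<rightarrow> W\<^sup>1\<^sup>,\<^sup>p\<^sub>E(\<real>\<^sup>d)\<close> acting on representatives; the second
  conjunct says that it is well defined on classes, and continuity is stated as boundedness.\<close>

definition sobolev_extension_operator ::
    "real \<Rightarrow> 'a::euclidean_space set \<Rightarrow> 'a set \<Rightarrow> ('a sob \<Rightarrow> 'a sob) \<Rightarrow> bool"
  where "sobolev_extension_operator p \<Lambda> E \<FF> \<longleftrightarrow>
    (\<forall>w\<in>sobolev p \<Lambda> E. \<FF> w \<in> sobolev p UNIV E) \<and>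
    (\<forall>w\<in>sobolev p \<Lambda> E. \<forall>z\<in>sobolev p \<Lambda> E. sob_eq \<Lambda> w z \<longrightarrow> sob_eq UNIV (\<FF> w) (\<FF> z)) \<and>
    (\<forall>w\<in>sobolev p \<Lambda> E. \<forall>z\<in>sobolev p \<Lambda> E. \<forall>a b.
       sob_eq UNIV (\<FF> (sob_lincomb a w b z)) (sob_lincomb a (\<FF> w) b (\<FF> z))) \<and>
    (\<exists>C. \<forall>w\<in>sobolev p \<Lambda> E. sob_norm p UNIV (\<FF> w) \<le> C * sob_norm p \<Lambda> w) \<and>
    (\<forall>w\<in>sobolev p \<Lambda> E. AE x in lebesgue_on \<Lambda>. fst (\<FF> w) x = fst w x)"

end

theory Submission
  imports Defs
begin

text \<open>Write \<open>d\<close> for the distance function to \<open>D\<close> and \<open>n\<close> for the space dimension. The core is a Hardy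
  inequality on the whole space, \<open>thick_imp_hardy_smooth\<close>: if \<open>D\<close> is \<open>l\<close>-thick with \<open>l > n - p\<close>, then
  the integral of \<open>\<bar>v/d\<bar>\<^sup>p\<close> is at most a constant times the integral of \<open>\<bar>\<nabla>v\<bar>\<^sup>p + \<bar>v\<bar>\<^sup>p\<close>, for all smooth
  \<open>v\<close> of compact support that vanish near \<open>D\<close>.

  The theorem follows by localisation. Choose a smooth cut-off function \<open>\<eta>\<close> that is positive near \<open>D\<close>
  and supported in \<open>U\<close>. As \<open>E \<inter> U \<subseteq> D\<close>, multiplication by \<open>\<eta>\<close> maps \<open>W\<^sup>1\<^sup>,\<^sup>p\<^sub>D(\<Omega>)\<close> to \<open>W\<^sup>1\<^sup>,\<^sup>p\<^sub>E(\<Lambda>)\<close>, and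
  \<open>\<eta> u\<close> extends to a member of \<open>W\<^sup>1\<^sup>,\<^sup>p\<^sub>E\<close> on the whole space. As \<open>D \<subseteq> E\<close>, this extension is a limit of
  smooth functions vanishing near \<open>D\<close> and inherits the Hardy inequality (\<open>hardy_passes_to_limit\<close>).
  Near \<open>D\<close> the function \<open>\<bar>u/d\<bar>\<close> is dominated by \<open>\<bar>\<eta> u/d\<bar>\<close>, away from \<open>D\<close> by \<open>\<bar>u\<bar>\<close>, so \<open>u/d\<close> is
  controlled by the full norm of \<open>u\<close>, which by (ii) is controlled by the gradient alone.

  The Hardy inequality on the whole space is proved in three steps.

  \<^item> If \<open>v = 0\<close> near \<open>y\<close> and the gradient energy in every ball \<open>ball y (3\<rho>)\<close>, \<open>\<rho> \<le> r\<close>, is at most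
    \<open>c \<rho>\<^sup>l\<close>, then chaining through the balls of radius \<open>r/2\<^sup>j\<close> bounds the integral of \<open>\<bar>v\<bar>\<^sup>p\<close> over \<open>ball y r\<close>
    by \<open>c r\<^sup>p\<^sup>+\<^sup>l\<close>; here \<open>l > n - p\<close> makes a geometric series converge (\<open>small_gradient_imp_small_function\<close>).
    If instead every point of \<open>D\<close> near \<open>x\<close> had a ball of large energy, Vitali's covering lemma would
    contradict thickness. This yields the layer estimate \<open>thick_imp_layer_estimate\<close>: the integral of
    \<open>\<bar>v\<bar>\<^sup>p\<close> over \<open>{d \<le> r}\<close> is at most \<open>C r\<^sup>p\<close> times that of \<open>\<bar>\<nabla>v\<bar>\<^sup>p\<close> over \<open>{d \<le> 6r}\<close>.

  \<^item> Multiplying by \<open>r\<close> to the power \<open>-p - \<beta>\<close> and summing over dyadic \<open>r\<close> bounds the integral of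
    \<open>\<bar>v\<bar>\<^sup>p d\<^sup>-\<^sup>p\<^sup>-\<^sup>\<beta>\<close> by \<open>C/\<beta>\<close> times that of \<open>\<bar>\<nabla>v\<bar>\<^sup>p d\<^sup>-\<^sup>\<beta>\<close>, for every \<open>0 < \<beta> \<le> 1\<close>
    (\<open>layer_estimate_imp_weighted_estimate\<close>).

  \<^item> Apply this to \<open>v d\<^sup>\<beta>\<^sup>/\<^sup>p\<close> instead of \<open>v\<close>. Differentiating the weight produces an error term, which is the
    integral of \<open>\<bar>v/d\<bar>\<^sup>p\<close> times \<open>(C/\<beta>)(\<beta>/p)\<^sup>p\<close>. As \<open>p > 1\<close>, that factor tends to \<open>0\<close> with \<open>\<beta>\<close>, and the
    error is absorbed (\<open>layer_estimates_imp_hardy\<close>; the idea is due to Wannebo).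

  The weight \<open>d\<^sup>\<beta>\<^sup>/\<^sup>p\<close> is not differentiable, so the first two steps are carried out for functions that merely
  have an upper gradient.\<close>

section \<open>Upper gradients\<close>

text \<open>A mean value inequality for functions with a pointwise bound on the local Lipschitz constant. The
  inequality with an extra \<open>e\<close> is additive over adjacent intervals
  and holds on short intervals by continuity of \<open>h\<close>, so bisection (Bolzano) gives it on \<open>{0..1}\<close>.\<close>

lemma increment_le_integral_of_local_slope:
  fixes f h :: "real \<Rightarrow> real"
  assumes h: "continuous_on {0..1} h"
    and slope: "\<And>t e. 0 \<le> t \<Longrightarrow> t \<le> 1 \<Longrightarrow> 0 < e \<Longrightarrow>
      \<exists>d>0. \<forall>u. \<bar>u - t\<bar> < d \<longrightarrow> \<bar>f u - f t\<bar> \<le> (h t + e) * \<bar>u - t\<bar>"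
  shows "\<bar>f 1 - f 0\<bar> \<le> integral {0..1} h"
proof (rule field_le_epsilon)
  fix e :: real assume e: "0 < e"
  define P where "P a b \<longleftrightarrow> (0 \<le> a \<and> b \<le> 1 \<longrightarrow>
    \<bar>f b - f a\<bar> \<le> integral {a..b} h + e * (b - a))" for a b
  have int: "h integrable_on {a..b}" if "0 \<le> a" "b \<le> 1" for a b
    by (rule integrable_continuous_interval) (rule continuous_on_subset[OF h], use that in auto)
  have "(0::real) \<le> 1" by simp
  then have "P 0 1"
  proof (induction rule: Bolzano)
    case (trans a b c)
    show ?case
      unfolding P_def
    proof (intro impI)
      assume ac: "0 \<le> a \<and> c \<le> 1"
      have "integral {a..b} h + integral {b..c} h = integral {a..c} h"
        by (rule Henstock_Kurzweil_Integration.integral_combine) (use trans ac int in auto)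
      with trans ac show "\<bar>f c - f a\<bar> \<le> integral {a..c} h + e * (c - a)"
        unfolding P_def by (auto simp: algebra_simps)
    qed
  next
    case (local t)
    obtain d1 where d1: "d1 > 0"
      "\<And>u. \<bar>u - t\<bar> < d1 \<Longrightarrow> \<bar>f u - f t\<bar> \<le> (h t + e/2) * \<bar>u - t\<bar>"
      using slope[of t "e/2"] local e by auto
    obtain d2 where d2: "d2 > 0" "\<And>u. u \<in> {0..1} \<Longrightarrow> \<bar>u - t\<bar> < d2 \<Longrightarrow> \<bar>h u - h t\<bar> < e/2"
      using h[unfolded continuous_on_iff, rule_format, of t "e/2"] local e
      by (auto simp: dist_real_def)
    have "P a b" if ab: "a \<le> t" "t \<le> b" "b - a < min d1 d2" for a b
      unfolding P_def
    proof (intro impI)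
      assume 0: "0 \<le> a \<and> b \<le> 1"
      have "\<bar>f b - f a\<bar> \<le> \<bar>f b - f t\<bar> + \<bar>f a - f t\<bar>" by linarith
      also have "\<dots> \<le> (h t + e/2) * (b - t) + (h t + e/2) * (t - a)"
        using d1(2)[of a] d1(2)[of b] ab by (intro add_mono) auto
      also have "\<dots> = (h t - e/2) * (b - a) + e * (b - a)"
        by (simp add: field_simps)
      also have "(h t - e/2) * (b - a) = integral {a..b} (\<lambda>_. h t - e/2)"
        using ab by simp
      also have "\<dots> \<le> integral {a..b} h"
      proof (rule integral_le)
        show "h t - e / 2 \<le> h x" if "x \<in> {a..b}" for x
        proof -
          have "\<bar>h x - h t\<bar> < e / 2" using that 0 ab by (intro d2(2)) (auto simp: abs_le_iff)
          then show ?thesis by (simp add: abs_if split: if_splits)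
        qed
      qed (use int 0 in auto)
      finally show "\<bar>f b - f a\<bar> \<le> integral {a..b} h + e * (b - a)" by simp
    qed
    then show ?case using d1(1) d2(1) by (intro exI[of _ "min d1 d2"]) auto
  qed
  then show "\<bar>f 1 - f 0\<bar> \<le> integral {0..1} h + e" by (simp add: P_def)
qed

lemma powr_ge_tangent:
  fixes a m p :: real
  assumes "1 \<le> p" "0 < m" "0 \<le> a"
  shows "m powr p + p * m powr (p - 1) * (a - m) \<le> a powr p"
proof (cases "a = 0")
  case True
  have "m powr p + p * m powr (p - 1) * (a - m) = (1 - p) * m powr p"
    using assms True by (simp add: powr_diff field_simps)
  also have "\<dots> \<le> 0" using assms by (simp add: mult_nonpos_nonneg)
  finally show ?thesis using True assms by simp
next
  case False
  have "a powr p - m powr p \<ge> (p * m powr (p - 1)) * (a - m)"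
  proof (rule convex_on_imp_above_tangent[OF powr_convex[OF assms(1)]])
    show "((\<lambda>x. x powr p) has_real_derivative p * m powr (p - 1)) (at m within {0<..})"
      using assms by (auto intro!: derivative_eq_intros)
  qed (use assms False in \<open>auto simp: interior_open\<close>)
  then show ?thesis by simp
qed

text \<open>Jensen's inequality on the unit interval: integrate the tangent line of \<open>t\<^sup>p\<close> at the mean of \<open>h\<close>.\<close>

lemma powr_integral_le_integral_powr:
  fixes h :: "real \<Rightarrow> real"
  assumes h: "continuous_on {0..1} h" and nonneg: "\<And>t. t \<in> {0..1} \<Longrightarrow> 0 \<le> h t" and p: "1 \<le> p"
  shows "(integral {0..1} h) powr p \<le> integral {0..1} (\<lambda>t. h t powr p)"
proof -
  define m where "m = integral {0..1} h"
  have ih: "h integrable_on {0..1}" by (rule integrable_continuous_interval[OF h])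
  have cp: "continuous_on {0..1} (\<lambda>t. h t powr p)"
    using h p nonneg by (intro continuous_on_powr' continuous_intros) auto
  have m0: "0 \<le> m" unfolding m_def by (rule integral_nonneg[OF ih]) (use nonneg in auto)
  show ?thesis
  proof (cases "m = 0")
    case True
    then show ?thesis using p cp
      by (auto simp: m_def[symmetric] intro!: integral_nonneg integrable_continuous_interval)
  next
    case False
    have il: "(\<lambda>t. m powr p + p * m powr (p - 1) * (h t - m)) integrable_on {0..1}"
      by (intro integrable_continuous_interval continuous_intros h)
    have const: "((\<lambda>_. k) has_integral k) {0..1::real}" for k :: real
      using has_integral_const_real[of k 0 1] by simp
    have "((\<lambda>t. m powr p + p * m powr (p - 1) * (h t - m)) has_integral
        m powr p + p * m powr (p - 1) * (m - m)) {0..1}"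
      by (intro has_integral_add has_integral_mult_right has_integral_diff const)
        (simp add: m_def ih integrable_integral)
    then have "m powr p = integral {0..1} (\<lambda>t. m powr p + p * m powr (p - 1) * (h t - m))"
      by (simp add: integral_unique)
    also have "\<dots> \<le> integral {0..1} (\<lambda>t. h t powr p)"
      by (rule integral_le[OF il integrable_continuous_interval[OF cp]])
        (use powr_ge_tangent[OF p] m0 False nonneg in auto)
    finally show ?thesis by (simp add: m_def)
  qed
qed

lemma integral_eq_nn_integral_lborel:
  fixes g :: "real \<Rightarrow> real"
  assumes "continuous_on UNIV g" "\<And>t. 0 \<le> g t"
  shows "ennreal (integral {0..1} g) = (\<integral>\<^sup>+t\<in>{0..1}. ennreal (g t) \<partial>lborel)"
proof -
  have "(\<integral>\<^sup>+t\<in>{0..1}. ennreal (g t) \<partial>lborel) = (\<integral>\<^sup>+t. ennreal (g t * indicator {0..1} t) \<partial>lborel)"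
    by (intro nn_integral_cong) (auto simp: indicator_def)
  also have "\<dots> = ennreal (integral {0..1} g)"
  proof (rule nn_integral_has_integral_lborel)
    have "continuous_on {0..1} g" using assms(1) continuous_on_subset by blast
    then have "(g has_integral integral {0..1} g) {0..1}"
      by (intro integrable_integral integrable_continuous_interval)
    moreover have "(\<lambda>x. g x * indicator {0..1} x) = (\<lambda>x. if x \<in> {0..1} then g x else 0)"
      by (auto simp: fun_eq_iff)
    ultimately show "((\<lambda>x. g x * indicator {0..1} x) has_integral integral {0..1} g) UNIV"
      by (simp only: has_integral_restrict_UNIV)
    have "g \<in> borel_measurable borel" by (rule borel_measurable_continuous_onI[OF assms(1)])
    then show "(\<lambda>t. g t * indicator {0..1} t) \<in> borel_measurable borel" by measurable
  qed (use assms in auto)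
  finally show ?thesis by simp
qed

text \<open>\<open>h x\<close> bounds the pointwise Lipschitz constant \<open>limsup \<bar>w y - w x\<bar> / norm (y - x)\<close>.\<close>

definition local_slope :: "('a::real_normed_vector \<Rightarrow> real) \<Rightarrow> ('a \<Rightarrow> real) \<Rightarrow> bool"
  where "local_slope w h \<longleftrightarrow>
    (\<forall>x. \<forall>e>0. \<forall>\<^sub>F y in nhds x. \<bar>w y - w x\<bar> \<le> (h x + e) * norm (y - x))"

text \<open>The usual upper gradient inequality along the segment from \<open>x\<close> to \<open>x + z\<close>, raised to the power \<open>p\<close>;
  \<open>G\<close> plays the role of \<open>\<bar>\<nabla>w\<bar>\<^sup>p\<close>. With the power built in, all later estimates are linear in
  \<open>\<bar>w\<bar>\<^sup>p\<close> and \<open>G\<close>, hence can be averaged and integrated term by term.\<close>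

definition p_upper_gradient ::
    "real \<Rightarrow> ('a::euclidean_space \<Rightarrow> real) \<Rightarrow> ('a \<Rightarrow> real) \<Rightarrow> bool"
  where "p_upper_gradient p w G \<longleftrightarrow>
    continuous_on UNIV w \<and> continuous_on UNIV G \<and> (\<forall>x. 0 \<le> G x) \<and>
    (\<forall>x z. ennreal (\<bar>w (x + z) - w x\<bar> powr p) \<le>
       ennreal (norm z powr p) * (\<integral>\<^sup>+t\<in>{0..1}. ennreal (G (x + t *\<^sub>R z)) \<partial>lborel))"

lemma p_upper_gradient_of_local_slope:
  fixes w h :: "'a::euclidean_space \<Rightarrow> real"
  assumes p: "1 \<le> p" and w: "continuous_on UNIV w" and h: "continuous_on UNIV h"
    and h0: "\<And>x. 0 \<le> h x" and slope: "local_slope w h"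
  shows "p_upper_gradient p w (\<lambda>x. h x powr p)"
proof -
  have ch: "continuous_on S (\<lambda>t. h (x + t *\<^sub>R z))" for S x z
    by (rule continuous_on_compose2[OF h]) (auto intro!: continuous_intros)
  have "ennreal (\<bar>w (x + z) - w x\<bar> powr p) \<le>
       ennreal (norm z powr p) * (\<integral>\<^sup>+t\<in>{0..1}. ennreal (h (x + t *\<^sub>R z) powr p) \<partial>lborel)" for x z
  proof (cases "z = 0")
    case False
    define g where "g t = h (x + t *\<^sub>R z)" for t :: real
    have cg: "continuous_on S g" for S unfolding g_def by (rule ch)
    have cgp: "continuous_on S (\<lambda>t. g t powr p)" for S
      using p by (intro continuous_on_powr' continuous_intros cg) (auto simp: g_def h0)
    have "\<bar>w (x + 1 *\<^sub>R z) - w (x + 0 *\<^sub>R z)\<bar> \<le> integral {0..1} (\<lambda>t. norm z * g t)"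
    proof (rule increment_le_integral_of_local_slope)
      fix t e :: real assume "0 < e"
      then have "0 < e / norm z" using False by simp
      then have "\<forall>\<^sub>F y in nhds (x + t *\<^sub>R z).
          \<bar>w y - w (x + t *\<^sub>R z)\<bar> \<le> (h (x + t *\<^sub>R z) + e / norm z) * norm (y - (x + t *\<^sub>R z))"
        using slope by (auto simp: local_slope_def)
      then obtain d where d: "d > 0" "\<And>y. dist y (x + t *\<^sub>R z) < d \<Longrightarrow>
          \<bar>w y - w (x + t *\<^sub>R z)\<bar> \<le> (h (x + t *\<^sub>R z) + e / norm z) * norm (y - (x + t *\<^sub>R z))"
        by (auto simp: eventually_nhds_metric)
      have "\<bar>w (x + u *\<^sub>R z) - w (x + t *\<^sub>R z)\<bar> \<le> (norm z * g t + e) * \<bar>u - t\<bar>"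
        if "\<bar>u - t\<bar> < d / norm z" for u
      proof -
        have eq: "x + u *\<^sub>R z - (x + t *\<^sub>R z) = (u - t) *\<^sub>R z" by (simp add: algebra_simps)
        have "dist (x + u *\<^sub>R z) (x + t *\<^sub>R z) < d"
          unfolding dist_norm eq norm_scaleR using that False by (simp add: pos_less_divide_eq)
        from d(2)[OF this] have "\<bar>w (x + u *\<^sub>R z) - w (x + t *\<^sub>R z)\<bar>
            \<le> (h (x + t *\<^sub>R z) + e / norm z) * (\<bar>u - t\<bar> * norm z)"
          unfolding eq norm_scaleR .
        also have "\<dots> = (norm z * g t + e) * \<bar>u - t\<bar>"
          using False by (simp add: g_def field_simps)
        finally show ?thesis .
      qed
      then show "\<exists>d>0. \<forall>u. \<bar>u - t\<bar> < d \<longrightarrow>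
          \<bar>w (x + u *\<^sub>R z) - w (x + t *\<^sub>R z)\<bar> \<le> (norm z * g t + e) * \<bar>u - t\<bar>"
        using d(1) False by (intro exI[of _ "d / norm z"]) auto
    qed (intro continuous_intros cg)
    then have le: "\<bar>w (x + z) - w x\<bar> \<le> norm z * integral {0..1} g" by simp
    have "\<bar>w (x + z) - w x\<bar> powr p \<le> (norm z * integral {0..1} g) powr p"
      using p by (intro powr_mono2 le) auto
    also have "\<dots> = norm z powr p * (integral {0..1} g) powr p"
      by (rule powr_mult)
    also have "\<dots> \<le> norm z powr p * integral {0..1} (\<lambda>t. g t powr p)"
      by (intro mult_left_mono powr_integral_le_integral_powr cg p) (auto simp: g_def h0)
    finally have "ennreal (\<bar>w (x + z) - w x\<bar> powr p) \<le>
        ennreal (norm z powr p) * ennreal (integral {0..1} (\<lambda>t. g t powr p))"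
      by (subst ennreal_mult[symmetric])
        (auto intro!: integral_nonneg integrable_continuous_interval cgp ennreal_leI)
    also have "ennreal (integral {0..1} (\<lambda>t. g t powr p)) = (\<integral>\<^sup>+t\<in>{0..1}. ennreal (g t powr p) \<partial>lborel)"
      by (rule integral_eq_nn_integral_lborel[OF cgp]) simp
    finally show ?thesis by (simp add: g_def)
  qed simp
  moreover have "continuous_on UNIV (\<lambda>x. h x powr p)"
    using p h0 by (intro continuous_on_powr' continuous_intros h) (auto)
  ultimately show ?thesis using w by (auto simp: p_upper_gradient_def)
qed

section \<open>Translation estimates and averages over balls\<close>

text \<open>The triangle inequality for \<open>p\<close>-th powers with a constant arbitrarily close to \<open>1\<close> in front of \<open>\<bar>b\<bar>\<^sup>p\<close>.
  In a chain of comparisons this constant is raised to the length of the chain, so it has to be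
  close to \<open>1\<close>. Either \<open>\<bar>a\<bar> \<le> \<mu> \<bar>b\<bar>\<close> with \<open>\<mu>\<^sup>p = \<sigma>\<close>, or \<open>\<bar>b - a\<bar>\<close> is comparable to \<open>\<bar>a\<bar>\<close>.\<close>

lemma powr_le_split:
  fixes p \<sigma> :: real
  assumes "0 < p" "1 < \<sigma>"
  obtains K where "0 < K" "\<And>a b :: real. \<bar>a\<bar> powr p \<le> \<sigma> * \<bar>b\<bar> powr p + K * \<bar>b - a\<bar> powr p"
proof
  define \<mu> where "\<mu> = \<sigma> powr (1 / p)"
  define K where "K = (1 - 1 / \<mu>) powr (- p)"
  have \<mu>: "1 < \<mu>" using assms by (simp add: \<mu>_def)
  then show K: "0 < K" by (simp add: K_def)
  fix a b :: real
  show "\<bar>a\<bar> powr p \<le> \<sigma> * \<bar>b\<bar> powr p + K * \<bar>b - a\<bar> powr p"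
  proof (cases "\<bar>a\<bar> \<le> \<mu> * \<bar>b\<bar>")
    case True
    have "\<bar>a\<bar> powr p \<le> (\<mu> * \<bar>b\<bar>) powr p" using True assms by (intro powr_mono2) auto
    also have "\<dots> = \<sigma> * \<bar>b\<bar> powr p" using assms \<mu> by (simp add: powr_mult \<mu>_def powr_powr)
    finally show ?thesis using K by (simp add: add_increasing2)
  next
    case False
    then have "\<bar>b\<bar> \<le> \<bar>a\<bar> / \<mu>" using \<mu> by (simp add: field_simps)
    then have "\<bar>a\<bar> * (1 - 1 / \<mu>) \<le> \<bar>b - a\<bar>" by (simp add: right_diff_distrib)
    then have "(\<bar>a\<bar> * (1 - 1 / \<mu>)) powr p \<le> \<bar>b - a\<bar> powr p"
      using assms \<mu> by (intro powr_mono2) auto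
    then have "K * (\<bar>a\<bar> * (1 - 1 / \<mu>)) powr p \<le> K * \<bar>b - a\<bar> powr p" using K by simp
    moreover have "K * (\<bar>a\<bar> * (1 - 1 / \<mu>)) powr p = \<bar>a\<bar> powr p"
    proof -
      have "(\<bar>a\<bar> * (1 - 1 / \<mu>)) powr p = \<bar>a\<bar> powr p * (1 - 1 / \<mu>) powr p"
        by (rule powr_mult)
      then show ?thesis using \<mu> by (simp add: K_def powr_minus)
    qed
    ultimately show ?thesis using assms by (simp add: add_increasing)
  qed
qed

lemma nn_integral_lborel_shift:
  fixes f :: "'a::euclidean_space \<Rightarrow> ennreal"
  assumes "f \<in> borel_measurable borel"
  shows "(\<integral>\<^sup>+x. f (x + c) \<partial>lborel) = (\<integral>\<^sup>+x. f x \<partial>lborel)"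
proof -
  have "(\<integral>\<^sup>+x. f x \<partial>lborel) = (\<integral>\<^sup>+x. f x \<partial>distr lborel borel ((+) c))"
    by (simp add: lborel_distr_plus)
  also have "\<dots> = (\<integral>\<^sup>+x. f (c + x) \<partial>lborel)"
    using assms by (intro nn_integral_distr) auto
  finally show ?thesis by (simp add: add.commute)
qed

lemma nn_integral_shifted_set_le:
  fixes f :: "'a::euclidean_space \<Rightarrow> ennreal"
  assumes [measurable]: "f \<in> borel_measurable borel" "S \<in> sets borel"
    and sub: "\<And>a. a \<in> A \<Longrightarrow> a + c \<in> S"
  shows "(\<integral>\<^sup>+a\<in>A. f (a + c) \<partial>lborel) \<le> (\<integral>\<^sup>+x\<in>S. f x \<partial>lborel)"
proof -
  have "(\<integral>\<^sup>+a\<in>A. f (a + c) \<partial>lborel) \<le> (\<integral>\<^sup>+a. f (a + c) * indicator S (a + c) \<partial>lborel)"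
    by (intro nn_integral_mono) (auto simp: indicator_def sub)
  also have "\<dots> = (\<integral>\<^sup>+x\<in>S. f x \<partial>lborel)"
    by (rule nn_integral_lborel_shift) measurable
  finally show ?thesis .
qed

text \<open>Convolution-type bound: after exchanging the integrals, every translate of \<open>A\<close> by a point of \<open>B\<close> lies
  in \<open>S\<close>.\<close>

lemma nn_integral_translates_le:
  fixes f :: "'a::euclidean_space \<Rightarrow> ennreal"
  assumes [measurable]: "f \<in> borel_measurable borel" "A \<in> sets borel" "B \<in> sets borel" "S \<in> sets borel"
    and sub: "\<And>a z. a \<in> A \<Longrightarrow> z \<in> B \<Longrightarrow> a + z \<in> S"
  shows "(\<integral>\<^sup>+a\<in>A. (\<integral>\<^sup>+z\<in>B. f (a + z) \<partial>lborel) \<partial>lborel) \<le> emeasure lborel B * (\<integral>\<^sup>+x\<in>S. f x \<partial>lborel)"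
proof -
  have "(\<integral>\<^sup>+a\<in>A. (\<integral>\<^sup>+z\<in>B. f (a + z) \<partial>lborel) \<partial>lborel)
      = (\<integral>\<^sup>+a. (\<integral>\<^sup>+z. f (a + z) * indicator B z * indicator A a \<partial>lborel) \<partial>lborel)"
    by (simp add: nn_integral_multc)
  also have "\<dots> = (\<integral>\<^sup>+z. (\<integral>\<^sup>+a. f (a + z) * indicator B z * indicator A a \<partial>lborel) \<partial>lborel)"
    by (rule lborel_pair.Fubini'[symmetric]) measurable
  also have "\<dots> \<le> (\<integral>\<^sup>+z. indicator B z * (\<integral>\<^sup>+x\<in>S. f x \<partial>lborel) \<partial>lborel)"
  proof (intro nn_integral_mono)
    fix z
    have "(\<integral>\<^sup>+a. f (a + z) * indicator B z * indicator A a \<partial>lborel)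
        = indicator B z * (\<integral>\<^sup>+a\<in>A. f (a + z) \<partial>lborel)"
      by (subst nn_integral_cmult[symmetric]) (auto intro!: nn_integral_cong simp: ac_simps)
    also have "\<dots> \<le> indicator B z * (\<integral>\<^sup>+x\<in>S. f x \<partial>lborel)"
      using nn_integral_shifted_set_le[of f S A z] sub by (auto simp: indicator_def)
    finally show "(\<integral>\<^sup>+a. f (a + z) * indicator B z * indicator A a \<partial>lborel)
        \<le> indicator B z * (\<integral>\<^sup>+x\<in>S. f x \<partial>lborel)" .
  qed
  also have "\<dots> = emeasure lborel B * (\<integral>\<^sup>+x\<in>S. f x \<partial>lborel)"
    by (simp add: nn_integral_multc)
  finally show ?thesis .
qed

lemma p_upper_gradientD:
  assumes "p_upper_gradient p w G"
  shows "continuous_on UNIV w" "continuous_on UNIV G" "0 \<le> G x"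
    "w \<in> borel_measurable borel" "G \<in> borel_measurable borel"
    "ennreal (\<bar>w (x + z) - w x\<bar> powr p) \<le>
       ennreal (norm z powr p) * (\<integral>\<^sup>+t\<in>{0..1}. ennreal (G (x + t *\<^sub>R z)) \<partial>lborel)"
  using assms by (auto simp: p_upper_gradient_def intro: borel_measurable_continuous_onI)

text \<open>The substitute for Poincare's inequality. For fixed \<open>z\<close> and \<open>t\<close>, translating by \<open>t z\<close> moves \<open>A\<close>
  into \<open>S\<close>, because \<open>t z\<close> is again in the ball; the estimate then follows from translation invariance.\<close>

lemma p_upper_gradient_increments_le:
  fixes w G :: "'a::euclidean_space \<Rightarrow> real"
  assumes ug: "p_upper_gradient p w G" and p: "0 < p"
    and [measurable]: "A \<in> sets borel" "S \<in> sets borel"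
    and sub: "\<And>a z. a \<in> A \<Longrightarrow> z \<in> ball 0 \<rho> \<Longrightarrow> a + z \<in> S"
  shows "(\<integral>\<^sup>+a\<in>A. (\<integral>\<^sup>+z\<in>ball 0 \<rho>. ennreal (\<bar>w (a + z) - w a\<bar> powr p) \<partial>lborel) \<partial>lborel)
    \<le> ennreal (\<rho> powr p) * emeasure lborel (ball (0::'a) \<rho>) * (\<integral>\<^sup>+x\<in>S. ennreal (G x) \<partial>lborel)"
proof -
  have [measurable]: "w \<in> borel_measurable borel" "G \<in> borel_measurable borel"
    by (rule p_upper_gradientD[OF ug])+
  have [measurable]: "ball (0::'a) \<rho> \<in> sets borel" by simp
  let ?J = "\<integral>\<^sup>+x\<in>S. ennreal (G x) \<partial>lborel"
  have "(\<integral>\<^sup>+a\<in>A. (\<integral>\<^sup>+z\<in>ball 0 \<rho>. ennreal (\<bar>w (a + z) - w a\<bar> powr p) \<partial>lborel) \<partial>lborel)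
      \<le> (\<integral>\<^sup>+a. (\<integral>\<^sup>+z. ennreal (\<rho> powr p) * (\<integral>\<^sup>+t. ennreal (G (a + t *\<^sub>R z)) * indicator {0..1} t
            * indicator (ball 0 \<rho>) z * indicator A a \<partial>lborel) \<partial>lborel) \<partial>lborel)"
  proof (rule nn_integral_mono)
    fix a :: 'a
    have "(\<integral>\<^sup>+z\<in>ball 0 \<rho>. ennreal (\<bar>w (a + z) - w a\<bar> powr p) \<partial>lborel) * indicator A a
        = (\<integral>\<^sup>+z. ennreal (\<bar>w (a + z) - w a\<bar> powr p) * indicator (ball 0 \<rho>) z * indicator A a \<partial>lborel)"
      by (rule nn_integral_multc[symmetric]) measurable
    also have "\<dots> \<le> (\<integral>\<^sup>+z. ennreal (\<rho> powr p) * (\<integral>\<^sup>+t. ennreal (G (a + t *\<^sub>R z)) * indicator {0..1} t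
            * indicator (ball 0 \<rho>) z * indicator A a \<partial>lborel) \<partial>lborel)"
    proof (rule nn_integral_mono)
      fix z :: 'a
      have "ennreal (\<bar>w (a + z) - w a\<bar> powr p) \<le>
          ennreal (\<rho> powr p) * (\<integral>\<^sup>+t\<in>{0..1}. ennreal (G (a + t *\<^sub>R z)) \<partial>lborel)" if "z \<in> ball 0 \<rho>"
        using that p by (intro order_trans[OF p_upper_gradientD(6)[OF ug]] mult_right_mono ennreal_leI powr_mono2) auto
      then show "ennreal (\<bar>w (a + z) - w a\<bar> powr p) * indicator (ball 0 \<rho>) z * indicator A a
        \<le> ennreal (\<rho> powr p) * (\<integral>\<^sup>+t. ennreal (G (a + t *\<^sub>R z)) * indicator {0..1} t
              * indicator (ball 0 \<rho>) z * indicator A a \<partial>lborel)"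
        by (cases "a \<in> A"; cases "z \<in> ball 0 \<rho>") simp_all
    qed
    finally show "(\<integral>\<^sup>+z\<in>ball 0 \<rho>. ennreal (\<bar>w (a + z) - w a\<bar> powr p) \<partial>lborel) * indicator A a
      \<le> (\<integral>\<^sup>+z. ennreal (\<rho> powr p) * (\<integral>\<^sup>+t. ennreal (G (a + t *\<^sub>R z)) * indicator {0..1} t
            * indicator (ball 0 \<rho>) z * indicator A a \<partial>lborel) \<partial>lborel)" .
  qed
  also have "\<dots> = ennreal (\<rho> powr p) * (\<integral>\<^sup>+a. (\<integral>\<^sup>+z. (\<integral>\<^sup>+t. ennreal (G (a + t *\<^sub>R z)) * indicator {0..1} t
            * indicator (ball 0 \<rho>) z * indicator A a \<partial>lborel) \<partial>lborel) \<partial>lborel)"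
    by (simp add: nn_integral_cmult)
  also have "(\<integral>\<^sup>+a. (\<integral>\<^sup>+z. (\<integral>\<^sup>+t. ennreal (G (a + t *\<^sub>R z)) * indicator {0..1} t
            * indicator (ball 0 \<rho>) z * indicator A a \<partial>lborel) \<partial>lborel) \<partial>lborel)
      = (\<integral>\<^sup>+z. (\<integral>\<^sup>+a. (\<integral>\<^sup>+t. ennreal (G (a + t *\<^sub>R z)) * indicator {0..1} t
            * indicator (ball 0 \<rho>) z * indicator A a \<partial>lborel) \<partial>lborel) \<partial>lborel)"
    by (rule lborel_pair.Fubini'[symmetric]) measurable
  also have "\<dots> = (\<integral>\<^sup>+z. (\<integral>\<^sup>+t. (\<integral>\<^sup>+a. ennreal (G (a + t *\<^sub>R z)) * indicator {0..1} t
            * indicator (ball 0 \<rho>) z * indicator A a \<partial>lborel) \<partial>lborel) \<partial>lborel)"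
  proof (intro nn_integral_cong)
    fix z :: 'a
    have "(\<lambda>(a, t). ennreal (G (a + t *\<^sub>R z)) * indicator {0..1} t
            * indicator (ball 0 \<rho>) z * indicator A a) \<in> borel_measurable (lborel \<Otimes>\<^sub>M lborel)"
      by measurable
    then show "(\<integral>\<^sup>+a. (\<integral>\<^sup>+t. ennreal (G (a + t *\<^sub>R z)) * indicator {0..1} t
            * indicator (ball 0 \<rho>) z * indicator A a \<partial>lborel) \<partial>lborel)
       = (\<integral>\<^sup>+t. (\<integral>\<^sup>+a. ennreal (G (a + t *\<^sub>R z)) * indicator {0..1} t
            * indicator (ball 0 \<rho>) z * indicator A a \<partial>lborel) \<partial>lborel)"
      by (rule pair_sigma_finite.Fubini'[OF pair_sigma_finite.intro, OF sigma_finite_lborel sigma_finite_lborel, symmetric])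
  qed
  also have "\<dots> \<le> (\<integral>\<^sup>+z. (\<integral>\<^sup>+t. ?J * indicator {0..1} (t::real) * indicator (ball 0 \<rho>) (z::'a) \<partial>lborel) \<partial>lborel)"
  proof (intro nn_integral_mono)
    fix z :: 'a and t :: real
    show "(\<integral>\<^sup>+a. ennreal (G (a + t *\<^sub>R z)) * indicator {0..1} t
            * indicator (ball 0 \<rho>) z * indicator A a \<partial>lborel)
        \<le> ?J * indicator {0..1} t * indicator (ball 0 \<rho>) z"
    proof (cases "t \<in> {0..1} \<and> z \<in> ball 0 \<rho>")
      case True
      have "norm (t *\<^sub>R z) \<le> 1 * norm z" unfolding norm_scaleR using True by (intro mult_right_mono) auto
      then have "t *\<^sub>R z \<in> ball 0 \<rho>" using True by auto
      then have "a + t *\<^sub>R z \<in> S" if "a \<in> A" for a using sub that by blast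
      then have "(\<integral>\<^sup>+a\<in>A. ennreal (G (a + t *\<^sub>R z)) \<partial>lborel) \<le> ?J"
        by (intro nn_integral_shifted_set_le) auto
      then show ?thesis using True by simp
    qed auto
  qed
  also have "\<dots> = emeasure lborel (ball (0::'a) \<rho>) * ?J"
    by (simp add: nn_integral_cmult nn_integral_multc mult.commute)
  finally show ?thesis by (simp add: mult_left_mono mult.assoc)
qed

text \<open>Averages the pointwise inequality \<open>split\<close> over \<open>B \<times> B'\<close>. The increments between points of the two sets
  are displacements of length less than \<open>2\<rho>\<close>, to which the preceding estimate applies.\<close>

lemma p_upper_gradient_pair_average:
  fixes w G :: "'a::euclidean_space \<Rightarrow> real"
  assumes ug: "p_upper_gradient p w G" and p: "0 < p" and \<sigma>: "0 \<le> \<sigma>" and K: "0 \<le> K"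
    and split: "\<And>a b :: real. \<bar>a\<bar> powr p \<le> \<sigma> * \<bar>b\<bar> powr p + K * \<bar>b - a\<bar> powr p"
    and [measurable]: "B \<in> sets borel" "B' \<in> sets borel"
    and sub: "B \<subseteq> ball y \<rho>" "B' \<subseteq> ball y \<rho>"
  shows "emeasure lborel B' * (\<integral>\<^sup>+x\<in>B. ennreal (\<bar>w x\<bar> powr p) \<partial>lborel) \<le>
    ennreal \<sigma> * (emeasure lborel B * (\<integral>\<^sup>+x\<in>B'. ennreal (\<bar>w x\<bar> powr p) \<partial>lborel)) +
    ennreal K * (ennreal ((2 * \<rho>) powr p) * emeasure lborel (ball (0::'a) (2 * \<rho>)) *
      (\<integral>\<^sup>+x\<in>ball y (3 * \<rho>). ennreal (G x) \<partial>lborel))"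
proof -
  have [measurable]: "w \<in> borel_measurable borel" "G \<in> borel_measurable borel"
    by (rule p_upper_gradientD[OF ug])+
  have [measurable]: "ball c s \<in> sets borel" for c :: 'a and s by simp
  define u where "u x = ennreal (\<bar>w x\<bar> powr p)" for x
  have [measurable]: "u \<in> borel_measurable borel" unfolding u_def by measurable
  define v where "v a b = ennreal (\<bar>w b - w a\<bar> powr p)" for a b
  have [measurable]: "(\<lambda>(a, b). v a b) \<in> borel_measurable (borel \<Otimes>\<^sub>M borel)"
    unfolding v_def by measurable
  have uv: "u a \<le> ennreal \<sigma> * u b + ennreal K * v a b" for a b
    unfolding u_def v_def using split[of "w a" "w b"] \<sigma> K
    by (simp flip: ennreal_mult' ennreal_plus add: ennreal_leI)
  have "emeasure lborel B' * (\<integral>\<^sup>+x\<in>B. u x \<partial>lborel)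
      = (\<integral>\<^sup>+a. (\<integral>\<^sup>+b. u a * indicator B' b * indicator B a \<partial>lborel) \<partial>lborel)"
  proof -
    have "(\<integral>\<^sup>+b. u a * indicator B' b * indicator B a \<partial>lborel)
        = emeasure lborel B' * (u a * indicator B a)" for a
    proof -
      have "(\<integral>\<^sup>+b. u a * indicator B' b * indicator B a \<partial>lborel)
          = (\<integral>\<^sup>+b. (u a * indicator B a) * indicator B' b \<partial>lborel)"
        by (simp add: ac_simps)
      also have "\<dots> = (u a * indicator B a) * emeasure lborel B'"
        by (rule nn_integral_cmult_indicator) simp
      finally show ?thesis by (simp add: mult.commute)
    qed
    then show ?thesis by (simp add: nn_integral_cmult)
  qed
  also have "\<dots> \<le> (\<integral>\<^sup>+a. (\<integral>\<^sup>+b. ennreal \<sigma> * (u b * indicator B' b * indicator B a) +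
      ennreal K * (v a b * indicator B' b * indicator B a) \<partial>lborel) \<partial>lborel)"
    using uv by (intro nn_integral_mono) (auto simp: indicator_def)
  also have "\<dots> = ennreal \<sigma> * (\<integral>\<^sup>+a. (\<integral>\<^sup>+b. u b * indicator B' b * indicator B a \<partial>lborel) \<partial>lborel) +
      ennreal K * (\<integral>\<^sup>+a. (\<integral>\<^sup>+b. v a b * indicator B' b * indicator B a \<partial>lborel) \<partial>lborel)"
    by (simp add: nn_integral_add nn_integral_cmult)
  also have "(\<integral>\<^sup>+a. (\<integral>\<^sup>+b. u b * indicator B' b * indicator B a \<partial>lborel) \<partial>lborel)
      = emeasure lborel B * (\<integral>\<^sup>+x\<in>B'. u x \<partial>lborel)"
    by (simp add: nn_integral_multc nn_integral_cmult mult.commute)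
  also have "(\<integral>\<^sup>+a. (\<integral>\<^sup>+b. v a b * indicator B' b * indicator B a \<partial>lborel) \<partial>lborel)
      \<le> (\<integral>\<^sup>+a\<in>B. (\<integral>\<^sup>+z\<in>ball 0 (2 * \<rho>). v a (a + z) \<partial>lborel) \<partial>lborel)"
  proof (rule nn_integral_mono)
    fix a :: 'a
    have "(\<integral>\<^sup>+b. v a b * indicator B' b * indicator B a \<partial>lborel)
        = (\<integral>\<^sup>+z. v a (z + a) * indicator B' (z + a) * indicator B a \<partial>lborel)"
      by (rule nn_integral_lborel_shift[symmetric]) measurable
    also have "\<dots> \<le> (\<integral>\<^sup>+z. v a (a + z) * indicator (ball 0 (2 * \<rho>)) z * indicator B a \<partial>lborel)"
    proof (rule nn_integral_mono)
      fix z
      have "z \<in> ball 0 (2 * \<rho>)" if "z + a \<in> B'" "a \<in> B"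
      proof -
        have "dist y (z + a) < \<rho>" "dist y a < \<rho>" using that sub by auto
        then have "dist (z + a) a < 2 * \<rho>" by metric
        then show ?thesis by (simp add: dist_norm)
      qed
      then show "v a (z + a) * indicator B' (z + a) * indicator B a
          \<le> v a (a + z) * indicator (ball 0 (2 * \<rho>)) z * indicator B a"
        by (auto simp: indicator_def add.commute)
    qed
    also have "\<dots> = (\<integral>\<^sup>+z\<in>ball 0 (2 * \<rho>). v a (a + z) \<partial>lborel) * indicator B a"
      by (rule nn_integral_multc) measurable
    finally show "(\<integral>\<^sup>+b. v a b * indicator B' b * indicator B a \<partial>lborel)
      \<le> (\<integral>\<^sup>+z\<in>ball 0 (2 * \<rho>). v a (a + z) \<partial>lborel) * indicator B a" .
  qed
  also have "\<dots> \<le> ennreal ((2 * \<rho>) powr p) * emeasure lborel (ball (0::'a) (2 * \<rho>)) *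
      (\<integral>\<^sup>+x\<in>ball y (3 * \<rho>). ennreal (G x) \<partial>lborel)"
    unfolding v_def
  proof (rule p_upper_gradient_increments_le[OF ug p])
    fix a z assume "a \<in> B" "z \<in> ball (0::'a) (2 * \<rho>)"
    then have "dist y a < \<rho>" "norm z < 2 * \<rho>" using sub by auto
    moreover have "dist y (a + z) \<le> dist y a + norm z" by norm
    ultimately show "a + z \<in> ball y (3 * \<rho>)" by simp
  qed auto
  finally show ?thesis by (simp add: u_def mult_left_mono add_left_mono)
qed

lemma nn_integral_ball_finite:
  fixes f :: "'a::euclidean_space \<Rightarrow> real"
  assumes "continuous_on UNIV f"
  shows "(\<integral>\<^sup>+x\<in>ball y \<rho>. ennreal (f x) \<partial>lborel) < \<infinity>"
proof -
  have "compact (f ` cball y \<rho>)"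
    by (intro compact_continuous_image continuous_on_subset[OF assms]) auto
  then obtain M where M: "\<And>x. x \<in> cball y \<rho> \<Longrightarrow> \<bar>f x\<bar> \<le> M"
    using compact_imp_bounded[of "f ` cball y \<rho>"] unfolding bounded_iff real_norm_def by blast
  have "(\<integral>\<^sup>+x\<in>ball y \<rho>. ennreal (f x) \<partial>lborel) \<le> (\<integral>\<^sup>+x. ennreal M * indicator (ball y \<rho>) x \<partial>lborel)"
  proof (intro nn_integral_mono)
    fix x show "ennreal (f x) * indicator (ball y \<rho>) x \<le> ennreal M * indicator (ball y \<rho>) x"
      using M[of x] by (auto simp: indicator_def abs_le_iff intro!: ennreal_leI)
  qed
  also have "\<dots> = ennreal M * emeasure lborel (ball y \<rho>)" by (simp add: nn_integral_cmult_indicator)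
  also have "\<dots> < \<infinity>" using emeasure_lborel_ball_finite[of y \<rho>] by (simp add: ennreal_mult_less_top)
  finally show ?thesis .
qed

text \<open>Let \<open>A j\<close> be the integral of \<open>\<bar>w\<bar>\<^sup>p\<close> over \<open>ball y (r / 2\<^sup>j)\<close>. Comparing consecutive balls gives
  \<open>A j \<le> \<sigma> 2\<^sup>n A (j + 1) + L c (r / 2\<^sup>j)\<^sup>p\<^sup>+\<^sup>l\<close> with \<open>n\<close> the dimension. Iterating, the \<open>j\<close>-th error carries the factor
  \<open>(\<sigma> 2\<^sup>n / 2\<^sup>p\<^sup>+\<^sup>l)\<^sup>j\<close>, which decays geometrically for \<open>\<sigma>\<close> close to \<open>1\<close> because \<open>n < p + l\<close>; and \<open>A j = 0\<close>
  for large \<open>j\<close> as \<open>w\<close> vanishes near \<open>y\<close>.\<close>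

lemma small_gradient_imp_small_function:
  fixes p l :: real
  assumes p: "0 < p" and l: "0 < l" and \<theta>: "real DIM('a::euclidean_space) < p + l"
  obtains C where "0 < C"
    "\<And>(w :: 'a \<Rightarrow> real) G y r c e. p_upper_gradient p w G \<Longrightarrow> 0 < e \<Longrightarrow> \<forall>x\<in>ball y e. w x = 0 \<Longrightarrow>
      0 < r \<Longrightarrow> 0 \<le> c \<Longrightarrow>
      (\<And>\<rho>. 0 < \<rho> \<Longrightarrow> \<rho> \<le> r \<Longrightarrow>
        (\<integral>\<^sup>+x\<in>ball y (3 * \<rho>). ennreal (G x) \<partial>lborel) \<le> ennreal (c * \<rho> powr l)) \<Longrightarrow>
      (\<integral>\<^sup>+x\<in>ball y r. ennreal (\<bar>w x\<bar> powr p) \<partial>lborel) \<le> ennreal (C * c * r powr (p + l))"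
proof -
  let ?d = "DIM('a)"
  define \<theta> where "\<theta> = p + l - ?d"
  have \<theta>0: "0 < \<theta>" using assms by (simp add: \<theta>_def)
  \<comment> \<open>Half of the gain \<open>\<theta>\<close> is spent on the constants \<open>\<sigma>\<close> of the chain; the other half makes it converge.\<close>
  define \<sigma> where "\<sigma> = 2 powr (\<theta> / 2)"
  have \<sigma>: "1 < \<sigma>" using \<theta>0 by (simp add: \<sigma>_def)
  obtain K where K: "0 < K" and split: "\<And>a b :: real. \<bar>a\<bar> powr p \<le> \<sigma> * \<bar>b\<bar> powr p + K * \<bar>b - a\<bar> powr p"
    using powr_le_split[OF p \<sigma>] by blast
  define L where "L = K * 2 powr p * 4 ^ ?d"
  have L: "0 < L" using K by (simp add: L_def)
  define q where "q = 2 powr (- \<theta> / 2)"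
  have q: "0 < q" "q < 1" using \<theta>0 powr_less_mono[of "- \<theta> / 2" 0 2] by (auto simp: q_def)
  have q_eq: "\<sigma> * 2 ^ ?d * (1 / 2) powr (p + l) = q"
  proof -
    have "(1 / 2 :: real) powr x = 2 powr (- x)" for x by (simp add: powr_minus_divide powr_divide)
    from this[of "p + l"] have "(1 / 2 :: real) powr (p + l) = 2 powr (- (p + l))" .
    moreover have "(2::real) ^ ?d = 2 powr ?d" by (simp add: powr_realpow)
    ultimately have "\<sigma> * 2 ^ ?d * (1 / 2) powr (p + l) = 2 powr (\<theta> / 2) * 2 powr ?d * 2 powr (- (p + l))"
      by (simp only: \<sigma>_def)
    also have "\<dots> = 2 powr (\<theta> / 2 + ?d + - (p + l))" by (simp only: powr_add)
    also have "\<theta> / 2 + ?d + - (p + l) = - \<theta> / 2" by (simp add: \<theta>_def field_simps)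
    finally show ?thesis by (simp add: q_def)
  qed
  define C where "C = L / (1 - q)"
  have C: "0 < C" using L q by (simp add: C_def)
  have "(\<integral>\<^sup>+x\<in>ball y r. ennreal (\<bar>w x\<bar> powr p) \<partial>lborel) \<le> ennreal (C * c * r powr (p + l))"
    if ug: "p_upper_gradient p w G" and e: "0 < e" "\<forall>x\<in>ball y e. w x = 0" and r: "0 < r" and c: "0 \<le> c"
      and small: "\<And>\<rho>. 0 < \<rho> \<Longrightarrow> \<rho> \<le> r \<Longrightarrow>
        (\<integral>\<^sup>+x\<in>ball y (3 * \<rho>). ennreal (G x) \<partial>lborel) \<le> ennreal (c * \<rho> powr l)"
    for w G :: "'a \<Rightarrow> real" and y r c e
  proof -
    define \<rho> where "\<rho> j = r * (1 / 2) ^ j" for j :: nat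
    have \<rho>: "0 < \<rho> j" "\<rho> j \<le> r" for j
      using r by (auto simp: \<rho>_def mult_le_cancel_left1 power_le_one)
    have \<rho>_powr: "\<rho> j powr (p + l) = r powr (p + l) * ((1 / 2) powr (p + l)) ^ j" for j
    proof -
      have "((1 / 2) ^ j) powr (p + l) = ((1 / 2 :: real) powr real j) powr (p + l)"
        by (subst powr_realpow) auto
      also have "\<dots> = ((1 / 2) powr (p + l)) powr real j" by (simp only: powr_powr mult.commute)
      also have "\<dots> = ((1 / 2) powr (p + l)) ^ j" by (rule powr_realpow) simp
      finally show ?thesis by (simp only: \<rho>_def powr_mult)
    qed
    define A where "A j = enn2real (\<integral>\<^sup>+x\<in>ball y (\<rho> j). ennreal (\<bar>w x\<bar> powr p) \<partial>lborel)" for j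
    have "continuous_on UNIV (\<lambda>x. \<bar>w x\<bar> powr p)"
      using p by (intro continuous_on_powr' continuous_intros p_upper_gradientD[OF ug]) auto
    from nn_integral_ball_finite[OF this]
    have A: "(\<integral>\<^sup>+x\<in>ball y (\<rho> j). ennreal (\<bar>w x\<bar> powr p) \<partial>lborel) = ennreal (A j)" for j
      by (simp add: A_def less_top)
    have A0: "0 \<le> A j" for j by (simp add: A_def)
    have step: "A j \<le> \<sigma> * 2 ^ ?d * A (Suc j) + L * c * \<rho> j powr (p + l)" for j
    proof -
      define \<omega> where "\<omega> = unit_ball_vol (real ?d)"
      have \<omega>: "0 < \<omega>" by (simp add: \<omega>_def)
      have vol: "emeasure lborel (ball z s) = ennreal (\<omega> * s ^ ?d)" if "0 \<le> s" for z :: 'a and s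
        using emeasure_ball[OF that, of z] by (simp add: \<omega>_def)
      have half: "\<rho> (Suc j) = \<rho> j / 2" by (simp add: \<rho>_def)
      have "emeasure lborel (ball y (\<rho> (Suc j))) * ennreal (A j) \<le>
          ennreal \<sigma> * (emeasure lborel (ball y (\<rho> j)) * ennreal (A (Suc j))) +
          ennreal K * (ennreal ((2 * \<rho> j) powr p) * emeasure lborel (ball (0::'a) (2 * \<rho> j)) *
            (\<integral>\<^sup>+x\<in>ball y (3 * \<rho> j). ennreal (G x) \<partial>lborel))"
        unfolding A[symmetric]
        by (rule p_upper_gradient_pair_average[OF ug p _ _ split])
          (use \<sigma> K \<rho>(1)[of j] half in auto)
      also have "\<dots> \<le> ennreal \<sigma> * (emeasure lborel (ball y (\<rho> j)) * ennreal (A (Suc j))) +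
          ennreal K * (ennreal ((2 * \<rho> j) powr p) * emeasure lborel (ball (0::'a) (2 * \<rho> j)) *
            ennreal (c * \<rho> j powr l))"
        by (intro add_left_mono mult_left_mono small \<rho>) auto
      also have "\<dots> = ennreal (\<sigma> * (\<omega> * \<rho> j ^ ?d * A (Suc j)) +
          K * ((2 * \<rho> j) powr p * (\<omega> * (2 * \<rho> j) ^ ?d) * (c * \<rho> j powr l)))"
        using \<sigma> K \<rho>(1)[of j] \<omega> A0 c by (simp add: vol ennreal_mult ennreal_plus)
      also have "emeasure lborel (ball y (\<rho> (Suc j))) * ennreal (A j)
          = ennreal (\<omega> * (\<rho> j / 2) ^ ?d * A j)"
        using \<rho>(1)[of j] \<omega> A0 by (simp add: vol half ennreal_mult)
      finally have "\<omega> * (\<rho> j / 2) ^ ?d * A j \<le> \<sigma> * (\<omega> * \<rho> j ^ ?d * A (Suc j)) +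
          K * ((2 * \<rho> j) powr p * (\<omega> * (2 * \<rho> j) ^ ?d) * (c * \<rho> j powr l))"
        using \<sigma> K \<rho>(1)[of j] \<omega> A0 c by (subst (asm) ennreal_le_iff) auto
      also have "\<dots> = \<omega> * (\<rho> j / 2) ^ ?d * (\<sigma> * 2 ^ ?d * A (Suc j) + L * c * \<rho> j powr (p + l))"
      proof -
        define T where "T = (2::real) ^ ?d"
        have T: "T \<noteq> 0" "(2::real) ^ ?d = T" by (simp_all add: T_def)
        have "(4::real) ^ ?d = T * T" by (simp add: T_def flip: power_mult_distrib)
        then show ?thesis
          unfolding L_def powr_mult powr_add power_mult_distrib power_divide T(2)
          using T(1) by (simp add: field_simps)
      qed
      finally show ?thesis using \<omega> \<rho>(1)[of j] by (subst (asm) mult_le_cancel_left_pos) auto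
    qed
    have iter: "A 0 \<le> (\<sigma> * 2 ^ ?d) ^ n * A n + L * c * r powr (p + l) * (\<Sum>j<n. q ^ j)" for n
    proof (induction n)
      case (Suc n)
      have "(\<sigma> * 2 ^ ?d) ^ n * A n
          \<le> (\<sigma> * 2 ^ ?d) ^ n * (\<sigma> * 2 ^ ?d * A (Suc n) + L * c * \<rho> n powr (p + l))"
        using \<sigma> by (intro mult_left_mono step) auto
      also have "\<dots> = (\<sigma> * 2 ^ ?d) ^ Suc n * A (Suc n) +
          L * c * r powr (p + l) * (\<sigma> * 2 ^ ?d * (1 / 2) powr (p + l)) ^ n"
        unfolding \<rho>_powr power_mult_distrib by (simp add: algebra_simps power_mult_distrib)
      finally show ?case using Suc unfolding q_eq by (simp add: algebra_simps)
    qed simp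
    obtain n where n: "\<rho> n < e"
    proof -
      have "\<exists>n. (1 / 2 :: real) ^ n < e / r" using e r by (intro real_arch_pow_inv) auto
      then show ?thesis using that r by (auto simp: \<rho>_def field_simps)
    qed
    have "(\<integral>\<^sup>+x\<in>ball y (\<rho> n). ennreal (\<bar>w x\<bar> powr p) \<partial>lborel) = (\<integral>\<^sup>+(x::'a). 0 \<partial>lborel)"
      using e n p by (intro nn_integral_cong) (auto simp: indicator_def)
    then have "A n = 0" by (simp add: A_def)
    then have "A 0 \<le> L * c * r powr (p + l) * (\<Sum>j<n. q ^ j)" using iter[of n] by simp
    also have "\<dots> \<le> L * c * r powr (p + l) * (1 / (1 - q))"
    proof (intro mult_left_mono)
      have "(\<Sum>j<n. q ^ j) \<le> (\<Sum>j. q ^ j)" using q by (intro sum_le_suminf) (auto intro: summable_geometric)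
      then show "(\<Sum>j<n. q ^ j) \<le> 1 / (1 - q)" using q by (simp add: suminf_geometric)
    qed (use L c in auto)
    finally have "A 0 \<le> C * c * r powr (p + l)" by (simp add: C_def)
    moreover have "\<rho> 0 = r" by (simp add: \<rho>_def)
    ultimately show ?thesis using A[of 0] by (simp add: ennreal_leI)
  qed
  with C show thesis by (rule that)
qed

section \<open>Thickness and the layer estimate\<close>

text \<open>Vitali's lemma selects disjoint balls among the \<open>ball y (3\<rho>)\<close> whose fivefold enlargements, of radius
  \<open>15\<rho>\<close>, cover \<open>F\<close>; their \<open>l\<close>-th powers are charged to the integrals of \<open>f\<close> over the disjoint balls. The
  content is defined by sequences of balls with positive radii, so a possibly finite family is
  padded by balls whose contributions sum to at most \<open>e\<close>.\<close>

lemma centered_hausdorff_content_le: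
  fixes F S :: "'a::euclidean_space set" and f :: "'a \<Rightarrow> ennreal"
  assumes F: "F \<noteq> {}" and l: "0 < l" and c: "0 < c"
    and [measurable]: "f \<in> borel_measurable borel" "S \<in> sets borel"
    and ball: "\<And>y. y \<in> F \<Longrightarrow> \<exists>\<rho>. 0 < \<rho> \<and> \<rho> \<le> r \<and> ball y (3 * \<rho>) \<subseteq> S \<and>
      ennreal (c * \<rho> powr l) \<le> (\<integral>\<^sup>+x\<in>ball y (3 * \<rho>). f x \<partial>lborel)"
  shows "centered_hausdorff_content l F \<le> ennreal (15 powr l / c) * (\<integral>\<^sup>+x\<in>S. f x \<partial>lborel)"
proof (rule ennreal_le_epsilon)
  fix e :: real assume e: "0 < e"
  obtain \<rho> where \<rho>: "\<And>y. y \<in> F \<Longrightarrow> 0 < \<rho> y" "\<And>y. y \<in> F \<Longrightarrow> \<rho> y \<le> r"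
    "\<And>y. y \<in> F \<Longrightarrow> ball y (3 * \<rho> y) \<subseteq> S"
    "\<And>y. y \<in> F \<Longrightarrow> ennreal (c * \<rho> y powr l) \<le> (\<integral>\<^sup>+x\<in>ball y (3 * \<rho> y). f x \<partial>lborel)"
  proof -
    have "\<exists>\<rho>. \<forall>y\<in>F. 0 < \<rho> y \<and> \<rho> y \<le> r \<and> ball y (3 * \<rho> y) \<subseteq> S \<and>
      ennreal (c * \<rho> y powr l) \<le> (\<integral>\<^sup>+x\<in>ball y (3 * \<rho> y). f x \<partial>lborel)"
      by (intro bchoice ballI ball)
    then show ?thesis using that by blast
  qed
  have "F \<subseteq> (\<Union>y\<in>F. ball y (3 * \<rho> y))" using \<rho>(1) by force
  then obtain C where C: "countable C" "C \<subseteq> F"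
      "pairwise (\<lambda>i j. disjnt (ball i (3 * \<rho> i)) (ball j (3 * \<rho> j))) C"
      and cover: "F \<subseteq> (\<Union>i\<in>C. ball i (5 * (3 * \<rho> i)))"
    by (rule Vitali_covering_lemma_balls[where S = F and K = F and a = "\<lambda>y. y" and r = "\<lambda>y. 3 * \<rho> y" and B = "3 * r"]) (use \<rho> in auto)
  obtain y0 where y0: "y0 \<in> F" using F by blast
  define N where "N = to_nat_on C ` C"
  define i where "i n = (if n \<in> N then from_nat_into C n else y0)" for n
  define R where "R n = (if n \<in> N then 15 * \<rho> (i n) else (e * (1 / 2) ^ Suc n) powr (1 / l))" for n
  define B where "B n = (if n \<in> N then ball (i n) (3 * \<rho> (i n)) else {})" for n
  have iN: "i (to_nat_on C a) = a" "to_nat_on C a \<in> N" if "a \<in> C" for a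
    using that C(1) by (auto simp: i_def N_def)
  have iC: "i n \<in> C" if "n \<in> N" for n using that iN by (auto simp: N_def)
  have iF: "i n \<in> F" for n using iC[of n] C(2) y0 by (cases "n \<in> N") (auto simp: i_def)
  have R: "0 < R n" for n using \<rho>(1)[OF iF[of n]] e by (auto simp: R_def)
  have "F \<subseteq> (\<Union>n. ball (i n) (R n))"
  proof
    fix x assume "x \<in> F"
    then obtain a where a: "a \<in> C" "x \<in> ball a (5 * (3 * \<rho> a))" using cover by blast
    then have "x \<in> ball (i (to_nat_on C a)) (R (to_nat_on C a))" using iN[OF a(1)] by (simp add: R_def)
    then show "x \<in> (\<Union>n. ball (i n) (R n))" by blast
  qed
  then have "centered_hausdorff_content l F \<le> (\<Sum>n. ennreal (R n powr l))"
    unfolding centered_hausdorff_content_def using iF R by (intro Inf_lower) auto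
  also have "\<dots> \<le> (\<Sum>n. ennreal (15 powr l / c) * (\<integral>\<^sup>+x\<in>B n. f x \<partial>lborel) + ennreal (e * (1 / 2) ^ Suc n))"
  proof (intro suminf_le summableI)
    fix n
    show "ennreal (R n powr l) \<le>
      ennreal (15 powr l / c) * (\<integral>\<^sup>+x\<in>B n. f x \<partial>lborel) + ennreal (e * (1 / 2) ^ Suc n)"
    proof (cases "n \<in> N")
      case True
      have "R n powr l = 15 powr l / c * (c * \<rho> (i n) powr l)"
        using True c by (simp add: R_def powr_mult)
      then have "ennreal (R n powr l) = ennreal (15 powr l / c) * ennreal (c * \<rho> (i n) powr l)"
        using c by (simp add: ennreal_mult[symmetric])
      also have "\<dots> \<le> ennreal (15 powr l / c) * (\<integral>\<^sup>+x\<in>B n. f x \<partial>lborel)"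
        using True \<rho>(4)[OF iF[of n]] by (intro mult_left_mono) (auto simp: B_def)
      finally show ?thesis by (rule order_trans) simp
    next
      case False
      then show ?thesis using l e by (simp add: R_def B_def powr_powr)
    qed
  qed
  also have "\<dots> = ennreal (15 powr l / c) * (\<Sum>n. \<integral>\<^sup>+x\<in>B n. f x \<partial>lborel) + (\<Sum>n. ennreal (e * (1 / 2) ^ Suc n))"
    by (subst suminf_add[symmetric]) auto
  also have "(\<Sum>n. \<integral>\<^sup>+x\<in>B n. f x \<partial>lborel) = (\<integral>\<^sup>+x\<in>(\<Union>n. B n). f x \<partial>lborel)"
  proof (rule nn_integral_disjoint_family[symmetric])
    show "disjoint_family B"
      unfolding disjoint_family_on_def
    proof (intro ballI impI)
      fix m n :: nat assume "m \<noteq> n"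
      show "B m \<inter> B n = {}"
      proof (cases "m \<in> N \<and> n \<in> N")
        case True
        then have "i m \<noteq> i n" using \<open>m \<noteq> n\<close> iN by (auto simp: N_def)
        then show ?thesis using True C(3) iC[of m] iC[of n] by (auto simp: B_def pairwise_def disjnt_def)
      qed (auto simp: B_def)
    qed
  qed (auto simp: B_def)
  also have "\<dots> \<le> (\<integral>\<^sup>+x\<in>S. f x \<partial>lborel)"
  proof (intro nn_integral_mono mult_left_mono)
    have "B n \<subseteq> S" for n using \<rho>(3)[OF iF[of n]] by (simp add: B_def)
    then show "indicator (\<Union>n. B n) x \<le> (indicator S x :: ennreal)" for x by (auto simp: indicator_def)
  qed auto
  also have "(\<Sum>n. ennreal (e * (1 / 2) ^ Suc n)) = ennreal e"
    using sums_mult[OF power_half_series, of e] e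
    by (intro suminf_ennreal_eq) auto
  finally show "centered_hausdorff_content l F \<le> ennreal (15 powr l / c) * (\<integral>\<^sup>+x\<in>S. f x \<partial>lborel) + ennreal e"
    by (simp add: mult_left_mono add_right_mono)
qed

text \<open>Energy \<open>J\<close> in \<open>ball x0 (4r)\<close> cannot be concentrated near all points of \<open>D\<close>: with \<open>c\<close> of order
  \<open>J / r\<^sup>l\<close>, if each \<open>y \<in> D \<inter> ball x0 r\<close> had a ball with energy above \<open>c \<rho>\<^sup>l\<close>, the content of
  \<open>D \<inter> ball x0 r\<close> would fall below \<open>\<gamma> r\<^sup>l\<close>. At a point without such balls,
  \<open>small_gradient_imp_small_function\<close> applies.\<close>

lemma thick_imp_small_average:
  fixes D :: "'a::euclidean_space set"
  assumes p: "0 < p" and l: "0 < l" and dim: "real DIM('a) < p + l" and \<gamma>: "0 < \<gamma>"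
    and thick: "\<And>x r. x \<in> D \<Longrightarrow> 0 < r \<Longrightarrow> r \<le> R \<Longrightarrow>
      ennreal (\<gamma> * r powr l) \<le> centered_hausdorff_content l (D \<inter> ball x r)"
  obtains C where "0 < C"
    "\<And>(w :: 'a \<Rightarrow> real) G x0 r J. p_upper_gradient p w G \<Longrightarrow>
      \<forall>y\<in>D. \<exists>e>0. \<forall>x\<in>ball y e. w x = 0 \<Longrightarrow> x0 \<in> D \<Longrightarrow> 0 < r \<Longrightarrow> r \<le> R \<Longrightarrow>
      (\<integral>\<^sup>+x\<in>ball x0 (4 * r). ennreal (G x) \<partial>lborel) < ennreal J \<Longrightarrow>
      \<exists>y. dist x0 y < r \<and> (\<integral>\<^sup>+x\<in>ball y r. ennreal (\<bar>w x\<bar> powr p) \<partial>lborel) \<le> ennreal (C * J * r powr p)"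
proof (rule small_gradient_imp_small_function[OF p l dim])
  fix C :: real
  assume C: "0 < C" and small: "\<And>(w :: 'a \<Rightarrow> real) G y r c e. p_upper_gradient p w G \<Longrightarrow> 0 < e \<Longrightarrow>
    \<forall>x\<in>ball y e. w x = 0 \<Longrightarrow> 0 < r \<Longrightarrow> 0 \<le> c \<Longrightarrow>
    (\<And>\<rho>. 0 < \<rho> \<Longrightarrow> \<rho> \<le> r \<Longrightarrow>
      (\<integral>\<^sup>+x\<in>ball y (3 * \<rho>). ennreal (G x) \<partial>lborel) \<le> ennreal (c * \<rho> powr l)) \<Longrightarrow>
    (\<integral>\<^sup>+x\<in>ball y r. ennreal (\<bar>w x\<bar> powr p) \<partial>lborel) \<le> ennreal (C * c * r powr (p + l))"
  have "\<exists>y. dist x0 y < r \<and>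
      (\<integral>\<^sup>+x\<in>ball y r. ennreal (\<bar>w x\<bar> powr p) \<partial>lborel) \<le> ennreal ((C * 15 powr l / \<gamma>) * J * r powr p)"
    if ug: "p_upper_gradient p w G" and van: "\<forall>y\<in>D. \<exists>e>0. \<forall>x\<in>ball y e. w x = 0"
      and x0: "x0 \<in> D" and r: "0 < r" "r \<le> R"
      and J: "(\<integral>\<^sup>+x\<in>ball x0 (4 * r). ennreal (G x) \<partial>lborel) < ennreal J"
    for w G :: "'a \<Rightarrow> real" and x0 r J
  proof (rule ccontr)
    assume contr: "\<not> ?thesis"
    have J0: "0 < J" using J by (cases "0 < J") (auto simp: ennreal_neg)
    have [measurable]: "G \<in> borel_measurable borel" by (rule p_upper_gradientD[OF ug])
    \<comment> \<open>With this value \<open>15\<^sup>l / c * J\<close> is exactly the lower bound \<open>\<gamma> r\<^sup>l\<close> of thickness.\<close>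
    define c where "c = 15 powr l * J / (\<gamma> * r powr l)"
    have c: "0 < c" using J0 \<gamma> r by (simp add: c_def)
    have eq: "C * c * r powr (p + l) = (C * 15 powr l / \<gamma>) * J * r powr p"
      using r \<gamma> by (simp add: c_def powr_add field_simps)
    have "centered_hausdorff_content l (D \<inter> ball x0 r) \<le>
        ennreal (15 powr l / c) * (\<integral>\<^sup>+x\<in>ball x0 (4 * r). ennreal (G x) \<partial>lborel)"
    proof (rule centered_hausdorff_content_le[OF _ l c])
      show "D \<inter> ball x0 r \<noteq> {}" using x0 r by auto
      fix y assume y: "y \<in> D \<inter> ball x0 r"
      obtain e where e: "0 < e" "\<forall>x\<in>ball y e. w x = 0" using van y by blast
      have "\<not> (\<forall>\<rho>. 0 < \<rho> \<and> \<rho> \<le> r \<longrightarrow>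
          (\<integral>\<^sup>+x\<in>ball y (3 * \<rho>). ennreal (G x) \<partial>lborel) \<le> ennreal (c * \<rho> powr l))"
      proof
        assume *: "\<forall>\<rho>. 0 < \<rho> \<and> \<rho> \<le> r \<longrightarrow>
          (\<integral>\<^sup>+x\<in>ball y (3 * \<rho>). ennreal (G x) \<partial>lborel) \<le> ennreal (c * \<rho> powr l)"
        have "(\<integral>\<^sup>+x\<in>ball y r. ennreal (\<bar>w x\<bar> powr p) \<partial>lborel) \<le> ennreal (C * c * r powr (p + l))"
          using * c by (intro small[OF ug e r(1)]) auto
        then show False using contr y unfolding eq by auto
      qed
      then obtain \<rho> where \<rho>: "0 < \<rho>" "\<rho> \<le> r"
          "ennreal (c * \<rho> powr l) \<le> (\<integral>\<^sup>+x\<in>ball y (3 * \<rho>). ennreal (G x) \<partial>lborel)"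
        by (auto simp: not_le intro: less_imp_le)
      moreover have "ball y (3 * \<rho>) \<subseteq> ball x0 (4 * r)"
      proof
        fix z assume "z \<in> ball y (3 * \<rho>)"
        then show "z \<in> ball x0 (4 * r)" using y \<rho>(1,2) dist_triangle[of x0 z y] by auto
      qed
      ultimately show "\<exists>\<rho>. 0 < \<rho> \<and> \<rho> \<le> r \<and> ball y (3 * \<rho>) \<subseteq> ball x0 (4 * r) \<and>
          ennreal (c * \<rho> powr l) \<le> (\<integral>\<^sup>+x\<in>ball y (3 * \<rho>). ennreal (G x) \<partial>lborel)"
        by blast
    qed auto
    also have "\<dots> < ennreal (15 powr l / c) * ennreal J"
      using J c by (intro ennreal_mult_strict_left_mono) auto
    also have "\<dots> = ennreal (\<gamma> * r powr l)"
      using c J0 \<gamma> r by (subst ennreal_mult[symmetric]) (auto simp: c_def)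
    finally show False using thick[OF x0 r] by simp
  qed
  moreover have "0 < C * 15 powr l / \<gamma>" using C \<gamma> by simp
  ultimately show thesis by (rule that[rotated])
qed

lemma set_infdist_le_borel [measurable]: "{x. infdist x D \<le> r} \<in> sets borel"
  by (intro borel_closed closed_Collect_le continuous_intros)

text \<open>For \<open>x\<close> in the layer choose a point \<open>y\<close> within distance \<open>2r\<close> around which \<open>\<bar>w\<bar>\<^sup>p\<close> has a small average.
  Then \<open>\<bar>w x\<bar>\<^sup>p\<close> is controlled by this average and by the mean increment from \<open>x\<close> to points of \<open>ball y r\<close>.
  The point \<open>y\<close> depends on \<open>x\<close>, but all balls involved lie in balls centred at \<open>x\<close>, so the
  translation estimates allow integration over all \<open>x\<close> in the layer at once.\<close>

lemma thick_imp_layer_estimate: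
  fixes D :: "'a::euclidean_space set"
  assumes D: "closed D" "D \<noteq> {}"
    and p: "0 < p" and l: "0 < l" and dim: "real DIM('a) < p + l" and \<gamma>: "0 < \<gamma>"
    and thick: "\<And>x r. x \<in> D \<Longrightarrow> 0 < r \<Longrightarrow> r \<le> R \<Longrightarrow>
      ennreal (\<gamma> * r powr l) \<le> centered_hausdorff_content l (D \<inter> ball x r)"
  obtains C where "0 < C"
    "\<And>(w :: 'a \<Rightarrow> real) G r. p_upper_gradient p w G \<Longrightarrow> \<forall>y\<in>D. \<exists>e>0. \<forall>x\<in>ball y e. w x = 0 \<Longrightarrow>
      0 < r \<Longrightarrow> r \<le> R \<Longrightarrow>
      (\<integral>\<^sup>+x\<in>{x. infdist x D \<le> r}. ennreal (\<bar>w x\<bar> powr p) \<partial>lborel) \<le>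
        ennreal (C * r powr p) * (\<integral>\<^sup>+x\<in>{x. infdist x D \<le> 6 * r}. ennreal (G x) \<partial>lborel)"
proof (rule thick_imp_small_average[OF p l dim \<gamma> thick])
  let ?d = "DIM('a)"
  fix C :: real
  assume C: "0 < C" and avg: "\<And>(w :: 'a \<Rightarrow> real) G x0 r J. p_upper_gradient p w G \<Longrightarrow>
    \<forall>y\<in>D. \<exists>e>0. \<forall>x\<in>ball y e. w x = 0 \<Longrightarrow> x0 \<in> D \<Longrightarrow> 0 < r \<Longrightarrow> r \<le> R \<Longrightarrow>
    (\<integral>\<^sup>+x\<in>ball x0 (4 * r). ennreal (G x) \<partial>lborel) < ennreal J \<Longrightarrow>
    \<exists>y. dist x0 y < r \<and> (\<integral>\<^sup>+x\<in>ball y r. ennreal (\<bar>w x\<bar> powr p) \<partial>lborel) \<le> ennreal (C * J * r powr p)"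
  obtain K where K: "0 < K" and split: "\<And>a b :: real. \<bar>a\<bar> powr p \<le> 2 * \<bar>b\<bar> powr p + K * \<bar>b - a\<bar> powr p"
    using powr_le_split[OF p, of 2] by auto
  define \<omega> where "\<omega> = unit_ball_vol (real ?d)"
  have \<omega>: "0 < \<omega>" by (simp add: \<omega>_def)
  have vol: "emeasure lborel (ball z s) = ennreal (\<omega> * s ^ ?d)" if "0 \<le> s" for z :: 'a and s
    using emeasure_ball[OF that, of z] by (simp add: \<omega>_def)
  define M where "M = 2 * C * 5 ^ ?d + K * 3 powr p * 3 ^ ?d"
  have M: "0 < M" using C K by (simp add: M_def add_pos_pos)
  have "(\<integral>\<^sup>+x\<in>{x. infdist x D \<le> r}. ennreal (\<bar>w x\<bar> powr p) \<partial>lborel) \<le>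
      ennreal (M * r powr p) * (\<integral>\<^sup>+x\<in>{x. infdist x D \<le> 6 * r}. ennreal (G x) \<partial>lborel)"
    if ug: "p_upper_gradient p w G" and van: "\<forall>y\<in>D. \<exists>e>0. \<forall>x\<in>ball y e. w x = 0"
      and r: "0 < r" "r \<le> R" for w G :: "'a \<Rightarrow> real" and r
  proof -
    have [measurable]: "w \<in> borel_measurable borel" "G \<in> borel_measurable borel"
      by (rule p_upper_gradientD[OF ug])+
    have [measurable]: "ball c s \<in> sets borel" for c :: 'a and s by simp
    let ?A = "{x. infdist x D \<le> r}" and ?S = "{x. infdist x D \<le> 6 * r}"
    let ?J = "\<integral>\<^sup>+x\<in>?S. ennreal (G x) \<partial>lborel"
    have pt: "ennreal (\<omega> * r ^ ?d) * ennreal (\<bar>w x\<bar> powr p) \<le>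
        ennreal (2 * C * r powr p) * (\<integral>\<^sup>+z\<in>ball 0 (5 * r). ennreal (G (x + z)) \<partial>lborel) +
        ennreal K * (\<integral>\<^sup>+z\<in>ball 0 (3 * r). ennreal (\<bar>w (x + z) - w x\<bar> powr p) \<partial>lborel)"
      if x: "x \<in> ?A" for x
    proof (rule ennreal_le_epsilon)
      fix e :: real assume e: "0 < e"
      let ?J = "\<integral>\<^sup>+z\<in>ball 0 (5 * r). ennreal (G (x + z)) \<partial>lborel"
      let ?I = "\<integral>\<^sup>+z\<in>ball 0 (3 * r). ennreal (\<bar>w (x + z) - w x\<bar> powr p) \<partial>lborel"
      obtain x0 where x0: "x0 \<in> D" "dist x x0 \<le> r"
        using infdist_attains_inf[OF D, of x] x by force
      have "continuous_on UNIV (\<lambda>z. G (x + z))"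
        by (rule continuous_on_compose2[OF p_upper_gradientD(2)[OF ug]]) (auto intro!: continuous_intros)
      from nn_integral_ball_finite[OF this, of 0 "5 * r"] have "?J < \<infinity>" .
      then obtain j where j: "?J = ennreal j" "0 \<le> j" by (cases ?J rule: ennreal_cases) auto
      \<comment> \<open>The strict inequality in \<open>avg\<close> forces a margin, chosen so that it contributes \<open>e\<close> in the end.\<close>
      define J where "J = j + e / (2 * C * r powr p)"
      have Jj: "j < J" using e C r by (simp add: J_def)
      have "(\<integral>\<^sup>+a\<in>ball x0 (4 * r). ennreal (G a) \<partial>lborel)
          = (\<integral>\<^sup>+z. ennreal (G (z + x)) * indicator (ball x0 (4 * r)) (z + x) \<partial>lborel)"
        by (rule nn_integral_lborel_shift[symmetric]) measurable
      also have "\<dots> \<le> ?J"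
      proof (rule nn_integral_mono)
        fix z
        have "z \<in> ball 0 (5 * r)" if "z + x \<in> ball x0 (4 * r)"
        proof -
          have "dist (z + x) x < 5 * r" using that x0(2) by simp metric
          then show ?thesis by (simp add: dist_norm)
        qed
        then show "ennreal (G (z + x)) * indicator (ball x0 (4 * r)) (z + x)
            \<le> ennreal (G (x + z)) * indicator (ball 0 (5 * r)) z"
          by (auto simp: indicator_def add.commute)
      qed
      also have "\<dots> < ennreal J" using j Jj by (simp add: ennreal_less_iff)
      finally obtain y where y: "dist x0 y < r"
          "(\<integral>\<^sup>+a\<in>ball y r. ennreal (\<bar>w a\<bar> powr p) \<partial>lborel) \<le> ennreal (C * J * r powr p)"
        using avg[OF ug van x0(1) r] by blast
      have "ennreal (\<omega> * r ^ ?d) * ennreal (\<bar>w x\<bar> powr p)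
          = (\<integral>\<^sup>+a. ennreal (\<bar>w x\<bar> powr p) * indicator (ball y r) a \<partial>lborel)"
      proof -
        have "(\<integral>\<^sup>+a. ennreal (\<bar>w x\<bar> powr p) * indicator (ball y r) a \<partial>lborel)
            = ennreal (\<bar>w x\<bar> powr p) * emeasure lborel (ball y r)"
          by (rule nn_integral_cmult_indicator) simp
        then show ?thesis using r vol[of r y] by (simp only: mult.commute less_imp_le)
      qed
      also have "\<dots> \<le> (\<integral>\<^sup>+a. ennreal 2 * (ennreal (\<bar>w a\<bar> powr p) * indicator (ball y r) a) +
          ennreal K * (ennreal (\<bar>w a - w x\<bar> powr p) * indicator (ball y r) a) \<partial>lborel)"
      proof (rule nn_integral_mono)
        fix a
        have "ennreal (\<bar>w x\<bar> powr p) \<le> ennreal 2 * ennreal (\<bar>w a\<bar> powr p) +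
            ennreal K * ennreal (\<bar>w a - w x\<bar> powr p)"
          using split[of "w x" "w a"] K
          by (subst ennreal_mult[symmetric], simp, simp, subst ennreal_mult[symmetric])
            (auto simp flip: ennreal_plus intro!: ennreal_leI)
        then show "ennreal (\<bar>w x\<bar> powr p) * indicator (ball y r) a \<le>
            ennreal 2 * (ennreal (\<bar>w a\<bar> powr p) * indicator (ball y r) a) +
            ennreal K * (ennreal (\<bar>w a - w x\<bar> powr p) * indicator (ball y r) a)"
          by (auto simp: indicator_def)
      qed
      also have "\<dots> = ennreal 2 * (\<integral>\<^sup>+a\<in>ball y r. ennreal (\<bar>w a\<bar> powr p) \<partial>lborel) +
          ennreal K * (\<integral>\<^sup>+a\<in>ball y r. ennreal (\<bar>w a - w x\<bar> powr p) \<partial>lborel)"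
        by (simp add: nn_integral_add nn_integral_cmult)
      also have "\<dots> \<le> ennreal 2 * ennreal (C * J * r powr p) + ennreal K * ?I"
      proof (intro add_mono mult_left_mono y)
        have "(\<integral>\<^sup>+a\<in>ball y r. ennreal (\<bar>w a - w x\<bar> powr p) \<partial>lborel)
          = (\<integral>\<^sup>+z. ennreal (\<bar>w (z + x) - w x\<bar> powr p) * indicator (ball y r) (z + x) \<partial>lborel)"
          by (rule nn_integral_lborel_shift[symmetric]) measurable
        also have "\<dots> \<le> ?I"
        proof (rule nn_integral_mono)
          fix z
          have "z \<in> ball 0 (3 * r)" if "z + x \<in> ball y r"
          proof -
            have "dist (z + x) x < 3 * r" using that x0(2) y(1) by simp metric
            then show ?thesis by (simp add: dist_norm)
          qed
          then show "ennreal (\<bar>w (z + x) - w x\<bar> powr p) * indicator (ball y r) (z + x)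
              \<le> ennreal (\<bar>w (x + z) - w x\<bar> powr p) * indicator (ball 0 (3 * r)) z"
            by (auto simp: indicator_def add.commute)
        qed
        finally show "(\<integral>\<^sup>+a\<in>ball y r. ennreal (\<bar>w a - w x\<bar> powr p) \<partial>lborel) \<le> ?I" .
      qed auto
      also have "ennreal 2 * ennreal (C * J * r powr p) = ennreal (2 * C * r powr p) * ?J + ennreal e"
      proof -
        have "2 * (C * J * r powr p) = 2 * C * r powr p * j + e"
          using C r by (simp add: J_def field_simps)
        moreover have "ennreal 2 * ennreal (C * J * r powr p) = ennreal (2 * (C * J * r powr p))"
          using C j Jj by (intro ennreal_mult[symmetric]) auto
        moreover have "ennreal (2 * C * r powr p * j + e) = ennreal (2 * C * r powr p * j) + ennreal e"
          using C j e by (intro ennreal_plus) auto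
        moreover have "ennreal (2 * C * r powr p * j) = ennreal (2 * C * r powr p) * ennreal j"
          using C j by (intro ennreal_mult) auto
        ultimately show ?thesis by (simp only: j(1))
      qed
      finally show "ennreal (\<omega> * r ^ ?d) * ennreal (\<bar>w x\<bar> powr p) \<le>
          ennreal (2 * C * r powr p) * ?J + ennreal K * ?I + ennreal e"
        by (simp add: ac_simps)
    qed
    have "ennreal (\<omega> * r ^ ?d) * (\<integral>\<^sup>+x\<in>?A. ennreal (\<bar>w x\<bar> powr p) \<partial>lborel)
        = (\<integral>\<^sup>+x. ennreal (\<omega> * r ^ ?d) * ennreal (\<bar>w x\<bar> powr p) * indicator ?A x \<partial>lborel)"
      by (simp add: nn_integral_cmult mult.assoc)
    also have "\<dots> \<le> (\<integral>\<^sup>+x. ennreal (2 * C * r powr p) *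
          ((\<integral>\<^sup>+z\<in>ball 0 (5 * r). ennreal (G (x + z)) \<partial>lborel) * indicator ?A x) +
        ennreal K * ((\<integral>\<^sup>+z\<in>ball 0 (3 * r). ennreal (\<bar>w (x + z) - w x\<bar> powr p) \<partial>lborel) * indicator ?A x) \<partial>lborel)"
      by (rule nn_integral_mono) (use pt in \<open>auto simp: indicator_def\<close>)
    also have "\<dots> = ennreal (2 * C * r powr p) *
          (\<integral>\<^sup>+x\<in>?A. (\<integral>\<^sup>+z\<in>ball 0 (5 * r). ennreal (G (x + z)) \<partial>lborel) \<partial>lborel) +
        ennreal K * (\<integral>\<^sup>+x\<in>?A. (\<integral>\<^sup>+z\<in>ball 0 (3 * r). ennreal (\<bar>w (x + z) - w x\<bar> powr p) \<partial>lborel) \<partial>lborel)"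
      by (simp add: nn_integral_add nn_integral_cmult)
    also have "\<dots> \<le> ennreal (2 * C * r powr p) * (emeasure lborel (ball (0::'a) (5 * r)) * ?J) +
        ennreal K * (ennreal ((3 * r) powr p) * emeasure lborel (ball (0::'a) (3 * r)) * ?J)"
    proof (intro add_mono mult_left_mono nn_integral_translates_le p_upper_gradient_increments_le[OF ug p])
      have inf: "infdist (a + z) D \<le> infdist a D + norm z" for a z :: 'a
        using infdist_triangle[of "a + z" D a] by (simp add: dist_norm)
      show "a + z \<in> ?S" if "a \<in> ?A" "z \<in> ball 0 (5 * r)" for a z
        using that inf[of a z] by auto
      show "a + z \<in> ?S" if "a \<in> ?A" "z \<in> ball 0 (3 * r)" for a z
        using that inf[of a z] r by auto
    qed auto
    also have "\<dots> = ennreal (\<omega> * r ^ ?d) * (ennreal (M * r powr p) * ?J)"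
    proof -
      have eq: "2 * C * r powr p * (\<omega> * (5 * r) ^ ?d) + K * ((3 * r) powr p * (\<omega> * (3 * r) ^ ?d))
          = \<omega> * r ^ ?d * (M * r powr p)"
        using r by (simp add: M_def powr_mult power_mult_distrib algebra_simps)
      have "ennreal (2 * C * r powr p) * (emeasure lborel (ball (0::'a) (5 * r)) * ?J) +
          ennreal K * (ennreal ((3 * r) powr p) * emeasure lborel (ball (0::'a) (3 * r)) * ?J)
          = ennreal (2 * C * r powr p * (\<omega> * (5 * r) ^ ?d)) * ?J + ennreal (K * ((3 * r) powr p * (\<omega> * (3 * r) ^ ?d))) * ?J"
        using r C K \<omega> by (simp add: vol ennreal_mult mult.assoc)
      also have "\<dots> = ennreal (\<omega> * r ^ ?d * (M * r powr p)) * ?J"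
        unfolding eq[symmetric] using r C K \<omega> by (subst ennreal_plus) (auto simp: distrib_right)
      finally show ?thesis using r C M \<omega> by (simp add: ennreal_mult mult.assoc)
    qed
    finally show ?thesis using \<omega> r by (subst (asm) ennreal_mult_le_mult_iff) auto
  qed
  with M show thesis by (rule that)
qed

section \<open>Summation over dyadic layers\<close>

text \<open>Bernoulli's inequality; it shows that a geometric series of ratio \<open>2\<^sup>-\<^sup>\<beta>\<close> has a sum of order \<open>1/\<beta>\<close>.\<close>

lemma half_powr_le:
  fixes \<beta> :: real
  assumes "0 < \<beta>" "\<beta> \<le> 1"
  shows "(1 / 2) powr \<beta> \<le> 1 - \<beta> / 2"
proof -
  have "1 / 2 \<le> (1 - \<beta> / 2) powr (1 / \<beta>)"
    using powr_ge_tangent[of "1 / \<beta>" 1 "1 - \<beta> / 2"] assms by (simp add: field_simps)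
  then have "(1 / 2) powr \<beta> \<le> ((1 - \<beta> / 2) powr (1 / \<beta>)) powr \<beta>"
    using assms by (intro powr_mono2) auto
  also have "\<dots> = 1 - \<beta> / 2" using assms by (simp add: powr_powr)
  finally show ?thesis .
qed

text \<open>The terms grow geometrically until \<open>R / 2\<^sup>k\<close> drops below \<open>d / 6\<close> and vanish afterwards, so the last
  nonzero term determines the sum up to a factor of order \<open>1/\<beta>\<close>. That this factor is no worse than
  \<open>1/\<beta>\<close> matters for the absorption argument.\<close>

lemma dyadic_sum_le:
  fixes \<beta> d R :: real
  assumes \<beta>: "0 < \<beta>" "\<beta> \<le> 1" and d: "0 < d" and R: "0 < R"
  shows "(\<Sum>k. ennreal (if d \<le> 6 * (R / 2 ^ k) then (R / 2 ^ k) powr (- \<beta>) else 0))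
    \<le> ennreal (12 / \<beta> * d powr (- \<beta>))"
proof -
  define r where "r k = R / 2 ^ k" for k :: nat
  define q where "q = (1 / 2) powr \<beta>"
  have r: "0 < r k" "r (Suc k) = r k / 2" for k using R by (auto simp: r_def)
  have q: "0 < q" "q \<le> 1 - \<beta> / 2" using half_powr_le[OF \<beta>] by (auto simp: q_def)
  have rq: "r k powr (- \<beta>) = q * r (Suc k) powr (- \<beta>)" for k
  proof -
    have "r (Suc k) = (1 / 2) * r k" by (simp add: r)
    then have "r (Suc k) powr (- \<beta>) = (1 / 2) powr (- \<beta>) * r k powr (- \<beta>)"
      by (simp only: powr_mult)
    then show ?thesis by (simp add: q_def powr_minus)
  qed
  define t where "t k = (if d \<le> 6 * r k then r k powr (- \<beta>) else 0)" for k
  have t0: "0 \<le> t k" for k by (simp add: t_def)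
  \<comment> \<open>As long as the terms do not vanish, they add up like a geometric series.\<close>
  have before: "d \<le> 6 * r n \<Longrightarrow> (1 - q) * (\<Sum>k<n. t k) \<le> q * r n powr (- \<beta>)" for n
  proof (induction n)
    case (Suc n)
    then have n: "d \<le> 6 * r n" using r[of n] by auto
    have "(1 - q) * (\<Sum>k<Suc n. t k) = (1 - q) * (\<Sum>k<n. t k) + (1 - q) * r n powr (- \<beta>)"
      using n by (simp add: t_def algebra_simps)
    also have "\<dots> \<le> r n powr (- \<beta>)" using Suc.IH[OF n] by (simp add: algebra_simps)
    finally show ?case using rq[of n] by simp
  qed (use q in simp)
  have "(1 - q) * (\<Sum>k<n. t k) \<le> (d / 6) powr (- \<beta>)" for n
  proof (induction n)
    case (Suc n)
    show ?case
    proof (cases "d \<le> 6 * r n")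
      case True
      have "(1 - q) * (\<Sum>k<Suc n. t k) = (1 - q) * (\<Sum>k<n. t k) + (1 - q) * r n powr (- \<beta>)"
        using True by (simp add: t_def algebra_simps)
      also have "\<dots> \<le> r n powr (- \<beta>)" using before[OF True] by (simp add: algebra_simps)
      also have "\<dots> \<le> (d / 6) powr (- \<beta>)" using True d r[of n] \<beta> by (intro powr_mono2') auto
      finally show ?thesis .
    next
      case False
      then show ?thesis using Suc by (simp add: t_def)
    qed
  qed simp
  moreover have "\<beta> / 2 * (\<Sum>k<n. t k) \<le> (1 - q) * (\<Sum>k<n. t k)" for n
    using q t0 by (intro mult_right_mono sum_nonneg) auto
  ultimately have le: "\<beta> / 2 * (\<Sum>k<n. t k) \<le> (d / 6) powr (- \<beta>)" for n by (meson order_trans)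
  have "(d / 6) powr (- \<beta>) = d powr (- \<beta>) * 6 powr \<beta>"
    using d by (simp add: powr_divide powr_minus field_simps)
  also have "\<dots> \<le> d powr (- \<beta>) * 6"
    using \<beta> powr_mono[of \<beta> 1 "6::real"] by (intro mult_left_mono) auto
  finally have "\<beta> / 2 * (\<Sum>k<n. t k) \<le> d powr (- \<beta>) * 6" for n using le[of n] by linarith
  then have bound: "(\<Sum>k<n. t k) \<le> 12 / \<beta> * d powr (- \<beta>)" for n
    using \<beta> by (simp add: field_simps)
  have "(\<Sum>k. ennreal (t k)) = (SUP n. \<Sum>k<n. ennreal (t k))" by (rule suminf_eq_SUP)
  also have "\<dots> \<le> ennreal (12 / \<beta> * d powr (- \<beta>))"
    using bound t0 by (intro SUP_least) (simp add: ennreal_leI)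
  finally show ?thesis unfolding t_def r_def .
qed

lemma obtain_dyadic_scale:
  fixes d R :: real
  assumes "0 < d" "d \<le> R"
  obtains k :: nat where "d \<le> R / 2 ^ k" "R / 2 ^ k < 2 * d"
proof -
  have "\<exists>k. (1 / 2 :: real) ^ k < 2 * d / R" using assms by (intro real_arch_pow_inv) auto
  then have ex: "\<exists>k. R / 2 ^ k < 2 * d" using assms by (auto simp: field_simps power_one_over)
  define k where "k = (LEAST k. R / 2 ^ k < 2 * d)"
  have k: "R / 2 ^ k < 2 * d" unfolding k_def by (rule LeastI_ex[OF ex])
  have "d \<le> R / 2 ^ k"
  proof (cases k)
    case 0
    then show ?thesis using assms by simp
  next
    case (Suc j)
    then have "\<not> R / 2 ^ j < 2 * d" using not_less_Least[of j "\<lambda>k. R / 2 ^ k < 2 * d"] by (simp add: k_def)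
    then show ?thesis by (simp add: Suc field_simps)
  qed
  with k show thesis by (rule that[rotated])
qed

text \<open>Multiply the layer estimate for \<open>r = R / 2\<^sup>k\<close> by \<open>r\<^sup>-\<^sup>p\<^sup>-\<^sup>\<beta>\<close> and sum over \<open>k\<close>. On the left one suitable
  term already gives the weight \<open>d\<^sup>-\<^sup>p\<^sup>-\<^sup>\<beta>\<close>; on the right the sum is \<open>dyadic_sum_le\<close>.\<close>

lemma layer_estimate_imp_weighted_estimate:
  fixes D :: "'a::euclidean_space set" and w G :: "'a \<Rightarrow> real"
  assumes p: "0 < p" and \<beta>: "0 < \<beta>" "\<beta> \<le> 1" and R: "0 < R" and C: "0 \<le> C"
    and [measurable]: "w \<in> borel_measurable borel" "G \<in> borel_measurable borel"
    and G: "\<And>x. 0 \<le> G x" "\<And>x. infdist x D = 0 \<Longrightarrow> G x = 0"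
    and layer: "\<And>r. 0 < r \<Longrightarrow> r \<le> R \<Longrightarrow>
      (\<integral>\<^sup>+x\<in>{x. infdist x D \<le> r}. ennreal (\<bar>w x\<bar> powr p) \<partial>lborel) \<le>
        ennreal (C * r powr p) * (\<integral>\<^sup>+x\<in>{x. infdist x D \<le> 6 * r}. ennreal (G x) \<partial>lborel)"
  shows "(\<integral>\<^sup>+x\<in>{x. infdist x D \<le> R}. ennreal (\<bar>w x\<bar> powr p * infdist x D powr (- p - \<beta>)) \<partial>lborel) \<le>
    ennreal (12 * 2 powr (p + 1) * C / \<beta>) * (\<integral>\<^sup>+x. ennreal (G x * infdist x D powr (- \<beta>)) \<partial>lborel)"
proof -
  define r where "r k = R / 2 ^ k" for k :: nat
  have r: "0 < r k" "r k \<le> R" for k using R by (auto simp: r_def field_simps)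
  let ?d = "\<lambda>x. infdist x D"
  have [measurable]: "?d \<in> borel_measurable borel"
    by (intro borel_measurable_continuous_onI continuous_intros)
  let ?u = "\<lambda>k x. ennreal (r k powr (- p - \<beta>)) * (ennreal (\<bar>w x\<bar> powr p) * indicator {x. ?d x \<le> r k} x)"
  have "(\<integral>\<^sup>+x\<in>{x. ?d x \<le> R}. ennreal (\<bar>w x\<bar> powr p * ?d x powr (- p - \<beta>)) \<partial>lborel)
      \<le> (\<integral>\<^sup>+x. ennreal (2 powr (p + 1)) * (\<Sum>k. ?u k x) \<partial>lborel)"
  proof (rule nn_integral_mono)
    fix x :: 'a
    show "ennreal (\<bar>w x\<bar> powr p * ?d x powr (- p - \<beta>)) * indicator {x. ?d x \<le> R} x
      \<le> ennreal (2 powr (p + 1)) * (\<Sum>k. ?u k x)"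
    proof (cases "0 < ?d x \<and> ?d x \<le> R")
      case True
      then obtain k where k: "?d x \<le> r k" "r k < 2 * ?d x"
        using obtain_dyadic_scale[of "?d x" R] by (auto simp: r_def)
      have "?d x powr (- p - \<beta>) = 2 powr (p + \<beta>) * (2 * ?d x) powr (- p - \<beta>)"
      proof -
        have "(2 * ?d x) powr (- p - \<beta>) = 2 powr (- (p + \<beta>)) * ?d x powr (- p - \<beta>)"
          by (simp add: powr_mult)
        then show ?thesis unfolding powr_minus by simp
      qed
      also have "\<dots> \<le> 2 powr (p + 1) * r k powr (- p - \<beta>)"
        using k r(1)[of k] p \<beta> by (intro mult_mono powr_mono powr_mono2') auto
      finally have "\<bar>w x\<bar> powr p * ?d x powr (- p - \<beta>) \<le> 2 powr (p + 1) * (r k powr (- p - \<beta>) * \<bar>w x\<bar> powr p)"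
        by (metis mult.assoc mult.commute mult_left_mono powr_ge_zero)
      then have "ennreal (\<bar>w x\<bar> powr p * ?d x powr (- p - \<beta>)) \<le> ennreal (2 powr (p + 1)) * ?u k x"
        using k(1) by (simp flip: ennreal_mult add: ennreal_leI)
      also have "?u k x \<le> (\<Sum>k. ?u k x)"
        using sum_le_suminf[of "\<lambda>k. ?u k x" "{k}"] by auto
      finally show ?thesis using True by (simp add: mult_left_mono)
    next
      case False
      then have "?d x = 0 \<or> \<not> ?d x \<le> R" using infdist_nonneg[of x D] by auto
      then show ?thesis by auto
    qed
  qed
  also have "\<dots> = ennreal (2 powr (p + 1)) * (\<Sum>k. ennreal (r k powr (- p - \<beta>)) *
      (\<integral>\<^sup>+x\<in>{x. ?d x \<le> r k}. ennreal (\<bar>w x\<bar> powr p) \<partial>lborel))"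
    by (simp add: nn_integral_cmult nn_integral_suminf)
  also have "\<dots> \<le> ennreal (2 powr (p + 1)) * (\<Sum>k. ennreal (r k powr (- p - \<beta>)) *
      (ennreal (C * r k powr p) * (\<integral>\<^sup>+x\<in>{x. ?d x \<le> 6 * r k}. ennreal (G x) \<partial>lborel)))"
    by (intro mult_left_mono suminf_le layer r) auto
  also have "\<dots> = ennreal (2 powr (p + 1)) * (\<Sum>k. ennreal C * (ennreal (r k powr (- \<beta>)) *
      (\<integral>\<^sup>+x\<in>{x. ?d x \<le> 6 * r k}. ennreal (G x) \<partial>lborel)))"
  proof -
    have "ennreal (r k powr (- p - \<beta>)) * ennreal (C * r k powr p) = ennreal C * ennreal (r k powr (- \<beta>))" for k
    proof -
      have "r k powr (- p - \<beta>) * r k powr p = r k powr (- \<beta>)" by (simp flip: powr_add)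
      then have "r k powr (- p - \<beta>) * (C * r k powr p) = C * r k powr (- \<beta>)" by (simp add: ac_simps)
      then show ?thesis using C by (simp flip: ennreal_mult)
    qed
    then show ?thesis by (simp flip: mult.assoc)
  qed
  also have "\<dots> = ennreal (2 powr (p + 1)) * (ennreal C * (\<integral>\<^sup>+x. (\<Sum>k. ennreal (r k powr (- \<beta>)) *
      (ennreal (G x) * indicator {x. ?d x \<le> 6 * r k} x)) \<partial>lborel))"
    by (subst nn_integral_suminf) (auto simp: nn_integral_cmult)
  also have "\<dots> \<le> ennreal (2 powr (p + 1)) * (ennreal C *
      (\<integral>\<^sup>+x. ennreal (12 / \<beta>) * ennreal (G x * ?d x powr (- \<beta>)) \<partial>lborel))"
  proof (intro mult_left_mono nn_integral_mono)
    fix x :: 'a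
    show "(\<Sum>k. ennreal (r k powr (- \<beta>)) * (ennreal (G x) * indicator {x. ?d x \<le> 6 * r k} x))
      \<le> ennreal (12 / \<beta>) * ennreal (G x * ?d x powr (- \<beta>))"
    proof (cases "?d x = 0")
      case False
      then have d: "0 < ?d x" using infdist_nonneg[of x D] by simp
      have "(\<Sum>k. ennreal (r k powr (- \<beta>)) * (ennreal (G x) * indicator {x. ?d x \<le> 6 * r k} x))
          = (\<Sum>k. ennreal (G x) * ennreal (if ?d x \<le> 6 * (R / 2 ^ k) then (R / 2 ^ k) powr (- \<beta>) else 0))"
        by (intro suminf_cong) (auto simp: r_def mult.commute)
      also have "\<dots> = ennreal (G x) * (\<Sum>k. ennreal (if ?d x \<le> 6 * (R / 2 ^ k) then (R / 2 ^ k) powr (- \<beta>) else 0))"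
        by simp
      also have "\<dots> \<le> ennreal (G x) * ennreal (12 / \<beta> * ?d x powr (- \<beta>))"
        by (intro mult_left_mono dyadic_sum_le \<beta> d R) auto
      also have "\<dots> = ennreal (12 / \<beta>) * ennreal (G x * ?d x powr (- \<beta>))"
        using G(1) \<beta> by (simp flip: ennreal_mult add: ac_simps)
      finally show ?thesis .
    qed (simp add: G(2))
  qed auto
  also have "\<dots> = ennreal (12 * 2 powr (p + 1) * C / \<beta>) * (\<integral>\<^sup>+x. ennreal (G x * ?d x powr (- \<beta>)) \<partial>lborel)"
  proof -
    have "ennreal (12 * 2 powr (p + 1) * C / \<beta>) = ennreal (2 powr (p + 1)) * (ennreal C * ennreal (12 / \<beta>))"
      using C \<beta> by (simp flip: ennreal_mult add: ac_simps)
    then show ?thesis by (simp add: nn_integral_cmult mult.assoc)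
  qed
  finally show ?thesis .
qed

section \<open>Hardy's inequality on the whole space\<close>

lemma local_slope_has_derivative:
  fixes f :: "'a::real_normed_vector \<Rightarrow> real"
  assumes f: "(f has_derivative f') (at x)" and le: "\<And>h. \<bar>f' h\<bar> \<le> c * norm h" and e: "0 < e"
  shows "\<forall>\<^sub>F y in nhds x. \<bar>f y - f x\<bar> \<le> (c + e) * norm (y - x)"
proof -
  obtain d where d: "0 < d" "\<And>y. norm (y - x) < d \<Longrightarrow> norm (f y - f x - f' (y - x)) \<le> e * norm (y - x)"
    using f e unfolding has_derivative_at_alt by blast
  have "\<bar>f y - f x\<bar> \<le> (c + e) * norm (y - x)" if "dist y x < d" for y
  proof -
    have "\<bar>f y - f x - f' (y - x)\<bar> \<le> e * norm (y - x)" using d(2)[of y] that by (simp add: dist_norm)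
    with le[of "y - x"] show ?thesis by (simp add: algebra_simps)
  qed
  then show ?thesis using d(1) by (auto simp: eventually_nhds_metric)
qed

lemma local_slope_mult:
  assumes f: "local_slope f a" and g: "local_slope g b"
    and cont: "continuous_on UNIV g" and a: "\<And>x. 0 \<le> a x"
  shows "local_slope (\<lambda>x. f x * g x) (\<lambda>x. a x * \<bar>g x\<bar> + \<bar>f x\<bar> * b x)"
  unfolding local_slope_def
proof (intro allI impI)
  fix x and e :: real assume e: "0 < e"
  define N where "N = a x + \<bar>g x\<bar> + \<bar>f x\<bar> + 1"
  have N: "1 \<le> N" using a[of x] by (simp add: N_def)
  define e1 where "e1 = min 1 (e / N)"
  have e1: "0 < e1" "e1 \<le> 1" "e1 * N \<le> e" using e N by (auto simp: e1_def field_simps min_def)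
  have "\<forall>\<^sub>F y in nhds x. dist (g y) (g x) < e1"
    using cont e1(1) by (intro tendstoD) (auto simp: continuous_on_eq_continuous_at isCont_def tendsto_nhds_iff)
  moreover have "\<forall>\<^sub>F y in nhds x. \<bar>f y - f x\<bar> \<le> (a x + e1) * norm (y - x)"
    "\<forall>\<^sub>F y in nhds x. \<bar>g y - g x\<bar> \<le> (b x + e1) * norm (y - x)"
    using f g e1(1) by (auto simp: local_slope_def)
  ultimately show "\<forall>\<^sub>F y in nhds x. \<bar>f y * g y - f x * g x\<bar> \<le> (a x * \<bar>g x\<bar> + \<bar>f x\<bar> * b x + e) * norm (y - x)"
  proof eventually_elim
    case (elim y)
    have "\<bar>f y * g y - f x * g x\<bar> = \<bar>(f y - f x) * g y + f x * (g y - g x)\<bar>" by (simp add: algebra_simps)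
    also have "\<dots> \<le> \<bar>f y - f x\<bar> * \<bar>g y\<bar> + \<bar>f x\<bar> * \<bar>g y - g x\<bar>"
      by (rule order_trans[OF abs_triangle_ineq]) (simp add: abs_mult)
    also have "\<dots> \<le> ((a x + e1) * norm (y - x)) * (\<bar>g x\<bar> + e1) + \<bar>f x\<bar> * ((b x + e1) * norm (y - x))"
      using elim a[of x] e1 by (intro add_mono mult_mono mult_left_mono) (auto simp: dist_real_def)
    also have "\<dots> = (a x * \<bar>g x\<bar> + \<bar>f x\<bar> * b x + e1 * (a x + \<bar>g x\<bar> + \<bar>f x\<bar> + e1)) * norm (y - x)"
      by (simp add: algebra_simps)
    also have "\<dots> \<le> (a x * \<bar>g x\<bar> + \<bar>f x\<bar> * b x + e) * norm (y - x)"
    proof (intro mult_right_mono add_left_mono)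
      have "e1 * (a x + \<bar>g x\<bar> + \<bar>f x\<bar> + e1) \<le> e1 * N"
        using e1 by (intro mult_left_mono) (auto simp: N_def)
      then show "e1 * (a x + \<bar>g x\<bar> + \<bar>f x\<bar> + e1) \<le> e" using e1 by linarith
    qed simp
    finally show ?case .
  qed
qed

text \<open>The distance function is 1-Lipschitz, so only the derivative of \<open>t\<^sup>s\<close> enters; the truncation at \<open>\<delta>\<close>
  keeps away from its singularity at \<open>0\<close>.\<close>

lemma local_slope_truncated_infdist_powr:
  fixes D :: "'a::euclidean_space set"
  assumes \<delta>: "0 < \<delta>" and s: "0 \<le> s"
  defines "m \<equiv> \<lambda>x. max (infdist x D) \<delta>"
  shows "local_slope (\<lambda>x. m x powr s) (\<lambda>x. s * m x powr (s - 1))"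
  unfolding local_slope_def
proof (intro allI impI)
  fix x :: 'a and e :: real assume e: "0 < e"
  have m: "0 < m x" for x using \<delta> by (auto simp: m_def)
  have lip: "\<bar>m y - m x\<bar> \<le> norm (y - x)" for y
    using infdist_triangle_abs[of y D x] by (auto simp: m_def dist_norm max_def)
  have cm: "continuous_on UNIV m" unfolding m_def by (intro continuous_intros)
  have "((\<lambda>t. t powr s) has_derivative (\<lambda>h. (s * m x powr (s - 1)) * h)) (at (m x))"
    using m[of x] by (auto intro!: derivative_eq_intros simp: powr_diff field_simps)
  then have "\<forall>\<^sub>F t in nhds (m x). \<bar>t powr s - m x powr s\<bar> \<le> (s * m x powr (s - 1) + e) * norm (t - m x)"
    by (rule local_slope_has_derivative[OF _ _ e]) (use s in \<open>auto simp: abs_mult\<close>)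
  moreover have "filterlim m (nhds (m x)) (nhds x)"
    using cm by (auto simp: continuous_on_eq_continuous_at isCont_def tendsto_nhds_iff)
  ultimately have "\<forall>\<^sub>F y in nhds x. \<bar>m y powr s - m x powr s\<bar> \<le> (s * m x powr (s - 1) + e) * norm (m y - m x)"
    by (rule eventually_compose_filterlim)
  then show "\<forall>\<^sub>F y in nhds x. \<bar>m y powr s - m x powr s\<bar> \<le> (s * m x powr (s - 1) + e) * norm (y - x)"
  proof eventually_elim
    case (elim y)
    have "(s * m x powr (s - 1) + e) * norm (m y - m x) \<le> (s * m x powr (s - 1) + e) * norm (y - x)"
      using lip[of y] s e by (intro mult_left_mono) auto
    with elim show ?case by linarith
  qed
qed

lemma powr_add_le:
  fixes a b p :: real
  assumes "0 \<le> a" "0 \<le> b" "0 < p"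
  shows "(a + b) powr p \<le> 2 powr p * (a powr p + b powr p)"
proof -
  have "(a + b) powr p \<le> (2 * max a b) powr p" using assms by (intro powr_mono2) auto
  also have "\<dots> = 2 powr p * max a b powr p" by (rule powr_mult)
  also have "\<dots> \<le> 2 powr p * (a powr p + b powr p)"
    by (intro mult_left_mono) (auto simp: max_def)
  finally show ?thesis .
qed

text \<open>The absorption argument. As \<open>v\<close> vanishes for \<open>d < \<delta>\<close>, replacing \<open>d\<close> by \<open>m = max d \<delta>\<close> does not change
  \<open>w = v d\<^sup>s\<close> but makes its local slope continuous. With \<open>s = \<beta>/p\<close> the left side of the weighted estimate
  for \<open>w\<close> is the integral of \<open>\<bar>v/d\<bar>\<^sup>p\<close>, and the right side contains that integral with the factor
  \<open>A s\<^sup>p\<close>, of order \<open>\<beta>\<^sup>p\<^sup>-\<^sup>1\<close>; \<open>\<beta>\<close> is chosen to make it at most \<open>1/2\<close>. The integral is finite because \<open>v\<close>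
  vanishes near \<open>D\<close>, so it may be subtracted.\<close>

lemma layer_estimates_imp_hardy:
  fixes D :: "'a::euclidean_space set"
  assumes p: "1 < p" and R: "0 < R" and C: "0 < C"
    and layer: "\<And>(w :: 'a \<Rightarrow> real) G r. p_upper_gradient p w G \<Longrightarrow> \<forall>y\<in>D. \<exists>e>0. \<forall>x\<in>ball y e. w x = 0 \<Longrightarrow>
      0 < r \<Longrightarrow> r \<le> R \<Longrightarrow>
      (\<integral>\<^sup>+x\<in>{x. infdist x D \<le> r}. ennreal (\<bar>w x\<bar> powr p) \<partial>lborel) \<le>
        ennreal (C * r powr p) * (\<integral>\<^sup>+x\<in>{x. infdist x D \<le> 6 * r}. ennreal (G x) \<partial>lborel)"
  obtains K where "0 < K"
    "\<And>(v :: 'a \<Rightarrow> real) g \<delta>. continuous_on UNIV v \<Longrightarrow> continuous_on UNIV g \<Longrightarrow> (\<And>x. 0 \<le> g x) \<Longrightarrow>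
      local_slope v g \<Longrightarrow> 0 < \<delta> \<Longrightarrow> (\<And>x. infdist x D < \<delta> \<Longrightarrow> v x = 0 \<and> g x = 0) \<Longrightarrow>
      (\<integral>\<^sup>+x. ennreal (\<bar>v x\<bar> powr p) \<partial>lborel) < \<infinity> \<Longrightarrow> (\<integral>\<^sup>+x. ennreal (g x powr p) \<partial>lborel) < \<infinity> \<Longrightarrow>
      (\<integral>\<^sup>+x. ennreal (\<bar>v x / infdist x D\<bar> powr p) \<partial>lborel) \<le>
        ennreal K * ((\<integral>\<^sup>+x. ennreal (g x powr p) \<partial>lborel) + (\<integral>\<^sup>+x. ennreal (\<bar>v x\<bar> powr p) \<partial>lborel))"
proof -
  let ?d = "\<lambda>x. infdist x D"
  have p0: "0 < p" using p by simp
  have [measurable]: "?d \<in> borel_measurable borel"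
    by (intro borel_measurable_continuous_onI continuous_intros)
  define C1 where "C1 = 12 * 2 powr (p + 1) * C"
  have C1: "0 < C1" using C by (simp add: C1_def)
  \<comment> \<open>The solution of \<open>(C1 / \<beta>) 2\<^sup>p (\<beta> / p)\<^sup>p = 1/2\<close> is \<open>\<beta>\<^sup>p\<^sup>-\<^sup>1 = b0\<close>.\<close>
  define b0 where "b0 = p powr p / (C1 * 2 powr (p + 1))"
  have b0: "0 < b0" using C1 p by (simp add: b0_def)
  define \<beta> where "\<beta> = min 1 (b0 powr (1 / (p - 1)))"
  have \<beta>: "0 < \<beta>" "\<beta> \<le> 1" using b0 by (auto simp: \<beta>_def)
  define s where "s = \<beta> / p"
  have s: "0 < s" using \<beta> p by (simp add: s_def)
  define A where "A = C1 / \<beta> * 2 powr p"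
  have A: "0 < A" using C1 \<beta> by (simp add: A_def)
  have half: "A * s powr p \<le> 1 / 2"
  proof -
    have "\<beta> powr (p - 1) \<le> (b0 powr (1 / (p - 1))) powr (p - 1)"
      using p \<beta> by (intro powr_mono2) (auto simp: \<beta>_def)
    also have "\<dots> = b0" using p b0 by (simp add: powr_powr)
    finally have "C1 * 2 powr p / p powr p * \<beta> powr (p - 1) \<le> C1 * 2 powr p / p powr p * b0"
      using C1 by (intro mult_left_mono) auto
    also have "\<dots> = 1 / 2" using C1 p by (simp add: b0_def powr_add)
    also have "C1 * 2 powr p / p powr p * \<beta> powr (p - 1) = A * s powr p"
      using \<beta> p by (simp add: A_def s_def powr_divide powr_diff)
    finally show ?thesis .
  qed
  define K where "K = 2 * A + 2 * R powr (- p)"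
  have K: "0 < K" using A R by (simp add: K_def add_pos_pos)
  have main: "(\<integral>\<^sup>+x. ennreal (\<bar>v x / ?d x\<bar> powr p) \<partial>lborel) \<le>
        ennreal K * ((\<integral>\<^sup>+x. ennreal (g x powr p) \<partial>lborel) + (\<integral>\<^sup>+x. ennreal (\<bar>v x\<bar> powr p) \<partial>lborel))"
    if v: "continuous_on UNIV v" and g: "continuous_on UNIV g" and g0: "\<And>x. 0 \<le> g x"
      and slope: "local_slope v g" and \<delta>: "0 < \<delta>" and van: "\<And>x. ?d x < \<delta> \<Longrightarrow> v x = 0 \<and> g x = 0"
      and fin: "(\<integral>\<^sup>+x. ennreal (\<bar>v x\<bar> powr p) \<partial>lborel) < \<infinity>" "(\<integral>\<^sup>+x. ennreal (g x powr p) \<partial>lborel) < \<infinity>"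
    for v g :: "'a \<Rightarrow> real" and \<delta>
  proof -
    have [measurable]: "v \<in> borel_measurable borel" "g \<in> borel_measurable borel"
      using v g by (auto intro: borel_measurable_continuous_onI)
    define m where "m x = max (?d x) \<delta>" for x
    have m: "0 < m x" for x using \<delta> by (auto simp: m_def)
    have mc: "continuous_on UNIV m" unfolding m_def by (intro continuous_intros)
    have mpc: "continuous_on UNIV (\<lambda>x. m x powr a)" for a
      using m by (intro continuous_on_powr mc continuous_intros) (auto simp: less_imp_neq[symmetric])
    define w where "w x = v x * m x powr s" for x
    define h where "h x = g x * \<bar>m x powr s\<bar> + \<bar>v x\<bar> * (s * m x powr (s - 1))" for x
    have h0: "0 \<le> h x" for x using g0 s by (simp add: h_def)
    have "local_slope (\<lambda>x. m x powr s) (\<lambda>x. s * m x powr (s - 1))"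
      unfolding m_def using s by (intro local_slope_truncated_infdist_powr \<delta>) auto
    then have "local_slope w h" unfolding w_def h_def by (rule local_slope_mult[OF slope _ mpc g0])
    moreover have wc: "continuous_on UNIV w" and hc: "continuous_on UNIV h"
      unfolding w_def h_def by (intro continuous_intros v g mpc)+
    ultimately have ug: "p_upper_gradient p w (\<lambda>x. h x powr p)"
      using p h0 by (intro p_upper_gradient_of_local_slope) auto
    have [measurable]: "w \<in> borel_measurable borel" "h \<in> borel_measurable borel"
      using wc hc by (auto intro: borel_measurable_continuous_onI)
    have near: "\<forall>y\<in>D. \<exists>e>0. \<forall>x\<in>ball y e. w x = 0"
    proof
      fix y assume y: "y \<in> D"
      have "w x = 0" if "x \<in> ball y \<delta>" for x
        using infdist_le[OF y, of x] that van[of x] by (simp add: w_def dist_commute)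
      then show "\<exists>e>0. \<forall>x\<in>ball y e. w x = 0" using \<delta> by blast
    qed
    define H where "H x = \<bar>v x / ?d x\<bar> powr p" for x
    have H0: "0 \<le> H x" for x by (simp add: H_def)
    have [measurable]: "H \<in> borel_measurable borel" unfolding H_def by measurable
    have wH: "\<bar>w x\<bar> powr p * ?d x powr (- p - \<beta>) = H x" for x
    proof (cases "?d x < \<delta>")
      case False
      then have d: "0 < ?d x" "m x = ?d x" using \<delta> by (auto simp: m_def)
      have "\<bar>w x\<bar> powr p * ?d x powr (- p - \<beta>) = \<bar>v x\<bar> powr p * (?d x powr (s * p) * ?d x powr (- p - \<beta>))"
        by (simp add: w_def d abs_mult powr_mult powr_powr)
      also have "?d x powr (s * p) * ?d x powr (- p - \<beta>) = ?d x powr (- p)"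
        using p by (simp add: s_def flip: powr_add)
      also have "\<bar>v x\<bar> powr p * ?d x powr (- p) = H x"
      proof -
        have "H x = (\<bar>v x\<bar> / ?d x) powr p" using d by (simp add: H_def)
        then show ?thesis by (simp add: powr_divide powr_minus_divide)
      qed
      finally show ?thesis .
    qed (use van in \<open>simp add: w_def H_def\<close>)
    have hH: "h x powr p * ?d x powr (- \<beta>) \<le> 2 powr p * (g x powr p + s powr p * H x)" for x
    proof (cases "?d x < \<delta>")
      case False
      then have d: "0 < ?d x" "m x = ?d x" using \<delta> by (auto simp: m_def)
      have "h x = ?d x powr s * (g x + s * \<bar>v x / ?d x\<bar>)"
        using d by (simp add: h_def powr_diff field_simps)
      then have "h x powr p * ?d x powr (- \<beta>) =
          (?d x powr (s * p) * ?d x powr (- \<beta>)) * (g x + s * \<bar>v x / ?d x\<bar>) powr p"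
        by (simp add: powr_mult powr_powr)
      also have "?d x powr (s * p) * ?d x powr (- \<beta>) = 1"
        using p d by (simp add: s_def flip: powr_add)
      also have "1 * (g x + s * \<bar>v x / ?d x\<bar>) powr p \<le> 2 powr p * (g x powr p + (s * \<bar>v x / ?d x\<bar>) powr p)"
        using powr_add_le[of "g x" "s * \<bar>v x / ?d x\<bar>" p] g0 s p by simp
      also have "(s * \<bar>v x / ?d x\<bar>) powr p = s powr p * H x" unfolding H_def by (rule powr_mult)
      finally show ?thesis .
    qed (use van H0 in \<open>simp add: h_def\<close>)
    obtain V where V: "(\<integral>\<^sup>+x. ennreal (\<bar>v x\<bar> powr p) \<partial>lborel) = ennreal V" "0 \<le> V"
      using fin(1) by (cases "\<integral>\<^sup>+x. ennreal (\<bar>v x\<bar> powr p) \<partial>lborel" rule: ennreal_cases) auto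
    obtain N where N: "(\<integral>\<^sup>+x. ennreal (g x powr p) \<partial>lborel) = ennreal N" "0 \<le> N"
      using fin(2) by (cases "\<integral>\<^sup>+x. ennreal (g x powr p) \<partial>lborel" rule: ennreal_cases) auto
    have HV: "H x \<le> a powr (- p) * \<bar>v x\<bar> powr p" if "0 < a" "a \<le> ?d x" for a x
    proof -
      have "\<bar>v x / ?d x\<bar> \<le> \<bar>v x\<bar> / a" using that by (simp add: frac_le)
      then have "H x \<le> (\<bar>v x\<bar> / a) powr p" unfolding H_def using p by (intro powr_mono2) auto
      then show ?thesis using that by (simp add: powr_divide powr_minus field_simps)
    qed
    have "(\<integral>\<^sup>+x. ennreal (H x) \<partial>lborel) \<le> (\<integral>\<^sup>+x. ennreal (\<delta> powr (- p)) * ennreal (\<bar>v x\<bar> powr p) \<partial>lborel)"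
    proof (rule nn_integral_mono)
      fix x
      have "H x \<le> \<delta> powr (- p) * \<bar>v x\<bar> powr p"
        using HV[OF \<delta>, of x] van[of x] by (cases "?d x < \<delta>") (auto simp: H_def)
      then show "ennreal (H x) \<le> ennreal (\<delta> powr (- p)) * ennreal (\<bar>v x\<bar> powr p)"
        by (simp flip: ennreal_mult add: ennreal_leI)
    qed
    also have "\<dots> = ennreal (\<delta> powr (- p)) * ennreal V" by (simp add: nn_integral_cmult V)
    also have "\<dots> < \<infinity>" by (simp add: ennreal_mult_less_top)
    finally obtain T where T: "(\<integral>\<^sup>+x. ennreal (H x) \<partial>lborel) = ennreal T" "0 \<le> T"
      by (cases "\<integral>\<^sup>+x. ennreal (H x) \<partial>lborel" rule: ennreal_cases) auto
    have "(\<integral>\<^sup>+x. ennreal (H x) \<partial>lborel) \<le>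
        (\<integral>\<^sup>+x\<in>{x. ?d x \<le> R}. ennreal (H x) \<partial>lborel) + (\<integral>\<^sup>+x. ennreal (R powr (- p)) * ennreal (\<bar>v x\<bar> powr p) \<partial>lborel)"
    proof (subst nn_integral_add[symmetric], measurable, rule nn_integral_mono)
      fix x
      show "ennreal (H x) \<le> ennreal (H x) * indicator {x. ?d x \<le> R} x + ennreal (R powr (- p)) * ennreal (\<bar>v x\<bar> powr p)"
        using HV[OF R, of x] by (cases "?d x \<le> R") (auto simp flip: ennreal_mult intro!: ennreal_leI)
    qed
    also have "(\<integral>\<^sup>+x. ennreal (R powr (- p)) * ennreal (\<bar>v x\<bar> powr p) \<partial>lborel) = ennreal (R powr (- p) * V)"
      using V by (simp add: nn_integral_cmult ennreal_mult)
    also have "(\<integral>\<^sup>+x\<in>{x. ?d x \<le> R}. ennreal (H x) \<partial>lborel) \<le>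
        ennreal (C1 / \<beta>) * (\<integral>\<^sup>+x. ennreal (h x powr p * ?d x powr (- \<beta>)) \<partial>lborel)"
      unfolding wH[symmetric] C1_def
    proof (rule layer_estimate_imp_weighted_estimate[where w = w and G = "\<lambda>x. h x powr p" and C = C])
      show "(\<integral>\<^sup>+x\<in>{x. ?d x \<le> r}. ennreal (\<bar>w x\<bar> powr p) \<partial>lborel) \<le>
          ennreal (C * r powr p) * (\<integral>\<^sup>+x\<in>{x. ?d x \<le> 6 * r}. ennreal (h x powr p) \<partial>lborel)"
        if "0 < r" "r \<le> R" for r
        by (rule layer[OF ug near that])
      show "h x powr p = 0" if "?d x = 0" for x
        using van[of x] that \<delta> by (simp add: h_def)
      show "0 \<le> C" using C by simp
    qed (auto simp: p0 \<beta> R)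
    also have "\<dots> \<le> ennreal (C1 / \<beta>) * (\<integral>\<^sup>+x. ennreal (2 powr p) *
        (ennreal (g x powr p) + ennreal (s powr p) * ennreal (H x)) \<partial>lborel)"
    proof (intro mult_left_mono nn_integral_mono)
      fix x
      have "ennreal (h x powr p * ?d x powr (- \<beta>)) \<le> ennreal (2 powr p * (g x powr p + s powr p * H x))"
        by (rule ennreal_leI[OF hH])
      then show "ennreal (h x powr p * ?d x powr (- \<beta>)) \<le>
          ennreal (2 powr p) * (ennreal (g x powr p) + ennreal (s powr p) * ennreal (H x))"
        using H0 by (simp add: ennreal_mult ennreal_plus)
    qed simp
    also have "\<dots> = ennreal (C1 / \<beta>) * (ennreal (2 powr p) * (ennreal N + ennreal (s powr p) * ennreal T))"
      by (simp add: nn_integral_cmult nn_integral_add N T)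
    also have "\<dots> = ennreal (C1 / \<beta> * (2 powr p * (N + s powr p * T)))"
    proof -
      have "ennreal (C1 / \<beta> * (2 powr p * (N + s powr p * T))) =
          ennreal (C1 / \<beta>) * ennreal (2 powr p * (N + s powr p * T))"
        using C1 \<beta> N T by (intro ennreal_mult) auto
      also have "ennreal (2 powr p * (N + s powr p * T)) = ennreal (2 powr p) * ennreal (N + s powr p * T)"
        using N T by (intro ennreal_mult) auto
      also have "ennreal (N + s powr p * T) = ennreal N + ennreal (s powr p * T)"
        using N T by (intro ennreal_plus) auto
      also have "ennreal (s powr p * T) = ennreal (s powr p) * ennreal T"
        using T by (intro ennreal_mult) auto
      finally show ?thesis by (rule sym)
    qed
    finally have "ennreal T \<le> ennreal (C1 / \<beta> * (2 powr p * (N + s powr p * T))) + ennreal (R powr (- p) * V)"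
      unfolding T(1) by (simp add: add_right_mono)
    also have "\<dots> = ennreal (C1 / \<beta> * (2 powr p * (N + s powr p * T)) + R powr (- p) * V)"
      using C1 \<beta> N T V by (intro ennreal_plus[symmetric]) auto
    finally have "T \<le> C1 / \<beta> * (2 powr p * (N + s powr p * T)) + R powr (- p) * V"
      using C1 \<beta> N T V by (subst (asm) ennreal_le_iff) auto
    also have "C1 / \<beta> * (2 powr p * (N + s powr p * T)) = A * N + (A * s powr p) * T"
      by (simp add: A_def algebra_simps)
    also have "(A * s powr p) * T \<le> (1 / 2) * T" by (rule mult_right_mono[OF half T(2)])
    finally have "T \<le> 2 * A * N + 2 * R powr (- p) * V" by simp
    also have "\<dots> \<le> K * (N + V)"
      using A R N V by (simp add: K_def algebra_simps)
    finally have "ennreal T \<le> ennreal (K * (N + V))" by (rule ennreal_leI)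
    also have "\<dots> = ennreal K * (ennreal N + ennreal V)"
      using K N V by (simp add: ennreal_mult ennreal_plus)
    finally show ?thesis using T N V by (simp add: H_def)
  qed
  from K main show thesis by (rule that)
qed

lemma smooth_differentiable:
  assumes "smooth v"
  shows "v differentiable at x" "(v has_derivative frechet_derivative v (at x)) (at x)"
    "continuous_on UNIV v" "continuous_on UNIV (\<lambda>x. frechet_derivative v (at x) h)"
proof -
  have 1: "C_diff (Suc 0) v" using assms unfolding smooth_def by blast
  then show d: "v differentiable at x" for x by simp
  then show "(v has_derivative frechet_derivative v (at x)) (at x)"
    by (simp add: frechet_derivative_works[symmetric])
  show "continuous_on UNIV v"
    using d by (auto simp: continuous_on_eq_continuous_at intro: differentiable_imp_continuous_within)
  show "continuous_on UNIV (\<lambda>x. frechet_derivative v (at x) h)" using 1 by simp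
qed

lemma continuous_grad:
  assumes "smooth v"
  shows "continuous_on UNIV (grad v)"
  unfolding grad_def by (intro continuous_intros smooth_differentiable(4)[OF assms])

lemma frechet_derivative_eq_grad_inner:
  fixes v :: "'a::euclidean_space \<Rightarrow> real"
  assumes "v differentiable at x"
  shows "frechet_derivative v (at x) h = grad v x \<bullet> h"
proof -
  interpret f: linear "frechet_derivative v (at x)"
    using assms by (rule linear_frechet_derivative)
  have "frechet_derivative v (at x) h = frechet_derivative v (at x) (\<Sum>b\<in>Basis. (h \<bullet> b) *\<^sub>R b)"
    by (simp add: euclidean_representation)
  also have "\<dots> = (\<Sum>b\<in>Basis. (h \<bullet> b) * frechet_derivative v (at x) b)"
    by (simp add: f.sum f.scaleR)
  also have "\<dots> = grad v x \<bullet> h"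
    by (simp add: grad_def inner_sum_left inner_commute[of h] mult.commute)
  finally show ?thesis .
qed

lemma local_slope_grad:
  fixes v :: "'a::euclidean_space \<Rightarrow> real"
  assumes "\<And>x. v differentiable at x"
  shows "local_slope v (\<lambda>x. norm (grad v x))"
  unfolding local_slope_def
proof (intro allI impI)
  fix x and e :: real assume e: "0 < e"
  show "\<forall>\<^sub>F y in nhds x. \<bar>v y - v x\<bar> \<le> (norm (grad v x) + e) * norm (y - x)"
  proof (rule local_slope_has_derivative[OF _ _ e])
    show "(v has_derivative frechet_derivative v (at x)) (at x)"
      using assms by (simp add: frechet_derivative_works[symmetric])
    show "\<bar>frechet_derivative v (at x) h\<bar> \<le> norm (grad v x) * norm h" for h
      unfolding frechet_derivative_eq_grad_inner[OF assms] by (rule Cauchy_Schwarz_ineq2)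
  qed
qed

lemma zero_outside_supp:
  assumes "x \<notin> supp v"
  shows "v x = 0" "grad v x = 0"
proof -
  show "v x = 0" using assms closure_subset[of "{x. v x \<noteq> 0}"] by (auto simp: supp_def)
  have "open (- supp v)" unfolding supp_def by (rule open_Compl[OF closed_closure])
  then have "(v has_derivative (\<lambda>_. 0)) (at x)"
  proof (rule has_derivative_transform_within_open[OF has_derivative_const[of 0]])
    show "0 = v y" if "y \<in> - supp v" for y
      using that closure_subset[of "{x. v x \<noteq> 0}"] by (auto simp: supp_def)
  qed (use assms in auto)
  then have "frechet_derivative v (at x) = (\<lambda>_. 0)" by (rule frechet_derivative_at[symmetric])
  then show "grad v x = 0" by (simp add: grad_def)
qed

lemma nn_integral_compact_support_finite:
  fixes f :: "'a::euclidean_space \<Rightarrow> real"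
  assumes f: "continuous_on UNIV f" and S: "bounded S" and van: "\<And>x. x \<notin> S \<Longrightarrow> f x = 0"
  shows "(\<integral>\<^sup>+x. ennreal (f x) \<partial>lborel) < \<infinity>"
proof -
  obtain B where B: "S \<subseteq> ball 0 B" using bounded_subset_ballD[OF S] by blast
  have "(\<integral>\<^sup>+x. ennreal (f x) \<partial>lborel) = (\<integral>\<^sup>+x\<in>ball 0 B. ennreal (f x) \<partial>lborel)"
  proof (rule nn_integral_cong)
    fix x
    have "f x = 0" if "x \<notin> ball 0 B" using that van[of x] B by blast
    then show "ennreal (f x) = ennreal (f x) * indicator (ball 0 B) x" by (auto simp: indicator_def)
  qed
  also have "\<dots> < \<infinity>" by (rule nn_integral_ball_finite[OF f])
  finally show ?thesis .
qed

lemma thick_imp_hardy_smooth: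
  fixes D :: "'a::euclidean_space set"
  assumes p: "1 < p" and dim: "real DIM('a) - p < l" and thick: "thick l D"
  obtains K where "0 < K"
    "\<And>v. v \<in> smooth_vanishing D \<Longrightarrow>
      (\<integral>\<^sup>+x. ennreal (\<bar>v x / infdist x D\<bar> powr p) \<partial>lborel) \<le>
        ennreal K * ((\<integral>\<^sup>+x. ennreal (norm (grad v x) powr p) \<partial>lborel) + (\<integral>\<^sup>+x. ennreal (\<bar>v x\<bar> powr p) \<partial>lborel))"
proof -
  obtain R \<gamma> where l: "0 < l" and D: "compact D" "D \<noteq> {}" and R: "0 < R" and \<gamma>: "0 < \<gamma>"
    and th: "\<And>x r. x \<in> D \<Longrightarrow> 0 < r \<Longrightarrow> r \<le> R \<Longrightarrow>
      ennreal (\<gamma> * r powr l) \<le> centered_hausdorff_content l (D \<inter> ball x r)"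
    using thick unfolding thick_def by blast
  show thesis
  proof (rule thick_imp_layer_estimate[OF compact_imp_closed[OF D(1)] D(2) _ l _ \<gamma> th])
    show "0 < p" "real DIM('a) < p + l" using p dim by auto
  next
    fix C :: real
    assume C: "0 < C" and layer: "\<And>(w :: 'a \<Rightarrow> real) G r. p_upper_gradient p w G \<Longrightarrow>
        \<forall>y\<in>D. \<exists>e>0. \<forall>x\<in>ball y e. w x = 0 \<Longrightarrow> 0 < r \<Longrightarrow> r \<le> R \<Longrightarrow>
        (\<integral>\<^sup>+x\<in>{x. infdist x D \<le> r}. ennreal (\<bar>w x\<bar> powr p) \<partial>lborel) \<le>
          ennreal (C * r powr p) * (\<integral>\<^sup>+x\<in>{x. infdist x D \<le> 6 * r}. ennreal (G x) \<partial>lborel)"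
    show thesis
    proof (rule layer_estimates_imp_hardy[OF p R C layer])
      fix K :: real
      assume K: "0 < K" and hardy: "\<And>(v :: 'a \<Rightarrow> real) g \<delta>. continuous_on UNIV v \<Longrightarrow>
        continuous_on UNIV g \<Longrightarrow> (\<And>x. 0 \<le> g x) \<Longrightarrow>
        local_slope v g \<Longrightarrow> 0 < \<delta> \<Longrightarrow> (\<And>x. infdist x D < \<delta> \<Longrightarrow> v x = 0 \<and> g x = 0) \<Longrightarrow>
        (\<integral>\<^sup>+x. ennreal (\<bar>v x\<bar> powr p) \<partial>lborel) < \<infinity> \<Longrightarrow> (\<integral>\<^sup>+x. ennreal (g x powr p) \<partial>lborel) < \<infinity> \<Longrightarrow>
        (\<integral>\<^sup>+x. ennreal (\<bar>v x / infdist x D\<bar> powr p) \<partial>lborel) \<le>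
          ennreal K * ((\<integral>\<^sup>+x. ennreal (g x powr p) \<partial>lborel) + (\<integral>\<^sup>+x. ennreal (\<bar>v x\<bar> powr p) \<partial>lborel))"
      have "(\<integral>\<^sup>+x. ennreal (\<bar>v x / infdist x D\<bar> powr p) \<partial>lborel) \<le>
          ennreal K * ((\<integral>\<^sup>+x. ennreal (norm (grad v x) powr p) \<partial>lborel) + (\<integral>\<^sup>+x. ennreal (\<bar>v x\<bar> powr p) \<partial>lborel))"
        if "v \<in> smooth_vanishing D" for v
      proof -
        have v: "smooth v" "compact (supp v)" "supp v \<inter> D = {}" using that by (auto simp: smooth_vanishing_def)
        have "\<exists>d>0. \<forall>x\<in>supp v. \<forall>y\<in>D. d \<le> dist x y"
          by (rule separate_compact_closed[OF v(2) compact_imp_closed[OF D(1)] v(3)])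
        then obtain \<delta> where \<delta>: "0 < \<delta>" "\<forall>x\<in>supp v. \<forall>y\<in>D. \<delta> \<le> dist x y" by (elim exE conjE)
        have out: "x \<notin> supp v" if "infdist x D < \<delta>" for x
        proof -
          obtain y where "y \<in> D" "infdist x D = dist x y"
            by (rule infdist_attains_inf[OF compact_imp_closed[OF D(1)] D(2)])
          then show ?thesis using \<delta>(2) that by force
        qed
        have cont: "continuous_on UNIV v" "continuous_on UNIV (\<lambda>x. norm (grad v x))"
          by (intro continuous_intros smooth_differentiable(3) continuous_grad v(1))+
        show ?thesis
        proof (rule hardy[OF cont _ local_slope_grad \<delta>(1)])
          show "v differentiable at x" for x by (rule smooth_differentiable(1)[OF v(1)])
          show "v x = 0 \<and> norm (grad v x) = 0" if "infdist x D < \<delta>" for x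
            using zero_outside_supp[OF out[OF that]] by simp
          show "(\<integral>\<^sup>+x. ennreal (\<bar>v x\<bar> powr p) \<partial>lborel) < \<infinity>"
            using p by (intro nn_integral_compact_support_finite[OF _ compact_imp_bounded[OF v(2)]]
                continuous_on_powr' continuous_intros cont) (auto simp: zero_outside_supp)
          show "(\<integral>\<^sup>+x. ennreal (norm (grad v x) powr p) \<partial>lborel) < \<infinity>"
            using p by (intro nn_integral_compact_support_finite[OF _ compact_imp_bounded[OF v(2)]]
                continuous_on_powr' continuous_intros continuous_grad v(1)) (auto simp: zero_outside_supp)
        qed auto
      qed
      with K show thesis by (rule that)
    qed
  qed
qed

section \<open>Smooth cut-off functions\<close>

lemma C_diff_SucI:
  assumes "\<And>x. (f has_derivative f' x) (at x)" "\<And>h. C_diff n (\<lambda>x. f' x h)"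
  shows "C_diff (Suc n) f"
proof -
  have "frechet_derivative f (at x) = f' x" for x
    by (rule frechet_derivative_at[symmetric, OF assms(1)])
  then show ?thesis using assms by (auto intro: differentiableI)
qed

lemma C_diff_SucD:
  "C_diff (Suc n) f \<Longrightarrow> C_diff n f"
proof (induction n arbitrary: f)
  case 0
  then show ?case
    by (auto simp: continuous_on_eq_continuous_at intro: differentiable_imp_continuous_within)
next
  case (Suc n)
  then show ?case by simp
qed

lemma C_diff_has_derivative:
  assumes "C_diff (Suc n) f"
  shows "(f has_derivative frechet_derivative f (at x)) (at x)"
  using assms by (simp add: frechet_derivative_works[symmetric])

lemma C_diff_const: "C_diff n (\<lambda>_. c)"
proof (induction n arbitrary: c)
  case (Suc n)
  then show ?case by (intro C_diff_SucI[where f' = "\<lambda>_ _. 0"]) auto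
qed simp

lemma C_diff_add:
  "C_diff n f \<Longrightarrow> C_diff n g \<Longrightarrow> C_diff n (\<lambda>x. f x + g x)"
proof (induction n arbitrary: f g)
  case (Suc n)
  show ?case
    by (rule C_diff_SucI[OF has_derivative_add[OF C_diff_has_derivative[OF Suc.prems(1)] C_diff_has_derivative[OF Suc.prems(2)]]])
      (use Suc in auto)
qed (auto intro: continuous_on_add)

lemma C_diff_mult:
  "C_diff n f \<Longrightarrow> C_diff n g \<Longrightarrow> C_diff n (\<lambda>x. f x * g x)"
proof (induction n arbitrary: f g)
  case (Suc n)
  show ?case
    by (rule C_diff_SucI[OF has_derivative_mult[OF C_diff_has_derivative[OF Suc.prems(1)] C_diff_has_derivative[OF Suc.prems(2)]]])
      (use Suc.prems C_diff_SucD[OF Suc.prems(1)] C_diff_SucD[OF Suc.prems(2)] in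
        \<open>auto intro!: C_diff_add Suc.IH\<close>)
qed (auto intro: continuous_on_mult)

lemma C_diff_sum:
  "(\<And>i. i \<in> I \<Longrightarrow> C_diff n (f i)) \<Longrightarrow> C_diff n (\<lambda>x. \<Sum>i\<in>I. f i x)"
  by (induction I rule: infinite_finite_induct) (auto intro: C_diff_const C_diff_add)

lemma C_diff_bounded_linear:
  assumes "bounded_linear f"
  shows "C_diff n f"
proof (cases n)
  case 0
  then show ?thesis using assms by (simp add: linear_continuous_on)
next
  case (Suc m)
  then show ?thesis
    using C_diff_SucI[of f "\<lambda>_. f" m] bounded_linear_imp_has_derivative[OF assms] C_diff_const by blast
qed

lemma C_diff_affine: "C_diff n (\<lambda>x. a * ((x - c) \<bullet> h))"
proof -
  have "bounded_linear (\<lambda>x. a * (x \<bullet> h))"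
    by (intro bounded_linear_const_mult bounded_linear_inner_left)
  then have "C_diff n (\<lambda>x. a * (x \<bullet> h) + - (a * (c \<bullet> h)))"
    by (intro C_diff_add C_diff_bounded_linear C_diff_const)
  moreover have "(\<lambda>x. a * (x \<bullet> h) + - (a * (c \<bullet> h))) = (\<lambda>x. a * ((x - c) \<bullet> h))"
    by (auto simp: fun_eq_iff inner_diff_left algebra_simps)
  ultimately show ?thesis by simp
qed

text \<open>The family of functions \<open>t\<^sup>-\<^sup>k exp(-1/t)\<close>, extended by \<open>0\<close>, is closed under differentiation up to linear
  combinations, so an induction over the order of differentiation stays within it.\<close>

definition flat :: "nat \<Rightarrow> real \<Rightarrow> real"
  where "flat k t = (if 0 < t then exp (- 1 / t) / t ^ k else 0)"

lemma flat_tendsto_0: "(flat k \<longlongrightarrow> 0) (at 0)"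
proof -
  have "((\<lambda>x. x ^ k / exp x) \<longlongrightarrow> (0::real)) at_top" by (rule tendsto_power_div_exp_0)
  then have "((\<lambda>t. inverse t ^ k / exp (inverse t)) \<longlongrightarrow> (0::real)) (at_right 0)"
    by (rule filterlim_compose) (rule filterlim_inverse_at_top_right)
  moreover have "\<forall>\<^sub>F t in at_right (0::real). inverse t ^ k / exp (inverse t) = flat k t"
    using eventually_at_right_less[of "0::real"]
    by eventually_elim (simp add: flat_def exp_minus field_simps)
  ultimately have "(flat k \<longlongrightarrow> 0) (at_right 0)" by (rule Lim_transform_eventually)
  moreover have "(flat k \<longlongrightarrow> 0) (at_left 0)"
  proof (rule Lim_transform_eventually[OF tendsto_const])
    show "\<forall>\<^sub>F t in at_left 0. 0 = flat k t"
      by (auto simp: eventually_at_filter flat_def)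
  qed
  ultimately show ?thesis by (rule filterlim_split_at_real[rotated])
qed

lemma flat_has_derivative:
  "(flat k has_real_derivative flat (k + 2) t + - real k * flat (k + 1) t) (at t)"
proof (cases t "0::real" rule: linorder_cases)
  case less
  have "(flat k has_real_derivative 0) (at t)"
    by (rule has_field_derivative_transform_within_open[OF DERIV_const, where S = "{..<0}"])
      (use less in \<open>auto simp: flat_def\<close>)
  then show ?thesis using less by (simp add: flat_def)
next
  case equal
  have "((\<lambda>h. (flat k (0 + h) - flat k 0) / h) \<longlongrightarrow> 0) (at 0)"
  proof (rule Lim_transform_eventually[OF flat_tendsto_0[of "Suc k"]])
    show "\<forall>\<^sub>F h in at 0. flat (Suc k) h = (flat k (0 + h) - flat k 0) / h"
      by (auto simp: eventually_at_filter flat_def)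
  qed
  then show ?thesis using equal by (simp add: DERIV_def flat_def)
next
  case greater
  have "((\<lambda>t. exp (- 1 / t) / t ^ k) has_real_derivative flat (k + 2) t + - real k * flat (k + 1) t) (at t)"
  proof -
    have "((\<lambda>t. exp (- 1 / t) / t ^ k) has_real_derivative
        (exp (- 1 / t) * (1 / (t * t)) * t ^ k - exp (- 1 / t) * (real k * t ^ (k - 1))) / (t ^ k * t ^ k)) (at t)"
      using greater by (auto intro!: derivative_eq_intros)
    moreover have "(exp (- 1 / t) * (1 / (t * t)) * t ^ k - exp (- 1 / t) * (real k * t ^ (k - 1))) / (t ^ k * t ^ k)
        = flat (k + 2) t + - real k * flat (k + 1) t"
      using greater by (cases k) (simp_all add: flat_def field_simps)
    ultimately show ?thesis by simp
  qed
  then show ?thesis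
    by (rule has_field_derivative_transform_within_open[where S = "{0<..}"])
      (use greater in \<open>auto simp: flat_def\<close>)
qed

definition bump :: "'a::euclidean_space \<Rightarrow> real \<Rightarrow> 'a \<Rightarrow> real"
  where "bump c r x = flat 0 (r\<^sup>2 - (x - c) \<bullet> (x - c))"

lemma C_diff_flat_paraboloid:
  "C_diff n (\<lambda>x::'a::euclidean_space. flat k (r\<^sup>2 - (x - c) \<bullet> (x - c)))"
proof (induction n arbitrary: k)
  let ?q = "\<lambda>x::'a. r\<^sup>2 - (x - c) \<bullet> (x - c)"
  have der: "((\<lambda>x. flat k (?q x)) has_derivative
      (\<lambda>h. (flat (k + 2) (?q x) + - real k * flat (k + 1) (?q x)) * (- 2 * ((x - c) \<bullet> h)))) (at x)" for k x
  proof -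
    have "(?q has_derivative (\<lambda>h. - 2 * ((x - c) \<bullet> h))) (at x)"
      by (auto intro!: derivative_eq_intros simp: inner_commute algebra_simps)
    moreover have "(flat k has_derivative
        (\<lambda>u. (flat (k + 2) (?q x) + - real k * flat (k + 1) (?q x)) * u)) (at (?q x))"
      using flat_has_derivative[of k "?q x"] unfolding has_field_derivative_def .
    ultimately show ?thesis by (rule has_derivative_compose)
  qed
  {
    case 0
    have "continuous (at x) (\<lambda>x. flat k (?q x))" for x by (rule has_derivative_continuous[OF der])
    then show ?case by (simp add: continuous_on_eq_continuous_at)
  next
    case (Suc n)
    show ?case
      by (rule C_diff_SucI[OF der]) (intro C_diff_mult C_diff_add C_diff_const C_diff_affine Suc.IH)
  }
qed

lemma smooth_bump: "smooth (bump c r)"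
  unfolding smooth_def bump_def using C_diff_flat_paraboloid by blast

lemma bump_pos_iff: "0 < r \<Longrightarrow> 0 < bump c r x \<longleftrightarrow> x \<in> ball c r"
proof -
  assume "0 < r"
  have "0 < r\<^sup>2 - (x - c) \<bullet> (x - c) \<longleftrightarrow> (norm (x - c))\<^sup>2 < r\<^sup>2"
    by (simp add: power2_norm_eq_inner)
  also have "\<dots> \<longleftrightarrow> norm (x - c) < r"
    using \<open>0 < r\<close> by (auto intro: power_strict_mono power2_less_imp_less)
  finally have "0 < r\<^sup>2 - (x - c) \<bullet> (x - c) \<longleftrightarrow> norm (x - c) < r" .
  then show ?thesis by (auto simp: bump_def flat_def dist_norm norm_minus_commute)
qed

lemma bump_nonneg: "0 \<le> bump c r x"
  by (simp add: bump_def flat_def)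

lemma smooth_sum: "(\<And>i. i \<in> I \<Longrightarrow> smooth (f i)) \<Longrightarrow> smooth (\<lambda>x. \<Sum>i\<in>I. f i x)"
  unfolding smooth_def by (auto intro: C_diff_sum)

lemma smooth_mult: "smooth f \<Longrightarrow> smooth g \<Longrightarrow> smooth (\<lambda>x. f x * g x)"
  unfolding smooth_def by (auto intro: C_diff_mult)

text \<open>A finite sum of bumps centred in \<open>D\<close>. Instead of the usual normalisation \<open>\<eta> = 1\<close> near \<open>D\<close> it has a
  positive lower bound \<open>c\<close> there, obtained from compactness of \<open>{x. infdist x D \<le> \<epsilon>/2}\<close>; this bounds \<open>\<bar>u\<bar>\<close>
  by \<open>\<bar>\<eta> u\<bar> / c\<close>.\<close>

lemma smooth_cutoff_exists:
  fixes D U :: "'a::euclidean_space set"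
  assumes D: "compact D" "D \<noteq> {}" and U: "open U" "D \<subseteq> U"
  obtains \<eta> \<delta> c where "smooth \<eta>" "compact (supp \<eta>)" "supp \<eta> \<subseteq> U" "0 < \<delta>" "0 < c"
    "\<And>x. infdist x D < \<delta> \<Longrightarrow> c \<le> \<eta> x"
proof -
  have "\<exists>r. \<forall>y\<in>D. 0 < r y \<and> cball y (r y) \<subseteq> U"
    using U open_contains_cball by (intro bchoice) blast
  then obtain r where r: "\<And>y. y \<in> D \<Longrightarrow> 0 < r y" "\<And>y. y \<in> D \<Longrightarrow> cball y (r y) \<subseteq> U" by blast
  obtain T where T: "T \<subseteq> D" "finite T" "D \<subseteq> (\<Union>y\<in>T. ball y (r y))"
  proof (rule compactE_image[OF D(1), of D "\<lambda>y. ball y (r y)"])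
    show "D \<subseteq> (\<Union>y\<in>D. ball y (r y))" using r(1) by force
  qed (use that in auto)
  define \<eta> where "\<eta> x = (\<Sum>y\<in>T. bump y (r y) x)" for x
  have smooth: "smooth \<eta>" unfolding \<eta>_def by (intro smooth_sum smooth_bump)
  have pos: "0 < \<eta> x" if x: "x \<in> (\<Union>y\<in>T. ball y (r y))" for x
  proof -
    obtain y where y: "y \<in> T" "x \<in> ball y (r y)" using x by blast
    show ?thesis unfolding \<eta>_def
      by (rule sum_pos2[OF T(2) y(1)]) (use y T(1) r(1) bump_pos_iff[of "r y" y x] in \<open>auto simp: bump_nonneg\<close>)
  qed
  let ?C = "\<Union>y\<in>T. cball y (r y)"
  have C: "compact ?C" by (intro compact_UN T(2)) auto
  have zero: "\<eta> x = 0" if "x \<notin> ?C" for x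
    unfolding \<eta>_def
  proof (rule sum.neutral, rule ballI)
    fix y assume y: "y \<in> T"
    then have "\<not> 0 < bump y (r y) x"
      using that T(1) r(1)[of y] by (subst bump_pos_iff) (auto simp: not_less less_imp_le)
    then show "bump y (r y) x = 0" using bump_nonneg[of y "r y" x] by simp
  qed
  have sub: "supp \<eta> \<subseteq> ?C"
    unfolding supp_def
  proof (intro closure_minimal compact_imp_closed C subsetI)
    show "x \<in> ?C" if "x \<in> {x. \<eta> x \<noteq> 0}" for x using zero[of x] that by blast
  qed
  have comp: "compact (supp \<eta>)"
  proof -
    have "supp \<eta> = ?C \<inter> supp \<eta>" using sub by blast
    moreover have "compact (?C \<inter> supp \<eta>)" unfolding supp_def by (intro compact_Int_closed C closed_closure)
    ultimately show ?thesis by simp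
  qed
  let ?W = "\<Union>y\<in>T. ball y (r y)"
  have "\<exists>d>0. \<forall>x\<in>D. \<forall>y\<in>- ?W. d \<le> dist x y"
    using T(3) by (intro separate_compact_closed[OF D(1)] closed_Compl open_UN) auto
  then obtain \<epsilon> where \<epsilon>: "0 < \<epsilon>" "\<forall>x\<in>D. \<forall>y\<in>- ?W. \<epsilon> \<le> dist x y" by (elim exE conjE)
  let ?N = "{x. infdist x D \<le> \<epsilon> / 2}"
  have N: "compact ?N" using \<epsilon>(1) by (intro compact_infdist_le D) auto
  have "?N \<subseteq> ?W"
  proof
    fix x assume x: "x \<in> ?N"
    obtain y where y: "y \<in> D" "infdist x D = dist x y"
      by (rule infdist_attains_inf[OF compact_imp_closed[OF D(1)] D(2)])
    show "x \<in> ?W"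
    proof (rule ccontr)
      assume "x \<notin> ?W"
      then have "\<epsilon> \<le> dist y x" using \<epsilon>(2) y(1) by blast
      then show False using x \<epsilon>(1) y(2) by (simp add: dist_commute)
    qed
  qed
  obtain z where z: "z \<in> ?N" "\<And>x. x \<in> ?N \<Longrightarrow> \<eta> z \<le> \<eta> x"
  proof -
    obtain y where "y \<in> D" using D(2) by blast
    then have "y \<in> ?N" using \<epsilon>(1) by (simp add: infdist_zero)
    then have "?N \<noteq> {}" by blast
    moreover have "continuous_on ?N \<eta>" using smooth_differentiable(3)[OF smooth] continuous_on_subset by blast
    ultimately show ?thesis using continuous_attains_inf[OF N] that by blast
  qed
  have c: "0 < \<eta> z" using pos z(1) \<open>?N \<subseteq> ?W\<close> by blast
  show thesis
  proof (rule that[OF smooth comp _ _ c])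
    show "supp \<eta> \<subseteq> U" using sub T(1) r(2) by blast
    show "0 < \<epsilon> / 2" using \<epsilon>(1) by simp
    show "\<eta> z \<le> \<eta> x" if "infdist x D < \<epsilon> / 2" for x using z(2)[of x] that by simp
  qed
qed

lemma supp_mult: "supp (\<lambda>x. f x * g x) \<subseteq> supp f \<inter> supp g"
  unfolding supp_def by (intro Int_greatest closure_mono) auto

lemma grad_mult:
  fixes f g :: "'a::euclidean_space \<Rightarrow> real"
  assumes "smooth f" "smooth g"
  shows "grad (\<lambda>x. f x * g x) x = f x *\<^sub>R grad g x + g x *\<^sub>R grad f x"
proof -
  have "((\<lambda>x. f x * g x) has_derivative
      (\<lambda>h. f x * frechet_derivative g (at x) h + frechet_derivative f (at x) h * g x)) (at x)"
    by (rule has_derivative_mult[OF smooth_differentiable(2)[OF assms(1)] smooth_differentiable(2)[OF assms(2)]])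
  from frechet_derivative_at[OF this, symmetric]
  have "frechet_derivative (\<lambda>x. f x * g x) (at x)
      = (\<lambda>h. f x * frechet_derivative g (at x) h + frechet_derivative f (at x) h * g x)" .
  then show ?thesis
    by (simp add: grad_def scaleR_sum_right scaleR_add_left sum.distrib mult.commute)
qed

section \<open>Sobolev functions\<close>

lemma borel_measurable_lebesgue_on:
  fixes f :: "'a::euclidean_space \<Rightarrow> 'b::euclidean_space"
  assumes "continuous_on UNIV f"
  shows "f \<in> borel_measurable (lebesgue_on S)"
proof -
  have "f \<in> borel_measurable lborel" using borel_measurable_continuous_onI[OF assms] by simp
  then show ?thesis by (intro measurable_restrict_space1 measurable_completion)
qed

lemma nn_integral_lebesgue_on_mono:
  assumes "S \<in> sets lebesgue" "T \<in> sets lebesgue" "S \<subseteq> T"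
  shows "(\<integral>\<^sup>+x. f x \<partial>lebesgue_on S) \<le> (\<integral>\<^sup>+x. f x \<partial>lebesgue_on T)"
proof -
  have "(\<integral>\<^sup>+x. f x \<partial>lebesgue_on S) = (\<integral>\<^sup>+x. f x * indicator S x \<partial>lebesgue)"
    by (rule nn_integral_restrict_space) (use assms in simp)
  also have "\<dots> \<le> (\<integral>\<^sup>+x. f x * indicator T x \<partial>lebesgue)"
    using assms(3) by (intro nn_integral_mono) (auto simp: indicator_def)
  also have "\<dots> = (\<integral>\<^sup>+x. f x \<partial>lebesgue_on T)"
    by (rule nn_integral_restrict_space[symmetric]) (use assms in simp)
  finally show ?thesis .
qed

lemma nn_integral_lebesgue_on_UNIV:
  assumes "f \<in> borel_measurable borel"
  shows "(\<integral>\<^sup>+x. f x \<partial>lebesgue_on UNIV) = (\<integral>\<^sup>+x. f x \<partial>lborel)"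
  using assms by (simp add: nn_integral_restrict_space nn_integral_completion)

text \<open>Finiteness of a nonnegative integral replaces integrability, so that estimates can be made in
  \<open>ennreal\<close> before anything is known to be integrable.\<close>

lemma in_Lp_iff:
  "in_Lp p S f \<longleftrightarrow> f \<in> borel_measurable (lebesgue_on S) \<and>
    (\<integral>\<^sup>+x. ennreal (norm (f x) powr p) \<partial>lebesgue_on S) < \<infinity>"
proof (cases "f \<in> borel_measurable (lebesgue_on S)")
  case True
  then have "(\<lambda>x. norm (f x) powr p) \<in> borel_measurable (lebesgue_on S)" by measurable
  then show ?thesis using True by (simp add: in_Lp_def integrable_iff_bounded)
qed (simp add: in_Lp_def)

lemma Lp_norm_powr:
  assumes "in_Lp p S f" "0 < p"
  shows "(\<integral>\<^sup>+x. ennreal (norm (f x) powr p) \<partial>lebesgue_on S) = ennreal (Lp_norm p S f powr p)"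
proof -
  have int: "integrable (lebesgue_on S) (\<lambda>x. norm (f x) powr p)" using assms by (simp add: in_Lp_def)
  have "Lp_norm p S f powr p = (\<integral>x. norm (f x) powr p \<partial>lebesgue_on S)"
    using assms(2) by (simp add: Lp_norm_def powr_powr)
  then show ?thesis using nn_integral_eq_integral[OF int] by simp
qed

text \<open>The \<open>p\<close>-th power of the Sobolev norm as an extended nonnegative number. Unlike \<open>sob_norm\<close>, which is
  \<open>0\<close> for non-integrable data, it is meaningful without integrability.\<close>

definition energy :: "real \<Rightarrow> 'a::euclidean_space set \<Rightarrow> 'a sob \<Rightarrow> ennreal"
  where "energy p S w = (\<integral>\<^sup>+x. ennreal (norm (snd w x) powr p + \<bar>fst w x\<bar> powr p) \<partial>lebesgue_on S)"

lemma sob_norm_powr: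
  assumes "in_Lp p S (fst w)" "in_Lp p S (snd w)" "0 < p"
  shows "energy p S w = ennreal (sob_norm p S w powr p)"
proof -
  have int: "integrable (lebesgue_on S) (\<lambda>x. norm (snd w x) powr p + \<bar>fst w x\<bar> powr p)"
    using assms by (auto simp: in_Lp_def)
  have "sob_norm p S w powr p = (\<integral>x. norm (snd w x) powr p + \<bar>fst w x\<bar> powr p \<partial>lebesgue_on S)"
    using assms(3) by (simp add: sob_norm_def powr_powr)
  then show ?thesis using nn_integral_eq_integral[OF int] by (simp add: energy_def)
qed

lemma sob_norm_nonneg: "0 \<le> sob_norm p S w"
  by (simp add: sob_norm_def)

lemma in_Lp_diff:
  fixes f g :: "'a::euclidean_space \<Rightarrow> 'b::euclidean_space"
  assumes f: "in_Lp p S f" and g: "in_Lp p S g" and p: "0 < p"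
  shows "in_Lp p S (\<lambda>x. f x - g x)"
proof -
  have [measurable]: "f \<in> borel_measurable (lebesgue_on S)" "g \<in> borel_measurable (lebesgue_on S)"
    using f g by (auto simp: in_Lp_def)
  have "(\<integral>\<^sup>+x. ennreal (norm (f x - g x) powr p) \<partial>lebesgue_on S) \<le>
      (\<integral>\<^sup>+x. ennreal (2 powr p) * (ennreal (norm (f x) powr p) + ennreal (norm (g x) powr p)) \<partial>lebesgue_on S)"
  proof (rule nn_integral_mono)
    fix x
    have "norm (f x - g x) powr p \<le> (norm (f x) + norm (g x)) powr p"
      using p by (intro powr_mono2 norm_triangle_ineq4) auto
    also have "\<dots> \<le> 2 powr p * (norm (f x) powr p + norm (g x) powr p)"
      using p by (intro powr_add_le) auto
    finally show "ennreal (norm (f x - g x) powr p) \<le>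
        ennreal (2 powr p) * (ennreal (norm (f x) powr p) + ennreal (norm (g x) powr p))"
      by (simp flip: ennreal_mult ennreal_plus add: ennreal_leI)
  qed
  also have "\<dots> < \<infinity>"
    using f g by (simp add: nn_integral_cmult nn_integral_add in_Lp_iff ennreal_mult_less_top)
  finally show ?thesis by (simp add: in_Lp_iff)
qed

lemma in_Lp_smooth_vanishing:
  fixes v :: "'a::euclidean_space \<Rightarrow> real"
  assumes v: "v \<in> smooth_vanishing E" and S: "S \<in> sets lebesgue" and p: "0 < p"
  shows "in_Lp p S v" "in_Lp p S (grad v)"
proof -
  have sm: "smooth v" "compact (supp v)" using v by (auto simp: smooth_vanishing_def)
  have fin: "in_Lp p S f" if f: "continuous_on UNIV f" and van: "\<And>x. x \<notin> supp v \<Longrightarrow> f x = 0"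
    for f :: "'a \<Rightarrow> 'b::euclidean_space"
  proof -
    have cont: "continuous_on UNIV (\<lambda>x. norm (f x) powr p)"
      using p by (intro continuous_on_powr' continuous_intros f) auto
    then have [measurable]: "(\<lambda>x. norm (f x) powr p) \<in> borel_measurable borel"
      by (rule borel_measurable_continuous_onI)
    have "(\<integral>\<^sup>+x. ennreal (norm (f x) powr p) \<partial>lebesgue_on S) \<le> (\<integral>\<^sup>+x. ennreal (norm (f x) powr p) \<partial>lebesgue_on UNIV)"
      by (rule nn_integral_lebesgue_on_mono) (use S in auto)
    also have "\<dots> = (\<integral>\<^sup>+x. ennreal (norm (f x) powr p) \<partial>lborel)"
      by (rule nn_integral_lebesgue_on_UNIV) measurable
    also have "\<dots> < \<infinity>"
      by (rule nn_integral_compact_support_finite[OF cont compact_imp_bounded[OF sm(2)]]) (use van in auto)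
    finally show ?thesis using borel_measurable_lebesgue_on[OF f] by (simp add: in_Lp_iff)
  qed
  show "in_Lp p S v" by (intro fin smooth_differentiable(3) sm) (simp add: zero_outside_supp)
  show "in_Lp p S (grad v)" by (intro fin continuous_grad sm) (simp add: zero_outside_supp)
qed

lemma sob_diff_eq:
  "sob_lincomb 1 w (- 1) z = (\<lambda>x. fst w x - fst z x, \<lambda>x. snd w x - snd z x)"
  by (simp add: sob_lincomb_def)

text \<open>On \<open>{d \<ge> \<tau>}\<close> the weight is bounded, so there \<open>L\<^sup>p\<close> convergence of the approximants carries the estimate to
  the limit, with a constant independent of \<open>\<tau>\<close>; then \<open>\<tau> \<rightarrow> 0\<close> by monotone convergence. Points of \<open>D\<close>
  contribute nothing, as \<open>x / 0 = 0\<close>.\<close>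

lemma hardy_passes_to_limit:
  fixes D E :: "'a::euclidean_space set"
  assumes p: "0 < p" and DE: "D \<subseteq> E" and K: "0 < K"
    and hardy: "\<And>v. v \<in> smooth_vanishing D \<Longrightarrow>
      (\<integral>\<^sup>+x. ennreal (\<bar>v x / infdist x D\<bar> powr p) \<partial>lborel) \<le>
        ennreal K * ((\<integral>\<^sup>+x. ennreal (norm (grad v x) powr p) \<partial>lborel) + (\<integral>\<^sup>+x. ennreal (\<bar>v x\<bar> powr p) \<partial>lborel))"
    and w: "w \<in> sobolev p UNIV E"
  shows "(\<integral>\<^sup>+x. ennreal (\<bar>fst w x / infdist x D\<bar> powr p) \<partial>lebesgue_on UNIV) \<le>
    ennreal (4 powr p * K * sob_norm p UNIV w powr p)"
proof -
  let ?d = "\<lambda>x. infdist x D" and ?M = "lebesgue_on (UNIV :: 'a set)"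
  let ?N = "sob_norm p UNIV"
  obtain z where wL: "in_Lp p UNIV (fst w)" "in_Lp p UNIV (snd w)"
    and z: "\<And>n. z n \<in> smooth_vanishing E"
    and lim: "(\<lambda>n. ?N (sob_lincomb 1 w (- 1) (z n, grad (z n)))) \<longlonglongrightarrow> 0"
    using w unfolding sobolev_def by blast
  define e where "e n = ?N (sob_lincomb 1 w (- 1) (z n, grad (z n))) powr p" for n
  have e0: "0 \<le> e n" for n by (simp add: e_def)
  have e: "e \<longlonglongrightarrow> 0"
    unfolding e_def using tendsto_powr'[OF lim tendsto_const, of p] p by (simp add: sob_norm_nonneg)
  have zD: "z n \<in> smooth_vanishing D" for n using z[of n] DE by (auto simp: smooth_vanishing_def)
  have zL: "in_Lp p UNIV (z n)" "in_Lp p UNIV (grad (z n))" for n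
    using in_Lp_smooth_vanishing[OF z _ p] by auto
  have dL: "in_Lp p UNIV (\<lambda>x. fst w x - z n x)" "in_Lp p UNIV (\<lambda>x. snd w x - grad (z n) x)" for n
    using in_Lp_diff[OF wL(1) zL(1) p] in_Lp_diff[OF wL(2) zL(2) p] by auto
  have [measurable]: "fst w \<in> borel_measurable ?M" "snd w \<in> borel_measurable ?M"
      "z n \<in> borel_measurable ?M" "grad (z n) \<in> borel_measurable ?M" for n
    using wL zL by (auto simp: in_Lp_def)
  have [measurable]: "?d \<in> borel_measurable ?M"
    by (intro borel_measurable_lebesgue_on continuous_intros)
  have en: "energy p UNIV (\<lambda>x. fst w x - z n x, \<lambda>x. snd w x - grad (z n) x) = ennreal (e n)" for n
    using sob_norm_powr[of p UNIV "(\<lambda>x. fst w x - z n x, \<lambda>x. snd w x - grad (z n) x)"] dL p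
    by (simp add: e_def sob_diff_eq)
  define S where "S = ?N w powr p"
  have S0: "0 \<le> S" by (simp add: S_def)
  have Sw: "energy p UNIV w = ennreal S" using sob_norm_powr[OF wL p] by (simp add: S_def)
  have zen: "energy p UNIV (z n, grad (z n)) \<le> ennreal (2 powr p * (S + e n))" for n
  proof -
    have "energy p UNIV (z n, grad (z n)) \<le> (\<integral>\<^sup>+x. ennreal (2 powr p) *
        (ennreal (norm (snd w x) powr p + \<bar>fst w x\<bar> powr p) +
         ennreal (norm (snd w x - grad (z n) x) powr p + \<bar>fst w x - z n x\<bar> powr p)) \<partial>?M)"
      unfolding energy_def
    proof (rule nn_integral_mono)
      fix x
      have tri: "norm b powr p \<le> 2 powr p * (norm a powr p + norm (a - b) powr p)"
        for a b :: "'c::real_normed_vector"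
      proof -
        have "norm b \<le> norm a + norm (a - b)" by norm
        then have "norm b powr p \<le> (norm a + norm (a - b)) powr p" using p by (intro powr_mono2) auto
        also have "\<dots> \<le> 2 powr p * (norm a powr p + norm (a - b) powr p)" using p by (intro powr_add_le) auto
        finally show ?thesis .
      qed
      have "norm (grad (z n) x) powr p + \<bar>z n x\<bar> powr p \<le> 2 powr p *
          ((norm (snd w x) powr p + \<bar>fst w x\<bar> powr p) +
           (norm (snd w x - grad (z n) x) powr p + \<bar>fst w x - z n x\<bar> powr p))"
        using tri[of "grad (z n) x" "snd w x"] tri[of "z n x" "fst w x"] by (simp add: algebra_simps)
      then show "ennreal (norm (snd (z n, grad (z n)) x) powr p + \<bar>fst (z n, grad (z n)) x\<bar> powr p) \<le>
          ennreal (2 powr p) * (ennreal (norm (snd w x) powr p + \<bar>fst w x\<bar> powr p) +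
         ennreal (norm (snd w x - grad (z n) x) powr p + \<bar>fst w x - z n x\<bar> powr p))"
        by (simp flip: ennreal_mult ennreal_plus add: ennreal_leI)
    qed
    also have "\<dots> = ennreal (2 powr p) * (energy p UNIV w +
        energy p UNIV (\<lambda>x. fst w x - z n x, \<lambda>x. snd w x - grad (z n) x))"
      by (simp add: energy_def nn_integral_cmult nn_integral_add)
    also have "\<dots> = ennreal (2 powr p * (S + e n))"
      unfolding Sw en using S0 e0 by (simp flip: ennreal_mult ennreal_plus)
    finally show ?thesis .
  qed
  have hz: "(\<integral>\<^sup>+x. ennreal (\<bar>z n x / ?d x\<bar> powr p) \<partial>?M) \<le> ennreal (K * (2 powr p * (S + e n)))" for n
  proof -
    have sm: "smooth (z n)" using z[of n] by (simp add: smooth_vanishing_def)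
    have [measurable]: "z n \<in> borel_measurable borel" "grad (z n) \<in> borel_measurable borel"
        "?d \<in> borel_measurable borel"
      by (intro borel_measurable_continuous_onI smooth_differentiable(3) continuous_grad sm continuous_intros)+
    have "(\<integral>\<^sup>+x. ennreal (\<bar>z n x / ?d x\<bar> powr p) \<partial>?M) = (\<integral>\<^sup>+x. ennreal (\<bar>z n x / ?d x\<bar> powr p) \<partial>lborel)"
      by (rule nn_integral_lebesgue_on_UNIV) measurable
    also have "\<dots> \<le> ennreal K * ((\<integral>\<^sup>+x. ennreal (norm (grad (z n) x) powr p) \<partial>lborel) +
        (\<integral>\<^sup>+x. ennreal (\<bar>z n x\<bar> powr p) \<partial>lborel))"
      by (rule hardy[OF zD])
    also have "(\<integral>\<^sup>+x. ennreal (norm (grad (z n) x) powr p) \<partial>lborel) + (\<integral>\<^sup>+x. ennreal (\<bar>z n x\<bar> powr p) \<partial>lborel)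
        = (\<integral>\<^sup>+x. ennreal (norm (grad (z n) x) powr p) + ennreal (\<bar>z n x\<bar> powr p) \<partial>lborel)"
      by (rule nn_integral_add[symmetric]) measurable
    also have "\<dots> = (\<integral>\<^sup>+x. ennreal (norm (grad (z n) x) powr p) + ennreal (\<bar>z n x\<bar> powr p) \<partial>?M)"
      by (rule nn_integral_lebesgue_on_UNIV[symmetric]) measurable
    also have "\<dots> = energy p UNIV (z n, grad (z n))" by (simp add: energy_def ennreal_plus)
    also have "ennreal K * energy p UNIV (z n, grad (z n)) \<le> ennreal K * ennreal (2 powr p * (S + e n))"
      by (intro mult_left_mono zen) simp
    also have "\<dots> = ennreal (K * (2 powr p * (S + e n)))"
      using K S0 e0[of n] by (intro ennreal_mult[symmetric]) auto
    finally show ?thesis .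
  qed
  define f where "f x = ennreal (\<bar>fst w x / ?d x\<bar> powr p)" for x
  have [measurable]: "f \<in> borel_measurable ?M" unfolding f_def by measurable
  have far: "(\<integral>\<^sup>+x. f x * indicator {x. \<tau> \<le> ?d x} x \<partial>?M) \<le> ennreal (4 powr p * K * S)" if \<tau>: "0 < \<tau>" for \<tau>
  proof -
    let ?F = "\<integral>\<^sup>+x. f x * indicator {x. \<tau> \<le> ?d x} x \<partial>?M"
    have "?F \<le> ennreal (2 powr p * (\<tau> powr (- p) * e n + K * (2 powr p * (S + e n))))" for n
    proof -
      have "?F \<le> (\<integral>\<^sup>+x. ennreal (2 powr p) * (ennreal (\<tau> powr (- p)) *
          ennreal (norm (snd w x - grad (z n) x) powr p + \<bar>fst w x - z n x\<bar> powr p) +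
          ennreal (\<bar>z n x / ?d x\<bar> powr p)) \<partial>?M)"
      proof (rule nn_integral_mono)
        fix x
        show "f x * indicator {x. \<tau> \<le> ?d x} x \<le> ennreal (2 powr p) * (ennreal (\<tau> powr (- p)) *
          ennreal (norm (snd w x - grad (z n) x) powr p + \<bar>fst w x - z n x\<bar> powr p) +
          ennreal (\<bar>z n x / ?d x\<bar> powr p))"
        proof (cases "\<tau> \<le> ?d x")
          case True
          have "\<bar>fst w x / ?d x\<bar> \<le> \<bar>(fst w x - z n x) / ?d x\<bar> + \<bar>z n x / ?d x\<bar>"
            unfolding diff_divide_distrib by linarith
          also have "\<bar>(fst w x - z n x) / ?d x\<bar> \<le> \<bar>fst w x - z n x\<bar> / \<tau>"
            using True \<tau> by (simp add: frac_le)
          finally have "\<bar>fst w x / ?d x\<bar> powr p \<le> (\<bar>fst w x - z n x\<bar> / \<tau> + \<bar>z n x / ?d x\<bar>) powr p"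
            using p by (intro powr_mono2) auto
          also have "\<dots> \<le> 2 powr p * ((\<bar>fst w x - z n x\<bar> / \<tau>) powr p + \<bar>z n x / ?d x\<bar> powr p)"
            using p \<tau> by (intro powr_add_le) auto
          also have "(\<bar>fst w x - z n x\<bar> / \<tau>) powr p = \<tau> powr (- p) * \<bar>fst w x - z n x\<bar> powr p"
            using \<tau> by (simp add: powr_divide powr_minus_divide)
          also have "2 powr p * (\<tau> powr (- p) * \<bar>fst w x - z n x\<bar> powr p + \<bar>z n x / ?d x\<bar> powr p) \<le>
              2 powr p * (\<tau> powr (- p) * (norm (snd w x - grad (z n) x) powr p + \<bar>fst w x - z n x\<bar> powr p) +
                \<bar>z n x / ?d x\<bar> powr p)"
            by (intro mult_left_mono add_right_mono) auto
          finally show ?thesis using True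
            by (simp flip: ennreal_mult ennreal_plus add: ennreal_leI f_def)
        qed simp
      qed
      also have "\<dots> = ennreal (2 powr p) * (ennreal (\<tau> powr (- p)) * ennreal (e n) +
          (\<integral>\<^sup>+x. ennreal (\<bar>z n x / ?d x\<bar> powr p) \<partial>?M))"
        unfolding en[symmetric] by (simp add: energy_def nn_integral_cmult nn_integral_add)
      also have "\<dots> \<le> ennreal (2 powr p) * (ennreal (\<tau> powr (- p)) * ennreal (e n) +
          ennreal (K * (2 powr p * (S + e n))))"
        by (intro mult_left_mono add_left_mono hz) simp
      also have "\<dots> = ennreal (2 powr p * (\<tau> powr (- p) * e n + K * (2 powr p * (S + e n))))"
        using K S0 e0[of n] by (simp flip: ennreal_mult ennreal_plus)
      finally show ?thesis .
    qed
    moreover have "(\<lambda>n. ennreal (2 powr p * (\<tau> powr (- p) * e n + K * (2 powr p * (S + e n)))))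
        \<longlonglongrightarrow> ennreal (2 powr p * (\<tau> powr (- p) * 0 + K * (2 powr p * (S + 0))))"
      by (intro tendsto_ennrealI tendsto_intros e)
    ultimately have "?F \<le> ennreal (2 powr p * (\<tau> powr (- p) * 0 + K * (2 powr p * (S + 0))))"
      by (intro LIMSEQ_le_const) auto
    moreover have "(4::real) powr p = 2 powr p * 2 powr p"
      using powr_mult[of 2 2 p] by simp
    ultimately show ?thesis by (simp add: ac_simps)
  qed
  have "(\<lambda>k. \<integral>\<^sup>+x. f x * indicator {x. 1 / Suc k \<le> ?d x} x \<partial>?M) \<longlonglongrightarrow> (\<integral>\<^sup>+x. f x \<partial>?M)"
  proof (rule nn_integral_LIMSEQ)
    show "incseq (\<lambda>k x. f x * indicator {x. 1 / real (Suc k) \<le> ?d x} x)"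
    proof (rule incseq_SucI, rule le_funI)
      fix k x
      have "1 / real (Suc (Suc k)) \<le> 1 / real (Suc k)" by (simp add: frac_le)
      then show "f x * indicator {x. 1 / real (Suc k) \<le> ?d x} x
          \<le> f x * indicator {x. 1 / real (Suc (Suc k)) \<le> ?d x} x"
        by (auto simp: indicator_def)
    qed
    show "(\<lambda>k. f x * indicator {x. 1 / real (Suc k) \<le> ?d x} x) \<longlonglongrightarrow> f x" for x
    proof (cases "?d x = 0")
      case False
      then have "0 < ?d x" using infdist_nonneg[of x D] by simp
      then obtain k0 where k0: "1 / real (Suc k0) < ?d x" using nat_approx_posE by blast
      have "f x * indicator {x. 1 / real (Suc k) \<le> ?d x} x = f x" if "k0 \<le> k" for k
      proof -
        have "1 / real (Suc k) \<le> 1 / real (Suc k0)" using that by (simp add: frac_le)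
        then show ?thesis using k0 by simp
      qed
      then have "\<forall>\<^sub>F k in sequentially. f x * indicator {x. 1 / real (Suc k) \<le> ?d x} x = f x"
        by (auto simp: eventually_sequentially)
      then show ?thesis by (rule tendsto_eventually)
    qed (simp add: f_def)
  qed measurable
  then have "(\<integral>\<^sup>+x. f x \<partial>?M) \<le> ennreal (4 powr p * K * S)"
    by (rule LIMSEQ_le_const2) (use far in auto)
  then show ?thesis by (simp add: f_def S_def)
qed

text \<open>The gradient component is the product rule.\<close>

definition cutoff :: "('a::euclidean_space \<Rightarrow> real) \<Rightarrow> 'a sob \<Rightarrow> 'a sob"
  where "cutoff \<eta> w = (\<lambda>x. \<eta> x * fst w x, \<lambda>x. \<eta> x *\<^sub>R snd w x + fst w x *\<^sub>R grad \<eta> x)"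

text \<open>The function \<open>\<eta>\<close> and its gradient are bounded, being continuous with compact support.\<close>

lemma cutoff_bounded:
  fixes \<eta> :: "'a::euclidean_space \<Rightarrow> real"
  assumes \<eta>: "smooth \<eta>" "compact (supp \<eta>)" and p: "0 < p"
    and sets: "\<Lambda> \<in> sets lebesgue" "\<Omega> \<in> sets lebesgue" "\<Lambda> \<subseteq> \<Omega>"
  obtains C where "0 \<le> C" "\<And>w. in_Lp p \<Omega> (fst w) \<Longrightarrow> in_Lp p \<Omega> (snd w) \<Longrightarrow>
    in_Lp p \<Lambda> (fst (cutoff \<eta> w)) \<and> in_Lp p \<Lambda> (snd (cutoff \<eta> w)) \<and>
    sob_norm p \<Lambda> (cutoff \<eta> w) \<le> C * sob_norm p \<Omega> w"
proof -
  have bdd: "\<exists>M. \<forall>x. norm (f x) \<le> M" if f: "continuous_on UNIV f" and van: "\<And>x. x \<notin> supp \<eta> \<Longrightarrow> f x = 0"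
    for f :: "'a \<Rightarrow> 'b::euclidean_space"
  proof -
    have "bounded (f ` supp \<eta>)"
      by (intro compact_imp_bounded compact_continuous_image continuous_on_subset[OF f] \<eta>) auto
    then obtain M where M: "\<forall>y\<in>f ` supp \<eta>. norm y \<le> M" unfolding bounded_iff by blast
    have "norm (f x) \<le> max M 0" for x
      using M van[of x] by (cases "x \<in> supp \<eta>") (auto simp: le_max_iff_disj)
    then show ?thesis by blast
  qed
  obtain M1 where M1: "\<And>x. \<bar>\<eta> x\<bar> \<le> M1"
    using bdd[OF smooth_differentiable(3)[OF \<eta>(1)]] by (auto simp: zero_outside_supp)
  obtain M2 where M2: "\<And>x. norm (grad \<eta> x) \<le> M2"
    using bdd[OF continuous_grad[OF \<eta>(1)]] by (auto simp: zero_outside_supp)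
  define M where "M = max M1 M2"
  have M: "\<bar>\<eta> x\<bar> \<le> M" "norm (grad \<eta> x) \<le> M" for x
    using M1[of x] M2[of x] by (auto simp: M_def)
  have M0: "0 \<le> M" using M(1)[of undefined] by linarith
  \<comment> \<open>The summand \<open>2\<^sup>p\<close> comes from the two terms of the gradient, the \<open>1\<close> from the function.\<close>
  define B where "B = (2 powr p + 1) * M powr p"
  have B0: "0 \<le> B" by (simp add: B_def)
  have main: "in_Lp p \<Lambda> (fst (cutoff \<eta> w)) \<and> in_Lp p \<Lambda> (snd (cutoff \<eta> w)) \<and>
      sob_norm p \<Lambda> (cutoff \<eta> w) \<le> B powr (1 / p) * sob_norm p \<Omega> w"
    if w: "in_Lp p \<Omega> (fst w)" "in_Lp p \<Omega> (snd w)" for w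
  proof -
    have [measurable]: "fst w \<in> borel_measurable (lebesgue_on \<Lambda>)" "snd w \<in> borel_measurable (lebesgue_on \<Lambda>)"
      using w measurable_restrict_mono[OF _ sets(3)] by (auto simp: in_Lp_def)
    have [measurable]: "\<eta> \<in> borel_measurable (lebesgue_on \<Lambda>)" "grad \<eta> \<in> borel_measurable (lebesgue_on \<Lambda>)"
      by (intro borel_measurable_lebesgue_on smooth_differentiable(3) continuous_grad \<eta>)+
    have meas: "fst (cutoff \<eta> w) \<in> borel_measurable (lebesgue_on \<Lambda>)"
        "snd (cutoff \<eta> w) \<in> borel_measurable (lebesgue_on \<Lambda>)"
      unfolding cutoff_def by simp_all
    have pt: "norm (snd (cutoff \<eta> w) x) powr p + \<bar>fst (cutoff \<eta> w) x\<bar> powr p \<le>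
        B * (norm (snd w x) powr p + \<bar>fst w x\<bar> powr p)" for x
    proof -
      have "norm (snd (cutoff \<eta> w) x) \<le> \<bar>\<eta> x\<bar> * norm (snd w x) + \<bar>fst w x\<bar> * norm (grad \<eta> x)"
        unfolding cutoff_def snd_conv by (rule order_trans[OF norm_triangle_ineq]) simp
      also have "\<dots> \<le> M * norm (snd w x) + \<bar>fst w x\<bar> * M"
        by (intro add_mono mult_left_mono mult_right_mono M) auto
      finally have "norm (snd (cutoff \<eta> w) x) powr p \<le> (M * norm (snd w x) + \<bar>fst w x\<bar> * M) powr p"
        using p by (intro powr_mono2) auto
      also have "\<dots> \<le> 2 powr p * ((M * norm (snd w x)) powr p + (\<bar>fst w x\<bar> * M) powr p)"
        using p M0 by (intro powr_add_le) auto
      finally have 1: "norm (snd (cutoff \<eta> w) x) powr p \<le>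
          2 powr p * (M powr p * norm (snd w x) powr p + \<bar>fst w x\<bar> powr p * M powr p)"
        unfolding powr_mult .
      have "\<bar>fst (cutoff \<eta> w) x\<bar> powr p \<le> (M * \<bar>fst w x\<bar>) powr p"
        using p M(1)[of x] by (intro powr_mono2) (auto simp: cutoff_def abs_mult mult_right_mono)
      then have 2: "\<bar>fst (cutoff \<eta> w) x\<bar> powr p \<le> M powr p * \<bar>fst w x\<bar> powr p"
        unfolding powr_mult .
      have "B * (norm (snd w x) powr p + \<bar>fst w x\<bar> powr p) =
          2 powr p * (M powr p * norm (snd w x) powr p + \<bar>fst w x\<bar> powr p * M powr p) +
          M powr p * \<bar>fst w x\<bar> powr p + M powr p * norm (snd w x) powr p"
        by (simp add: B_def algebra_simps)
      moreover have "0 \<le> M powr p * norm (snd w x) powr p" by simp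
      ultimately show ?thesis using 1 2 by linarith
    qed
    have "energy p \<Lambda> (cutoff \<eta> w) \<le>
        (\<integral>\<^sup>+x. ennreal B * ennreal (norm (snd w x) powr p + \<bar>fst w x\<bar> powr p) \<partial>lebesgue_on \<Lambda>)"
      unfolding energy_def
    proof (rule nn_integral_mono)
      fix x
      have "ennreal (norm (snd (cutoff \<eta> w) x) powr p + \<bar>fst (cutoff \<eta> w) x\<bar> powr p)
          \<le> ennreal (B * (norm (snd w x) powr p + \<bar>fst w x\<bar> powr p))"
        by (rule ennreal_leI[OF pt])
      also have "\<dots> = ennreal B * ennreal (norm (snd w x) powr p + \<bar>fst w x\<bar> powr p)"
        using B0 by (intro ennreal_mult) auto
      finally show "ennreal (norm (snd (cutoff \<eta> w) x) powr p + \<bar>fst (cutoff \<eta> w) x\<bar> powr p)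
          \<le> ennreal B * ennreal (norm (snd w x) powr p + \<bar>fst w x\<bar> powr p)" .
    qed
    also have "\<dots> \<le> ennreal B * energy p \<Omega> w"
      unfolding energy_def
      by (subst nn_integral_cmult) (auto intro!: mult_left_mono nn_integral_lebesgue_on_mono sets)
    also have "energy p \<Omega> w = ennreal (sob_norm p \<Omega> w powr p)" by (rule sob_norm_powr[OF w p])
    finally have le: "energy p \<Lambda> (cutoff \<eta> w) \<le> ennreal (B * sob_norm p \<Omega> w powr p)"
      using B0 by (simp add: ennreal_mult)
    also have "\<dots> < \<infinity>" by simp
    finally have fin: "energy p \<Lambda> (cutoff \<eta> w) < \<infinity>" .
    have "(\<integral>\<^sup>+x. ennreal (norm (fst (cutoff \<eta> w) x) powr p) \<partial>lebesgue_on \<Lambda>) \<le> energy p \<Lambda> (cutoff \<eta> w)"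
      "(\<integral>\<^sup>+x. ennreal (norm (snd (cutoff \<eta> w) x) powr p) \<partial>lebesgue_on \<Lambda>) \<le> energy p \<Lambda> (cutoff \<eta> w)"
      unfolding energy_def by (auto intro!: nn_integral_mono ennreal_leI)
    then have L: "in_Lp p \<Lambda> (fst (cutoff \<eta> w))" "in_Lp p \<Lambda> (snd (cutoff \<eta> w))"
      using fin meas by (auto simp: in_Lp_iff intro: le_less_trans)
    have "sob_norm p \<Lambda> (cutoff \<eta> w) powr p \<le> B * sob_norm p \<Omega> w powr p"
      using le B0 unfolding sob_norm_powr[OF L p] by (subst (asm) ennreal_le_iff) auto
    then have "(sob_norm p \<Lambda> (cutoff \<eta> w) powr p) powr (1 / p) \<le> (B * sob_norm p \<Omega> w powr p) powr (1 / p)"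
      using p by (intro powr_mono2) auto
    then have "sob_norm p \<Lambda> (cutoff \<eta> w) \<le> B powr (1 / p) * sob_norm p \<Omega> w"
      using p unfolding powr_mult powr_powr by (simp add: sob_norm_nonneg)
    with L show ?thesis by blast
  qed
  show thesis by (rule that[OF _ main]) auto
qed

lemma smooth_vanishing_mult:
  assumes "smooth \<eta>" "compact (supp \<eta>)" "supp \<eta> \<inter> E \<subseteq> D" "v \<in> smooth_vanishing D"
  shows "(\<lambda>x. \<eta> x * v x) \<in> smooth_vanishing E"
proof -
  have v: "smooth v" "supp v \<inter> D = {}" using assms(4) by (auto simp: smooth_vanishing_def)
  have sub: "supp (\<lambda>x. \<eta> x * v x) \<subseteq> supp \<eta> \<inter> supp v" by (rule supp_mult)
  have "compact (supp \<eta> \<inter> supp (\<lambda>x. \<eta> x * v x))"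
    unfolding supp_def[of "\<lambda>x. \<eta> x * v x"] by (intro compact_Int_closed assms(2) closed_closure)
  moreover have "supp \<eta> \<inter> supp (\<lambda>x. \<eta> x * v x) = supp (\<lambda>x. \<eta> x * v x)" using sub by blast
  moreover have "supp (\<lambda>x. \<eta> x * v x) \<inter> E = {}" using sub v(2) assms(3) by blast
  ultimately show ?thesis
    using smooth_mult[OF assms(1) v(1)] by (simp add: smooth_vanishing_def)
qed

text \<open>If \<open>v\<^sub>n\<close> approximates \<open>w\<close>, then \<open>\<eta> v\<^sub>n\<close> approximates the cut-off of \<open>w\<close>: by the product rule the difference is
  the cut-off of the difference, to which \<open>cutoff_bounded\<close> applies.\<close>

lemma cutoff_in_sobolev:
  fixes \<eta> :: "'a::euclidean_space \<Rightarrow> real"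
  assumes \<eta>: "smooth \<eta>" "compact (supp \<eta>)" and p: "0 < p"
    and sets: "\<Lambda> \<in> sets lebesgue" "\<Omega> \<in> sets lebesgue" "\<Lambda> \<subseteq> \<Omega>"
    and E: "supp \<eta> \<inter> E \<subseteq> D"
  obtains C where "0 \<le> C" "\<And>w. w \<in> sobolev p \<Omega> D \<Longrightarrow>
    cutoff \<eta> w \<in> sobolev p \<Lambda> E \<and> sob_norm p \<Lambda> (cutoff \<eta> w) \<le> C * sob_norm p \<Omega> w"
proof (rule cutoff_bounded[OF \<eta> p sets])
  fix C :: real
  assume C: "0 \<le> C" and bound: "\<And>w. in_Lp p \<Omega> (fst w) \<Longrightarrow> in_Lp p \<Omega> (snd w) \<Longrightarrow>
    in_Lp p \<Lambda> (fst (cutoff \<eta> w)) \<and> in_Lp p \<Lambda> (snd (cutoff \<eta> w)) \<and>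
    sob_norm p \<Lambda> (cutoff \<eta> w) \<le> C * sob_norm p \<Omega> w"
  have main: "cutoff \<eta> w \<in> sobolev p \<Lambda> E \<and> sob_norm p \<Lambda> (cutoff \<eta> w) \<le> C * sob_norm p \<Omega> w"
    if w: "w \<in> sobolev p \<Omega> D" for w
  proof -
    obtain v where wL: "in_Lp p \<Omega> (fst w)" "in_Lp p \<Omega> (snd w)"
      and v: "\<And>n. v n \<in> smooth_vanishing D"
      and lim: "(\<lambda>n. sob_norm p \<Omega> (sob_lincomb 1 w (- 1) (v n, grad (v n)))) \<longlonglongrightarrow> 0"
      using w unfolding sobolev_def by blast
    define \<eta>v where "\<eta>v n = (\<lambda>x. \<eta> x * v n x)" for n
    have \<eta>v: "\<eta>v n \<in> smooth_vanishing E" for n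
      unfolding \<eta>v_def by (rule smooth_vanishing_mult[OF \<eta> E v])
    have sv: "smooth (v n)" for n using v[of n] by (simp add: smooth_vanishing_def)
    have eq: "sob_lincomb 1 (cutoff \<eta> w) (- 1) (\<eta>v n, grad (\<eta>v n))
        = cutoff \<eta> (sob_lincomb 1 w (- 1) (v n, grad (v n)))" for n
      unfolding sob_diff_eq cutoff_def \<eta>v_def
      by (simp add: grad_mult[OF \<eta>(1) sv] algebra_simps)
    have le: "sob_norm p \<Lambda> (sob_lincomb 1 (cutoff \<eta> w) (- 1) (\<eta>v n, grad (\<eta>v n)))
        \<le> C * sob_norm p \<Omega> (sob_lincomb 1 w (- 1) (v n, grad (v n)))" for n
    proof -
      have "in_Lp p \<Omega> (fst (sob_lincomb 1 w (- 1) (v n, grad (v n))))"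
        "in_Lp p \<Omega> (snd (sob_lincomb 1 w (- 1) (v n, grad (v n))))"
        using in_Lp_diff[OF wL(1) in_Lp_smooth_vanishing(1)[OF v sets(2) p] p]
          in_Lp_diff[OF wL(2) in_Lp_smooth_vanishing(2)[OF v sets(2) p] p]
        by (simp_all add: sob_diff_eq)
      from bound[OF this] show ?thesis unfolding eq by blast
    qed
    have "(\<lambda>n. sob_norm p \<Lambda> (sob_lincomb 1 (cutoff \<eta> w) (- 1) (\<eta>v n, grad (\<eta>v n)))) \<longlonglongrightarrow> 0"
    proof (rule tendsto_sandwich[OF _ _ tendsto_const])
      show "(\<lambda>n. C * sob_norm p \<Omega> (sob_lincomb 1 w (- 1) (v n, grad (v n)))) \<longlonglongrightarrow> 0"
        using tendsto_mult_left[OF lim, of C] by simp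
    qed (use le in \<open>auto simp: sob_norm_nonneg\<close>)
    then have "cutoff \<eta> w \<in> sobolev p \<Lambda> E"
      using bound[OF wL] \<eta>v unfolding sobolev_def by blast
    then show ?thesis using bound[OF wL] by blast
  qed
  show thesis by (rule that[OF C main])
qed

section \<open>Hardy's inequality on the domain\<close>

theorem theorem9p3:
  fixes \<Omega> D :: "'a::euclidean_space set" and p :: real
  assumes "domain \<Omega>" and "bounded \<Omega>"
    and "closed D" and "D \<subseteq> frontier \<Omega>"
    and "1 < p"
    and i: "\<exists>l. real DIM('a) - p < l \<and> l \<le> real DIM('a) \<and> thick l D"
    and ii: "equivalently_normed_by_gradient p \<Omega> D"
    and iii: "\<exists>U V. open U \<and> bounded U \<and> open V \<and> bounded V \<and>
        D \<subseteq> U \<and> closure V \<inter> D = {} \<and> closure \<Omega> \<subseteq> U \<union> V \<and>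
        (let \<Lambda> = \<Omega> \<inter> U; \<Gamma> = (frontier \<Omega> - D) \<inter> U; E = frontier \<Lambda> - \<Gamma>
         in domain \<Lambda> \<and> (\<exists>\<FF>. sobolev_extension_operator p \<Lambda> E \<FF>))"
  shows "\<exists>c>0. \<forall>(u, grad_u) \<in> sobolev p \<Omega> D.
      (\<integral>\<^sup>+x. ennreal (\<bar>u x / infdist x D\<bar> powr p) \<partial>lebesgue_on \<Omega>)
        \<le> ennreal c * (\<integral>\<^sup>+x. ennreal (norm (grad_u x) powr p) \<partial>lebesgue_on \<Omega>)"
proof -
  let ?d = "\<lambda>x. infdist x D"
  have p: "1 < p" "0 < p" using \<open>1 < p\<close> by auto
  obtain l where l: "real DIM('a) - p < l" "thick l D" using i by blast
  have D: "compact D" "D \<noteq> {}" using l(2) by (auto simp: thick_def)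
  have \<Omega>: "open \<Omega>" using \<open>domain \<Omega>\<close> by (simp add: domain_def)
  obtain U \<FF> where U: "open U" "D \<subseteq> U"
    and F: "sobolev_extension_operator p (\<Omega> \<inter> U) (frontier (\<Omega> \<inter> U) - (frontier \<Omega> - D) \<inter> U) \<FF>"
    using iii unfolding Let_def by blast
  define \<Lambda> where "\<Lambda> = \<Omega> \<inter> U"
  define E where "E = frontier \<Lambda> - (frontier \<Omega> - D) \<inter> U"
  have \<Lambda>: "open \<Lambda>" "\<Lambda> \<subseteq> \<Omega>" using \<Omega> U by (auto simp: \<Lambda>_def)
  have sets: "\<Lambda> \<in> sets lebesgue" "\<Omega> \<in> sets lebesgue" using \<Lambda> \<Omega> by auto
  have DE: "D \<subseteq> E"
  proof
    fix x assume x: "x \<in> D"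
    then have "x \<in> closure \<Omega>" "x \<notin> \<Omega>" "x \<in> U"
      using \<open>D \<subseteq> frontier \<Omega>\<close> \<Omega> U(2) by (auto simp: frontier_def interior_open)
    then have "x \<in> closure \<Lambda>" using open_Int_closure_subset[OF U(1), of \<Omega>] by (auto simp: \<Lambda>_def Int_commute)
    with \<open>x \<notin> \<Omega>\<close> x \<Lambda> show "x \<in> E" by (auto simp: E_def frontier_def interior_open)
  qed
  have EU: "U \<inter> E \<subseteq> D"
  proof
    fix x assume x: "x \<in> U \<inter> E"
    then have "x \<in> closure \<Lambda>" "x \<notin> \<Lambda>" using \<Lambda> by (auto simp: E_def frontier_def interior_open)
    then have "x \<in> closure \<Omega>" "x \<notin> \<Omega>" using x closure_mono[OF \<Lambda>(2)] by (auto simp: \<Lambda>_def)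
    then have "x \<in> frontier \<Omega>" using \<Omega> by (simp add: frontier_def interior_open)
    then show "x \<in> D" using x by (auto simp: E_def)
  qed
  obtain \<eta> \<delta> c where \<eta>: "smooth \<eta>" "compact (supp \<eta>)" "supp \<eta> \<subseteq> U" and \<delta>: "0 < \<delta>" and c: "0 < c"
    and \<eta>c: "\<And>x. ?d x < \<delta> \<Longrightarrow> c \<le> \<eta> x"
    by (rule smooth_cutoff_exists[OF D U]) (rule that)
  have suppE: "supp \<eta> \<inter> E \<subseteq> D" using \<eta>(3) EU by blast
  obtain C1 where C1: "0 \<le> C1" and cut: "\<And>w. w \<in> sobolev p \<Omega> D \<Longrightarrow>
      cutoff \<eta> w \<in> sobolev p \<Lambda> E \<and> sob_norm p \<Lambda> (cutoff \<eta> w) \<le> C1 * sob_norm p \<Omega> w"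
    by (rule cutoff_in_sobolev[OF \<eta>(1,2) p(2) sets \<Lambda>(2) suppE]) (rule that)
  obtain C2 where FW: "\<And>w. w \<in> sobolev p \<Lambda> E \<Longrightarrow> \<FF> w \<in> sobolev p UNIV E"
    and Fnorm: "\<And>w. w \<in> sobolev p \<Lambda> E \<Longrightarrow> sob_norm p UNIV (\<FF> w) \<le> C2 * sob_norm p \<Lambda> w"
    and Fext: "\<And>w. w \<in> sobolev p \<Lambda> E \<Longrightarrow> AE x in lebesgue_on \<Lambda>. fst (\<FF> w) x = fst w x"
    using F unfolding sobolev_extension_operator_def \<Lambda>_def[symmetric] E_def[symmetric] by blast
  obtain K where K: "0 < K" and hardy: "\<And>v. v \<in> smooth_vanishing D \<Longrightarrow>
      (\<integral>\<^sup>+x. ennreal (\<bar>v x / ?d x\<bar> powr p) \<partial>lborel) \<le>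
        ennreal K * ((\<integral>\<^sup>+x. ennreal (norm (grad v x) powr p) \<partial>lborel) + (\<integral>\<^sup>+x. ennreal (\<bar>v x\<bar> powr p) \<partial>lborel))"
    by (rule thick_imp_hardy_smooth[OF p(1) l]) (rule that)
  obtain a where a: "0 < a" and poincare: "\<And>w. w \<in> sobolev p \<Omega> D \<Longrightarrow> a * sob_norm p \<Omega> w \<le> Lp_norm p \<Omega> (snd w)"
    using ii unfolding equivalently_normed_by_gradient_def by blast
  define A where "A = c powr (- p) * (4 powr p * K * (max C2 0 * C1) powr p) + \<delta> powr (- p)"
  have A: "0 < A" using c K \<delta> by (auto simp: A_def intro!: add_nonneg_pos)
  define M where "M = A * a powr (- p)"
  have M: "0 < M" using A a by (simp add: M_def)
  have "(\<integral>\<^sup>+x. ennreal (\<bar>u x / ?d x\<bar> powr p) \<partial>lebesgue_on \<Omega>)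
        \<le> ennreal M * (\<integral>\<^sup>+x. ennreal (norm (g x) powr p) \<partial>lebesgue_on \<Omega>)"
    if ug: "(u, g) \<in> sobolev p \<Omega> D" for u g
  proof -
    let ?w = "cutoff \<eta> (u, g)"
    let ?N = "sob_norm p \<Omega> (u, g)"
    have uL: "in_Lp p \<Omega> u" "in_Lp p \<Omega> g" using ug by (auto simp: sobolev_def)
    have w: "?w \<in> sobolev p \<Lambda> E" and wN: "sob_norm p \<Lambda> ?w \<le> C1 * ?N" using cut[OF ug] by auto
    have fst_w: "fst ?w x = \<eta> x * u x" for x by (simp add: cutoff_def)
    have [measurable]: "u \<in> borel_measurable (lebesgue_on \<Omega>)" using uL by (simp add: in_Lp_def)
    have [measurable]: "?d \<in> borel_measurable (lebesgue_on S)" "\<eta> \<in> borel_measurable (lebesgue_on S)" for S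
      by (intro borel_measurable_lebesgue_on continuous_intros smooth_differentiable(3) \<eta>(1))+
    \<comment> \<open>The operator bound may be negative when all norms vanish, hence \<open>max C2 0\<close>.\<close>
    have FN: "sob_norm p UNIV (\<FF> ?w) \<le> max C2 0 * C1 * ?N"
    proof -
      have "sob_norm p UNIV (\<FF> ?w) \<le> C2 * sob_norm p \<Lambda> ?w" by (rule Fnorm[OF w])
      also have "\<dots> \<le> max C2 0 * sob_norm p \<Lambda> ?w" by (intro mult_right_mono sob_norm_nonneg) simp
      also have "\<dots> \<le> max C2 0 * (C1 * ?N)" by (intro mult_left_mono wN) simp
      finally show ?thesis by (simp add: mult.assoc)
    qed
    have "(\<integral>\<^sup>+x. ennreal (\<bar>\<eta> x * u x / ?d x\<bar> powr p) \<partial>lebesgue_on \<Lambda>)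
        = (\<integral>\<^sup>+x. ennreal (\<bar>fst (\<FF> ?w) x / ?d x\<bar> powr p) \<partial>lebesgue_on \<Lambda>)"
      by (rule nn_integral_cong_AE) (use Fext[OF w] in \<open>eventually_elim, simp add: fst_w\<close>)
    also have "\<dots> \<le> (\<integral>\<^sup>+x. ennreal (\<bar>fst (\<FF> ?w) x / ?d x\<bar> powr p) \<partial>lebesgue_on UNIV)"
      by (rule nn_integral_lebesgue_on_mono) (use sets in auto)
    also have "\<dots> \<le> ennreal (4 powr p * K * sob_norm p UNIV (\<FF> ?w) powr p)"
      by (rule hardy_passes_to_limit[OF p(2) DE K hardy FW[OF w]])
    also have "\<dots> \<le> ennreal (4 powr p * K * (max C2 0 * C1 * ?N) powr p)"
      using p K by (intro ennreal_leI mult_left_mono powr_mono2 FN) (auto simp: sob_norm_nonneg)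
    finally have near: "(\<integral>\<^sup>+x. ennreal (\<bar>\<eta> x * u x / ?d x\<bar> powr p) \<partial>lebesgue_on \<Lambda>)
        \<le> ennreal (4 powr p * K * (max C2 0 * C1) powr p * ?N powr p)"
      unfolding powr_mult by (simp add: ac_simps)
    have "(\<integral>\<^sup>+x. ennreal (\<bar>u x\<bar> powr p) \<partial>lebesgue_on \<Omega>) \<le> energy p \<Omega> (u, g)"
      unfolding energy_def by (intro nn_integral_mono ennreal_leI) simp
    also have "\<dots> = ennreal (?N powr p)" using sob_norm_powr[of p \<Omega> "(u, g)"] uL p by simp
    finally have far: "(\<integral>\<^sup>+x. ennreal (\<bar>u x\<bar> powr p) \<partial>lebesgue_on \<Omega>) \<le> ennreal (?N powr p)" .
    have "(\<integral>\<^sup>+x. ennreal (\<bar>u x / ?d x\<bar> powr p) \<partial>lebesgue_on \<Omega>) \<le>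
        (\<integral>\<^sup>+x. ennreal (c powr (- p)) * (ennreal (\<bar>\<eta> x * u x / ?d x\<bar> powr p) * indicator \<Lambda> x) +
          ennreal (\<delta> powr (- p)) * ennreal (\<bar>u x\<bar> powr p) \<partial>lebesgue_on \<Omega>)"
    proof (rule nn_integral_mono)
      fix x assume "x \<in> space (lebesgue_on \<Omega>)"
      then have x: "x \<in> \<Omega>" by simp
      show "ennreal (\<bar>u x / ?d x\<bar> powr p) \<le>
          ennreal (c powr (- p)) * (ennreal (\<bar>\<eta> x * u x / ?d x\<bar> powr p) * indicator \<Lambda> x) +
          ennreal (\<delta> powr (- p)) * ennreal (\<bar>u x\<bar> powr p)"
      proof (cases "?d x < \<delta>")
        case True
        have \<eta>x: "c \<le> \<eta> x" by (rule \<eta>c[OF True])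
        \<comment> \<open>Near \<open>D\<close> the cut-off function is at least \<open>c\<close>; in particular \<open>x\<close> lies in \<open>U\<close>.\<close>
        then have "x \<in> supp \<eta>" using zero_outside_supp(1)[of x \<eta>] c by force
        then have x\<Lambda>: "x \<in> \<Lambda>" using x \<eta>(3) by (auto simp: \<Lambda>_def)
        have "c * \<bar>u x / ?d x\<bar> \<le> \<bar>\<eta> x\<bar> * \<bar>u x / ?d x\<bar>"
          using \<eta>x c by (intro mult_right_mono) auto
        also have "\<dots> = \<bar>\<eta> x * u x / ?d x\<bar>" by (simp add: abs_mult)
        finally have "\<bar>u x / ?d x\<bar> \<le> \<bar>\<eta> x * u x / ?d x\<bar> / c" unfolding pos_le_divide_eq[OF c] by (simp only: mult.commute)
        then have "\<bar>u x / ?d x\<bar> powr p \<le> (\<bar>\<eta> x * u x / ?d x\<bar> / c) powr p" using p by (intro powr_mono2) auto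
        also have "\<dots> = c powr (- p) * \<bar>\<eta> x * u x / ?d x\<bar> powr p"
          using c unfolding powr_divide powr_minus_divide by simp
        finally have "ennreal (\<bar>u x / ?d x\<bar> powr p) \<le> ennreal (c powr (- p)) * ennreal (\<bar>\<eta> x * u x / ?d x\<bar> powr p)"
          by (simp flip: ennreal_mult add: ennreal_leI)
        then show ?thesis using x\<Lambda> by (simp add: add_increasing2)
      next
        case False
        have "\<bar>u x / ?d x\<bar> \<le> \<bar>u x\<bar> / \<delta>" using False \<delta> by (simp add: frac_le)
        then have "\<bar>u x / ?d x\<bar> powr p \<le> (\<bar>u x\<bar> / \<delta>) powr p" using p by (intro powr_mono2) auto
        also have "\<dots> = \<delta> powr (- p) * \<bar>u x\<bar> powr p"
          using \<delta> unfolding powr_divide powr_minus_divide by simp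
        finally have "ennreal (\<bar>u x / ?d x\<bar> powr p) \<le> ennreal (\<delta> powr (- p)) * ennreal (\<bar>u x\<bar> powr p)"
          by (simp flip: ennreal_mult add: ennreal_leI)
        then show ?thesis by (simp add: add_increasing)
      qed
    qed
    also have "\<dots> = ennreal (c powr (- p)) *
          (\<integral>\<^sup>+x. ennreal (\<bar>\<eta> x * u x / ?d x\<bar> powr p) * indicator \<Lambda> x \<partial>lebesgue_on \<Omega>) +
        ennreal (\<delta> powr (- p)) * (\<integral>\<^sup>+x. ennreal (\<bar>u x\<bar> powr p) \<partial>lebesgue_on \<Omega>)"
    proof -
      have [measurable]: "\<Lambda> \<in> sets (lebesgue_on \<Omega>)"
        using sets \<Lambda>(2) by (simp add: sets_restrict_space_iff)
      show ?thesis by (simp add: nn_integral_add nn_integral_cmult)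
    qed
    also have "(\<integral>\<^sup>+x. ennreal (\<bar>\<eta> x * u x / ?d x\<bar> powr p) * indicator \<Lambda> x \<partial>lebesgue_on \<Omega>)
        = (\<integral>\<^sup>+x. ennreal (\<bar>\<eta> x * u x / ?d x\<bar> powr p) \<partial>lebesgue_on \<Lambda>)"
    proof -
      have "indicator \<Lambda> x * indicator \<Omega> x = (indicator \<Lambda> x :: ennreal)" for x
        using \<Lambda>(2) by (auto simp: indicator_def)
      then show ?thesis using sets by (simp add: nn_integral_restrict_space mult.assoc)
    qed
    also have "ennreal (c powr (- p)) * \<dots> + ennreal (\<delta> powr (- p)) * (\<integral>\<^sup>+x. ennreal (\<bar>u x\<bar> powr p) \<partial>lebesgue_on \<Omega>)
        \<le> ennreal (c powr (- p)) * ennreal (4 powr p * K * (max C2 0 * C1) powr p * ?N powr p) +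
          ennreal (\<delta> powr (- p)) * ennreal (?N powr p)"
      by (intro add_mono mult_left_mono near far) auto
    also have "\<dots> = ennreal (A * ?N powr p)"
    proof -
      have "A * ?N powr p = c powr (- p) * (4 powr p * K * (max C2 0 * C1) powr p * ?N powr p) +
          \<delta> powr (- p) * ?N powr p"
        by (simp add: A_def algebra_simps)
      then show ?thesis using K by (simp add: ennreal_mult ennreal_plus)
    qed
    also have "\<dots> \<le> ennreal (M * Lp_norm p \<Omega> g powr p)"
    proof (rule ennreal_leI)
      have "?N \<le> Lp_norm p \<Omega> g / a" using poincare[OF ug] unfolding pos_le_divide_eq[OF a] by (simp add: mult.commute)
      then have "?N powr p \<le> (Lp_norm p \<Omega> g / a) powr p"
        using p by (intro powr_mono2) (auto simp: sob_norm_nonneg)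
      also have "\<dots> = a powr (- p) * Lp_norm p \<Omega> g powr p"
        unfolding powr_divide powr_minus_divide by simp
      finally have "A * ?N powr p \<le> A * (a powr (- p) * Lp_norm p \<Omega> g powr p)"
        using A by (intro mult_left_mono) auto
      then show "A * ?N powr p \<le> M * Lp_norm p \<Omega> g powr p" by (simp add: M_def mult.assoc)
    qed
    also have "\<dots> = ennreal M * (\<integral>\<^sup>+x. ennreal (norm (g x) powr p) \<partial>lebesgue_on \<Omega>)"
      unfolding Lp_norm_powr[OF uL(2) p(2)] using M by (intro ennreal_mult) auto
    finally show ?thesis .
  qed
  with M show ?thesis by (intro exI[of _ M]) auto
qed

end
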